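(* Let $n$ be a square-free positive integer. If $G \in \pi_A^t(U_n)$ is nilpotent, then $d(G) \leq \log(n)$.
   Context: $\log$ is the natural logarithm. For a finite group $G$, $d(G)$ is the minimal cardinality of a generating set of $G$ (so $d(G)=0$ for the trivial group). For a square-free positive integer $n$, $\pi_A^t(U_n)$ denotes the set of (isomorphism classes of) finite groups $G$ for which there is a finite Galois extension $K/\mathbb{Q}$ with $\operatorname{Gal}(K/\mathbb{Q}) \cong G$ that is unramified at every finite prime not dividing $n$ and at most tamely ramified at every finite prime (ramification at the infinite place is allowed). *)

theory Defs
  imports
    "HOL-Algebra.Algebra"
    "HOL-Algebra.Algebraic_Closure_Type"
    "HOL-Computational_Algebra.Computational_Algebra"
begin

hide_const (open) Divisibility.prime

section \<open>Number fields\<close>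

text \<open>
  Every finite extension of the rationals embeds into the complex numbers, so, up to isomorphism,
  number fields are the subfields of the complex numbers that have finite degree over \<open>\<rat>\<close>.
\<close>

abbreviation complex_field :: "complex ring" where
  "complex_field \<equiv> ring_of_type_algebra"

definition number_field :: "complex set \<Rightarrow> bool" where
  "number_field K \<longleftrightarrow> subfield K complex_field \<and> ring.finite_dimension complex_field \<rat> K"

text \<open>
  Field automorphisms are made extensional (via \<^const>\<open>Bij\<close>), so that two of them are equal as
  functions iff they agree on \<open>K\<close>.
\<close>

definition aut_group :: "complex set \<Rightarrow> (complex \<Rightarrow> complex) monoid" where
  "aut_group K = (BijGroup K)\<lparr>carrier :=
     {\<sigma> \<in> Bij K. \<sigma> \<in> ring_hom (complex_field\<lparr>carrier := K\<rparr>) (complex_field\<lparr>carrier := K\<rparr>) \<and>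
                 (\<forall>q\<in>\<rat>. \<sigma> q = q)}\<rparr>"

text \<open>
  \<open>K/\<rat>\<close> is a finite Galois extension: it is finite, and \<open>\<rat>\<close> is the fixed field of
  \<open>Aut(K/\<rat>)\<close>.
\<close>

definition finite_galois :: "complex set \<Rightarrow> bool" where
  "finite_galois K \<longleftrightarrow> number_field K \<and>
     {x \<in> K. \<forall>\<sigma> \<in> carrier (aut_group K). \<sigma> x = x} = \<rat>"


section \<open>Ramification\<close>

definition ring_of_integers :: "complex set \<Rightarrow> complex ring" where
  "ring_of_integers K = complex_field\<lparr>carrier := {x \<in> K. algebraic_int x}\<rparr>"

definition primes_above :: "complex set \<Rightarrow> nat \<Rightarrow> complex set set" where
  "primes_above K p =
     {P. primeideal P (ring_of_integers K) \<and> P \<inter> \<int> = of_int ` {k. int p dvd k}}"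

text \<open>
  The exponent of \<open>P\<close> in the factorisation of the ideal generated by \<open>p\<close>. In a Dedekind domain to
  divide is to contain, so this is the largest \<open>k\<close> for which the \<open>k\<close>-th power of \<open>P\<close> contains that
  ideal. Powers are taken in the multiplicative monoid of ideals.
\<close>

definition ramification_index :: "complex set \<Rightarrow> nat \<Rightarrow> complex set \<Rightarrow> nat" where
  "ramification_index K p P =
     (GREATEST k. Idl\<^bsub>ring_of_integers K\<^esub> {of_nat p} \<subseteq> P [^]\<^bsub>ideals_set (ring_of_integers K)\<^esub> k)"

text \<open>
  Residue fields of number fields are finite, hence perfect, so separability of the residue field
  extensions is automatic and only the ramification indices matter.
\<close>

definition unramified_at :: "complex set \<Rightarrow> nat \<Rightarrow> bool" where
  "unramified_at K p \<longleftrightarrow> (\<forall>P \<in> primes_above K p. ramification_index K p P = 1)"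

definition tamely_ramified_at :: "complex set \<Rightarrow> nat \<Rightarrow> bool" where
  "tamely_ramified_at K p \<longleftrightarrow> (\<forall>P \<in> primes_above K p. coprime (ramification_index K p P) p)"

text \<open>
  \<open>pi_A_t n\<close> is \<open>\<pi>\<^sub>A\<^sup>t(U\<^sub>n)\<close>. Instead of isomorphism classes it consists of all finite groups (on a given
  type) in these classes. The definition makes no demand at the infinite place.
\<close>

definition pi_A_t :: "nat \<Rightarrow> ('a, 'b) monoid_scheme set" where
  "pi_A_t n = {G. group G \<and> finite (carrier G) \<and>
     (\<exists>K. finite_galois K \<and> aut_group K \<cong> G \<and>
          (\<forall>p. prime p \<and> \<not> p dvd n \<longrightarrow> unramified_at K p) \<and>
          (\<forall>p. prime p \<longrightarrow> tamely_ramified_at K p))}"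


section \<open>Groups\<close>

primrec lower_central_series :: "('a, 'b) monoid_scheme \<Rightarrow> nat \<Rightarrow> 'a set" where
  "lower_central_series G 0 = carrier G"
| "lower_central_series G (Suc k) = generate G
     (\<Union>h \<in> lower_central_series G k. \<Union>g \<in> carrier G.
        {h \<otimes>\<^bsub>G\<^esub> g \<otimes>\<^bsub>G\<^esub> inv\<^bsub>G\<^esub> h \<otimes>\<^bsub>G\<^esub> inv\<^bsub>G\<^esub> g})"

definition nilpotent_group :: "('a, 'b) monoid_scheme \<Rightarrow> bool" where
  "nilpotent_group G \<longleftrightarrow> group G \<and> (\<exists>k. lower_central_series G k = {\<one>\<^bsub>G\<^esub>})"

text \<open>Meaningful for finitely generated groups only.\<close>

definition min_generators :: "('a, 'b) monoid_scheme \<Rightarrow> nat" where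
  "min_generators G =
     (LEAST k. \<exists>S \<subseteq> carrier G. finite S \<and> card S = k \<and> generate G S = carrier G)"

end

theory Submission
  imports Defs "Jordan_Normal_Form.Char_Poly" "Jordan_Normal_Form.Column_Operations"
    "HOL-Real_Asymp.Real_Asymp" "HOL-Number_Theory.Cong"
begin

text \<open>
  Let \<open>K/\<rat>\<close> be a tame Galois extension with nilpotent group \<open>G\<close>, unramified outside \<open>n\<close>. Tame inertia groups are
  cyclic, so choose a generator \<open>g\<^sub>p\<close> of the inertia group of one prime above each odd prime \<open>p\<close> dividing \<open>n\<close>. If
  these elements do not generate \<open>G\<close>, they lie in a maximal subgroup \<open>M\<close>, which is normal with abelian quotient
  because \<open>G\<close> is nilpotent. Then \<open>M\<close> contains all inertia groups: those above an odd \<open>p\<close> by conjugacy, and those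
  above 2 because Frobenius conjugation squares a tame inertia element there, which makes it a commutator.
  So the fixed field of \<open>M\<close> is an unramified extension of \<open>\<rat>\<close> of degree greater than one, contradicting
  Minkowski's theorem. Hence \<open>d(G)\<close> is at most the number \<open>r\<close> of odd prime divisors of \<open>n\<close>, and \<open>e\<^sup>r \<le> 3\<^sup>r \<le> n\<close>.

  Discriminants and different ideals are avoided: absence of ramification gives, for \<open>s \<notin> M\<close>, an identity
  \<open>\<Sum> x\<^sub>i s(y\<^sub>i) = 0\<close>, \<open>\<Sum> x\<^sub>i y\<^sub>i = 1\<close> with integral \<open>x\<^sub>i\<close>, \<open>y\<^sub>i\<close> (as for Galois extensions of rings), and the product of
  these identities over all \<open>s\<close> inverts the matrix of conjugates of an integral basis over the integers.
\<close>

text \<open>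
  \<^theory>\<open>HOL-Algebra.Algebra\<close> adds transitivity rules with premises of the form \<open>x \<in> UNIV\<close>, which would take
  precedence over the standard ones in calculations.
\<close>

declare order_trans_rules [trans del]
declare order_trans_rules [trans]

section \<open>Linear forms\<close>

text \<open>The logarithm pays for one generator per odd prime only: ln 2 < 1 < ln 3, so the prime 2
  must cost nothing. This is why its inertia has to be absorbed by commutators. The fixed field of M
  never appears as an extension with a degree and a Galois group of its own. Its work is done by one
  tool, Dedekind independence of characters modulo a prime P of K, with P = {0} allowed: a
  multiplicative map h that respects traces modulo P agrees modulo P with a group element. Taking
  for h the p-th power map gives Frobenius elements; taking an element outside M shows that its
  coset is separated from M by M-fixed integers; taking complex conjugation, with P = {0}, shows
  that it belongs to G. A discriminant of absolute value 1 is refuted in two cases. If complex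
  conjugation lies in M, all conjugates of M-fixed integers are real, and Minkowski's theorem for
  real linear forms applies. Otherwise M has index 2; then a congruence modulo 4 excludes -1, and
  the sign change of the square root of the discriminant excludes 1.\<close>

lemma int_matrix_clear_first_row:
  fixes A :: "int mat"
  assumes "A \<in> carrier_mat n n" "0 < n"
  shows "\<exists>U\<in>carrier_mat n n. (\<bar>det U\<bar> = 1) \<and> (\<forall>j. 0 < j \<and> j < n \<longrightarrow> (A * U) $$ (0, j) = 0)"
  using assms
proof (induction "nat (\<Sum>j<n. \<bar>A $$ (0, j)\<bar>)" arbitrary: A rule: less_induct)
  case less
  note A = less.prems(1) and n = less.prems(2)
  show ?case
  proof (cases "\<exists>j k. j < n \<and> k < n \<and> j \<noteq> k \<and> A $$ (0, k) \<noteq> 0 \<and> \<bar>A $$ (0, k)\<bar> \<le> \<bar>A $$ (0, j)\<bar>")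
    case True
    then obtain j k where jk: "j < n" "k < n" "j \<noteq> k" "A $$ (0, k) \<noteq> 0" "\<bar>A $$ (0, k)\<bar> \<le> \<bar>A $$ (0, j)\<bar>"
      by blast
    \<comment> \<open>One subtraction of the Euclidean algorithm: this sign replaces the entry a_j
      by one of absolute value |a_j| - |a_k|, so the measure drops.\<close>
    define e where "e = - sgn (A $$ (0, j)) * sgn (A $$ (0, k))"
    define V where "V = addrow_mat n e k j"
    define A' where "A' = addcol e j k A"
    have V: "V \<in> carrier_mat n n" "det V = 1"
      using jk by (auto simp: V_def det_addrow_mat)
    have A'V: "A' = A * V"
      unfolding A'_def V_def by (rule addcol_mat[OF A jk(2)])
    have A': "A' \<in> carrier_mat n n" using A V A'V by simp
    have ent: "A' $$ (0, i) = (if i = j then A $$ (0, j) + e * A $$ (0, k) else A $$ (0, i))" if "i < n" for i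
      using that A n jk by (auto simp: A'_def)
    have lt: "\<bar>A' $$ (0, j)\<bar> < \<bar>A $$ (0, j)\<bar>"
      using jk(4,5) by (auto simp: ent jk e_def sgn_if abs_if split: if_splits)
    have "(\<Sum>i<n. \<bar>A' $$ (0, i)\<bar>) < (\<Sum>i<n. \<bar>A $$ (0, i)\<bar>)"
      by (rule sum_strict_mono_ex1) (use ent lt jk in auto)
    moreover have "(\<Sum>i<n. \<bar>A' $$ (0, i)\<bar>) \<ge> 0" by (simp add: sum_nonneg)
    ultimately have "nat (\<Sum>i<n. \<bar>A' $$ (0, i)\<bar>) < nat (\<Sum>i<n. \<bar>A $$ (0, i)\<bar>)" by linarith
    from less.hyps[OF this A' n] obtain U where U: "U \<in> carrier_mat n n" "\<bar>det U\<bar> = 1"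
      "\<And>j. 0 < j \<Longrightarrow> j < n \<Longrightarrow> (A' * U) $$ (0, j) = 0" by blast
    have "A * (V * U) = A' * U" using A'V A V U by simp
    moreover have "\<bar>det (V * U)\<bar> = 1" using det_mult[OF V(1) U(1)] V U by simp
    ultimately show ?thesis using U V by (intro bexI[of _ "V * U"]) auto
  next
    case False
    show ?thesis
    proof (cases "\<exists>j. 0 < j \<and> j < n \<and> A $$ (0, j) \<noteq> 0")
      case True
      then obtain j where j: "0 < j" "j < n" "A $$ (0, j) \<noteq> 0" by blast
      have z: "A $$ (0, i) = 0" if "i < n" "i \<noteq> j" for i
      proof (rule ccontr)
        assume "A $$ (0, i) \<noteq> 0"
        moreover have "\<bar>A $$ (0, i)\<bar> \<le> \<bar>A $$ (0, j)\<bar> \<or> \<bar>A $$ (0, j)\<bar> \<le> \<bar>A $$ (0, i)\<bar>" by linarith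
        ultimately show False using False that j by blast
      qed
      define V :: "int mat" where "V = swaprows_mat n 0 j"
      have "swapcols 0 j A = A * V" unfolding V_def by (rule swapcols_mat[OF A n j(2)])
      moreover have "det V = -1" using j n by (simp add: V_def det_swaprows_mat)
      moreover have "swapcols 0 j A $$ (0, i) = 0" if "0 < i" "i < n" for i
        using that A n j z by auto
      moreover have "V \<in> carrier_mat n n" by (simp add: V_def)
      ultimately show ?thesis by (intro bexI[of _ V]) auto
    next
      case False
      thus ?thesis using A by (intro bexI[of _ "1\<^sub>m n"]) auto
    qed
  qed
qed

lemma pigeonhole_residue:
  fixes f :: "'k \<Rightarrow> int"
  assumes "finite I" "g \<noteq> 0" "int (card I) > \<bar>g\<bar> * d"
  shows "\<exists>r. int (card {k\<in>I. f k mod g = r}) > d"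
proof (rule ccontr)
  assume "\<not> ?thesis"
  hence le: "int (card {k\<in>I. f k mod g = r}) \<le> d" for r by (meson not_le)
  let ?R = "(\<lambda>r. r mod g) ` {0..<\<bar>g\<bar>}"
  have "x mod g \<in> ?R" for x
    using assms(2) by (intro image_eqI[of _ _ "x mod \<bar>g\<bar>"])
      (auto simp: mod_mod_cancel)
  hence "I = (\<Union>r\<in>?R. {k\<in>I. f k mod g = r})" by auto
  hence "card I \<le> (\<Sum>r\<in>?R. card {k\<in>I. f k mod g = r})"
    using card_UN_le[of ?R "\<lambda>r. {k\<in>I. f k mod g = r}"] by simp
  hence "int (card I) \<le> (\<Sum>r\<in>?R. int (card {k\<in>I. f k mod g = r}))"
    unfolding of_nat_sum[symmetric] by (simp only: of_nat_le_iff)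
  also have "\<dots> \<le> int (card ?R) * d" using sum_bounded_above[of ?R _ d] le by simp
  also have "\<dots> \<le> \<bar>g\<bar> * d"
  proof (rule mult_right_mono)
    show "int (card ?R) \<le> \<bar>g\<bar>" using card_image_le[of "{0..<\<bar>g\<bar>}" "\<lambda>r. r mod g"] by simp
    show "0 \<le> d" using le[of 0] by linarith
  qed
  finally have "int (card I) \<le> \<bar>g\<bar> * d" .
  thus False using assms by linarith
qed

text \<open>The columns of \<open>B\<close> span a sublattice of index |det B|, so more vectors than
  that cannot be pairwise incongruent. The index itself is never formed: column operations clear the
  first row, first coordinates are sorted by residue modulo \<open>g\<close>, and the rest is the
  same problem for the minor \<open>D\<close>, since |g| * |det D| = |det B|.\<close>

lemma pigeonhole_int_lattice:
  fixes B :: "int mat" and u :: "'k \<Rightarrow> nat \<Rightarrow> int"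
  assumes "B \<in> carrier_mat n n" "det B \<noteq> 0" "finite I" "int (card I) > \<bar>det B\<bar>"
  shows "\<exists>k\<in>I. \<exists>l\<in>I. k \<noteq> l \<and> (\<exists>m. \<forall>i<n. u k i - u l i = (\<Sum>j<n. B $$ (i, j) * m j))"
  using assms
proof (induction n arbitrary: B I u)
  case 0
  hence "card I > 1" by simp
  then obtain k l where "k \<in> I" "l \<in> I" "k \<noteq> l" using card_le_Suc0_iff_eq[OF 0(3)] by fastforce
  thus ?case by auto
next
  case (Suc n)
  note B = Suc.prems(1)
  from int_matrix_clear_first_row[OF B] obtain U where U: "U \<in> carrier_mat (Suc n) (Suc n)" "\<bar>det U\<bar> = 1"
    and z: "\<And>j. 0 < j \<Longrightarrow> j < Suc n \<Longrightarrow> (B * U) $$ (0, j) = 0" by blast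
  define A where "A = B * U"
  have A: "A \<in> carrier_mat (Suc n) (Suc n)" using B U by (simp add: A_def)
  define g where "g = A $$ (0, 0)"
  define D where "D = mat_delete A 0 0"
  have D: "D \<in> carrier_mat n n" using A by (auto simp: D_def mat_delete_def)
  have Dij: "D $$ (i, j) = A $$ (Suc i, Suc j)" if "i < n" "j < n" for i j
    using that A by (auto simp: D_def mat_delete_def)
  have "det A = (\<Sum>j<Suc n. A $$ (0, j) * cofactor A 0 j)" using laplace_expansion_row[OF A, of 0] by simp
  also have "\<dots> = (\<Sum>j\<in>{0}. A $$ (0, j) * cofactor A 0 j)"
    using z by (intro sum.mono_neutral_right) (auto simp: A_def simp del: index_mult_mat)
  also have "\<dots> = g * det D" by (simp add: g_def D_def cofactor_def)
  finally have dA: "det A = g * det D" .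
  have "\<bar>det A\<bar> = \<bar>det B\<bar>" using det_mult[OF B U(1)] U by (simp add: A_def abs_mult)
  hence nz: "g \<noteq> 0" "det D \<noteq> 0" and "int (card I) > \<bar>g\<bar> * \<bar>det D\<bar>"
    using Suc.prems dA by (auto simp: abs_mult)
  from pigeonhole_residue[OF Suc.prems(3) nz(1) this(3), of "\<lambda>k. u k 0"]
  obtain r where r: "int (card {k\<in>I. u k 0 mod g = r}) > \<bar>det D\<bar>" by blast
  define J where "J = {k\<in>I. u k 0 mod g = r}"
  define q where "q k = u k 0 div g" for k
  \<comment> \<open>Subtracting \<open>q k\<close> times the first column reduces every first
    coordinate to the common residue \<open>r\<close>; \<open>w k\<close> is the rest of the reduced
    vector, to be compared modulo \<open>D\<close>.\<close>
  define w where "w k i = u k (Suc i) - q k * A $$ (Suc i, 0)" for k i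
  have "finite J" using Suc.prems by (simp add: J_def)
  from Suc.IH[OF D nz(2) this, of w] r obtain k l m where kl: "k \<in> J" "l \<in> J" "k \<noteq> l"
    and m: "\<And>i. i < n \<Longrightarrow> w k i - w l i = (\<Sum>j<n. D $$ (i, j) * m j)" unfolding J_def by blast
  define m1 where "m1 j = (case j of 0 \<Rightarrow> q k - q l | Suc j \<Rightarrow> m j)" for j
  have eqA: "u k i - u l i = (\<Sum>j<Suc n. A $$ (i, j) * m1 j)" if "i < Suc n" for i
  proof (cases i)
    case 0
    have "(\<Sum>j<Suc n. A $$ (0, j) * m1 j) = g * (q k - q l)"
      using z by (subst sum.lessThan_Suc_shift) (simp add: m1_def g_def A_def del: index_mult_mat)
    moreover have "u k 0 = g * q k + r" "u l 0 = g * q l + r"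
      using kl mult_div_mod_eq[of g "u l 0"] by (auto simp: J_def q_def)
    ultimately show ?thesis using 0 by (simp add: algebra_simps)
  next
    case (Suc i')
    hence "w k i' - w l i' = (\<Sum>j<n. A $$ (Suc i', Suc j) * m j)"
      using m[of i'] that by (simp add: Dij)
    moreover have "(\<Sum>j<Suc n. A $$ (Suc i', j) * m1 j)
       = A $$ (Suc i', 0) * (q k - q l) + (\<Sum>j<n. A $$ (Suc i', Suc j) * m j)"
      by (subst sum.lessThan_Suc_shift) (simp add: m1_def)
    ultimately show ?thesis using Suc by (simp add: w_def algebra_simps)
  qed
  define m2 where "m2 k = (\<Sum>j<Suc n. U $$ (k, j) * m1 j)" for k
  have "u k i - u l i = (\<Sum>j<Suc n. B $$ (i, j) * m2 j)" if i: "i < Suc n" for i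
  proof -
    have "u k i - u l i = (\<Sum>j<Suc n. (\<Sum>h<Suc n. B $$ (i, h) * U $$ (h, j)) * m1 j)"
      unfolding eqA[OF i] using B U i
      by (intro sum.cong) (auto simp: A_def scalar_prod_def lessThan_atLeast0)
    also have "\<dots> = (\<Sum>j<Suc n. \<Sum>h<Suc n. B $$ (i, h) * U $$ (h, j) * m1 j)"
      by (simp only: sum_distrib_right)
    also have "\<dots> = (\<Sum>h<Suc n. \<Sum>j<Suc n. B $$ (i, h) * U $$ (h, j) * m1 j)" by (rule sum.swap)
    also have "\<dots> = (\<Sum>j<Suc n. B $$ (i, j) * m2 j)"
      by (simp only: m2_def sum_distrib_left mult.assoc)
    finally show ?thesis .
  qed
  thus ?case using kl by (intro bexI[of _ k] bexI[of _ l]) (auto simp: J_def)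
qed


text \<open>Minkowski's theorem without volumes: the forms are scaled by a large \<open>q\<close>
  and rounded to integer forms, the pigeonhole principle is applied to a box of integer points
  slightly larger than the scaled bounds, and a limit removes the slack.\<close>

lemma minkowski_linear_forms:
  fixes A :: "real mat" and c :: "nat \<Rightarrow> real"
  assumes A: "A \<in> carrier_mat n n" and n: "0 < n" and det: "det A \<noteq> 0"
    and c: "\<And>i. i < n \<Longrightarrow> 0 < c i" and prod: "\<bar>det A\<bar> \<le> (\<Prod>i<n. c i)"
  shows "\<exists>m :: nat \<Rightarrow> int. (\<exists>j<n. m j \<noteq> 0) \<and> (\<forall>i<n. \<bar>\<Sum>j<n. A $$ (i, j) * m j\<bar> \<le> c i)"
proof -
  define Am :: "(nat \<Rightarrow> int) \<Rightarrow> nat \<Rightarrow> real" where "Am m i = (\<Sum>j<n. A $$ (i, j) * m j)" for m i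
  define Z where "Z = (1 / det A) \<cdot>\<^sub>m adj_mat A"
  have Z: "Z \<in> carrier_mat n n" and ZA: "Z * A = 1\<^sub>m n"
    using adj_mat[OF A] det A mult_smult_assoc_mat[of "adj_mat A" n n A n "1 / det A"]
    by (auto simp: Z_def intro!: eq_matI)
  \<comment> \<open>A bound for the inverse of \<open>A\<close>: small values of the forms force
    small coefficients.\<close>
  define K where "K = (\<Sum>k<n. \<Sum>i<n. \<bar>Z $$ (k, i)\<bar>)"
  have K0: "K \<ge> 0" by (simp add: K_def sum_nonneg)
  have inv: "real_of_int \<bar>m k\<bar> \<le> K * (\<Sum>i<n. \<bar>Am m i\<bar>)" if k: "k < n" for m k
  proof -
    have "real_of_int (m k) = (\<Sum>j<n. (Z * A) $$ (k, j) * m j)"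
      unfolding ZA using k by (simp add: sum.delta' if_distrib if_distribR cong: if_cong)
    also have "\<dots> = (\<Sum>j<n. \<Sum>i<n. Z $$ (k, i) * A $$ (i, j) * m j)"
      using A Z k by (intro sum.cong) (auto simp: scalar_prod_def lessThan_atLeast0 sum_distrib_right)
    also have "\<dots> = (\<Sum>i<n. Z $$ (k, i) * Am m i)"
      by (subst sum.swap) (simp add: Am_def sum_distrib_left mult.assoc)
    finally have "\<bar>real_of_int (m k)\<bar> \<le> (\<Sum>i<n. \<bar>Z $$ (k, i)\<bar> * \<bar>Am m i\<bar>)"
      using sum_abs[of "\<lambda>i. Z $$ (k, i) * Am m i" "{..<n}"] by (simp add: abs_mult)
    also have "\<dots> \<le> (\<Sum>i<n. K * \<bar>Am m i\<bar>)"
    proof (intro sum_mono mult_right_mono)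
      fix i assume "i \<in> {..<n}"
      hence "\<bar>Z $$ (k, i)\<bar> \<le> (\<Sum>i<n. \<bar>Z $$ (k, i)\<bar>)" by (intro member_le_sum) auto
      also have "\<dots> \<le> K" unfolding K_def
        using k by (intro member_le_sum[of k "{..<n}" "\<lambda>k. \<Sum>i<n. \<bar>Z $$ (k, i)\<bar>"]) (auto simp: sum_nonneg)
      finally show "\<bar>Z $$ (k, i)\<bar> \<le> K" .
    qed auto
    finally show ?thesis by (simp add: sum_distrib_left)
  qed
  define B where "B q = mat n n (\<lambda>(i, j). \<lfloor>real q * A $$ (i, j)\<rfloor>)" for q :: nat
  have B: "B q \<in> carrier_mat n n" for q by (simp add: B_def)
  have detB: "(\<lambda>q. real_of_int (det (B q)) / real q ^ n) \<longlonglongrightarrow> det A"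
  proof -
    have fl: "(\<lambda>q. real_of_int \<lfloor>real q * x\<rfloor> / real q) \<longlonglongrightarrow> x" for x :: real
      by real_asymp
    have eq: "real_of_int (det (B q)) / real q ^ n
      = (\<Sum>p\<in>{p. p permutes {0..<n}}. signof p * (\<Prod>i=0..<n. real_of_int \<lfloor>real q * A $$ (i, p i)\<rfloor> / real q))" for q
    proof -
      have "real_of_int (signof p * (\<Prod>i=0..<n. B q $$ (i, p i)))
        = signof p * (\<Prod>i=0..<n. real_of_int \<lfloor>real q * A $$ (i, p i)\<rfloor>)" if p: "p permutes {0..<n}" for p
      proof -
        have "p i < n" if "i < n" for i using permutes_in_image[OF p, of i] that by simp
        thus ?thesis by (simp add: B_def sign_def)
      qed
      thus ?thesis unfolding det_def'[OF B]
        by (simp add: sum_divide_distrib prod_dividef)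
    qed
    show ?thesis unfolding eq det_def'[OF A] by (intro tendsto_intros fl)
  qed
  define Cs where "Cs = (\<Sum>i<n. c i)"
  have Cs: "Cs > 0" unfolding Cs_def using c n by (intro sum_pos) auto
  \<comment> \<open>Bounds the coefficients independently of the slack: for large \<open>q\<close>
    the sum \<open>S\<close> of their absolute values satisfies S \<le> R / 2 + S / 2.\<close>
  define R where "R = 4 * real n * K * Cs"
  have R0: "R \<ge> 0" using K0 Cs by (simp add: R_def)
  have ex: "\<exists>m :: nat \<Rightarrow> int. (\<exists>j<n. m j \<noteq> 0) \<and> (\<forall>j<n. real_of_int \<bar>m j\<bar> \<le> R)
      \<and> (\<forall>i<n. \<bar>Am m i\<bar> \<le> c i * (1 + 1 / Suc k) + R / Suc k)" for k
  proof -
    define \<epsilon> where "\<epsilon> = 1 / real (Suc k)"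
    have \<epsilon>: "0 < \<epsilon>" "\<epsilon> \<le> 1" by (auto simp: \<epsilon>_def)
    have "(\<lambda>q. \<bar>real_of_int (det (B q)) / real q ^ n\<bar>) \<longlonglongrightarrow> \<bar>det A\<bar>"
      using detB by (rule tendsto_rabs)
    hence "\<forall>\<^sub>F q in sequentially. \<bar>real_of_int (det (B q)) / real q ^ n\<bar> < \<bar>det A\<bar> * (1 + \<epsilon>)"
      "\<forall>\<^sub>F q in sequentially. 0 < \<bar>real_of_int (det (B q)) / real q ^ n\<bar>"
      using det \<epsilon> by (auto intro!: order_tendstoD)
    moreover have "\<forall>\<^sub>F q in sequentially. real q \<ge> real (Suc k) \<and> real q \<ge> 2 * real n * (real n * K)"
      by (intro eventually_conj) real_asymp+
    ultimately have "\<forall>\<^sub>F q in sequentially. \<bar>real_of_int (det (B q)) / real q ^ n\<bar> < \<bar>det A\<bar> * (1 + \<epsilon>)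
      \<and> 0 < \<bar>real_of_int (det (B q)) / real q ^ n\<bar> \<and> real q \<ge> real (Suc k) \<and> real q \<ge> 2 * real n * (real n * K)"
      by eventually_elim auto
    then obtain q where q: "\<bar>real_of_int (det (B q)) / real q ^ n\<bar> < \<bar>det A\<bar> * (1 + \<epsilon>)"
      "0 < \<bar>real_of_int (det (B q)) / real q ^ n\<bar>" "real q \<ge> real (Suc k)" "real q \<ge> 2 * real n * (real n * K)"
      by (auto dest: eventually_happens)
    have q0: "real q > 0" using q(3) by linarith
    \<comment> \<open>Two integers below \<open>C i\<close> differ by at most
      \<open>C i - 1\<close>, which is less than the scaled bound, while the number of points of the
      box is at least the product of the scaled bounds.\<close>
    define C where "C i = nat \<lceil>real q * (c i * (1 + \<epsilon>))\<rceil>" for i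
    define I where "I = PiE {..<n} (\<lambda>i. {0..<int (C i)})"
    have "real_of_int \<bar>det (B q)\<bar> < real q ^ n * (\<bar>det A\<bar> * (1 + \<epsilon>))"
      using q(1) q0 by (simp add: divide_simps mult.commute)
    also have "\<dots> \<le> real q ^ n * ((\<Prod>i<n. c i) * (1 + \<epsilon>) ^ n)"
    proof (intro mult_left_mono mult_mono prod)
      show "1 + \<epsilon> \<le> (1 + \<epsilon>) ^ n" using \<epsilon> n by (intro self_le_power) auto
    qed (use \<epsilon> c in \<open>auto intro!: prod_nonneg simp: less_imp_le\<close>)
    also have "\<dots> = (\<Prod>i<n. real q * (c i * (1 + \<epsilon>)))" by (simp add: prod.distrib)
    also have "\<dots> \<le> (\<Prod>i<n. real (C i))"
    proof (intro prod_mono conjI)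
      fix i assume "i \<in> {..<n}"
      hence "0 < real q * (c i * (1 + \<epsilon>))" using q0 c \<epsilon> by (auto intro!: mult_pos_pos)
      thus "0 \<le> real q * (c i * (1 + \<epsilon>))" "real q * (c i * (1 + \<epsilon>)) \<le> real (C i)"
        by (auto simp: C_def)
    qed
    also have "\<dots> = real (card I)" by (simp add: I_def card_PiE)
    finally have "real_of_int \<bar>det (B q)\<bar> < real_of_int (int (card I))" by simp
    hence card: "\<bar>det (B q)\<bar> < int (card I)" by (simp only: of_int_less_iff)
    have "det (B q) \<noteq> 0" using q(2) by auto
    moreover have "finite I" by (auto simp: I_def intro: finite_PiE)
    ultimately obtain f g m where fg: "f \<in> I" "g \<in> I" "f \<noteq> g"
      and m: "\<And>i. i < n \<Longrightarrow> f i - g i = (\<Sum>j<n. B q $$ (i, j) * m j)"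
      using pigeonhole_int_lattice[OF B, of q I "\<lambda>f. f"] card by blast
    have nz: "\<exists>j<n. m j \<noteq> 0"
    proof (rule ccontr)
      assume "\<not> ?thesis"
      hence "f i = g i" if "i < n" for i using m[OF that] by simp
      hence "f = g" using fg(1,2) by (intro PiE_ext[of f "{..<n}" _ g]) (auto simp: I_def)
      with fg show False by simp
    qed
    define S where "S = (\<Sum>j<n. real_of_int \<bar>m j\<bar>)"
    have Am: "\<bar>Am m i\<bar> \<le> c i * (1 + \<epsilon>) + S / real q" if i: "i < n" for i
    proof -
      have pos: "0 < real q * (c i * (1 + \<epsilon>))" using q0 c i \<epsilon> by (auto intro!: mult_pos_pos)
      have "f i \<in> {0..<int (C i)}" "g i \<in> {0..<int (C i)}" using fg i by (auto simp: I_def PiE_def Pi_def)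
      hence "\<bar>f i - g i\<bar> \<le> \<lceil>real q * (c i * (1 + \<epsilon>))\<rceil> - 1" using pos by (auto simp: C_def)
      hence "real_of_int \<bar>f i - g i\<bar> \<le> real q * (c i * (1 + \<epsilon>))" by linarith
      hence 1: "\<bar>real_of_int (f i - g i) / real q\<bar> \<le> c i * (1 + \<epsilon>)"
        using q0 by (simp add: divide_simps mult_ac)
      have "Am m i = real_of_int (f i - g i) / real q + (\<Sum>j<n. (A $$ (i, j) - B q $$ (i, j) / real q) * m j)"
        unfolding Am_def m[OF i] by (simp add: sum_divide_distrib left_diff_distrib sum_subtractf)
      also have "\<bar>\<dots>\<bar> \<le> c i * (1 + \<epsilon>) + (\<Sum>j<n. \<bar>(A $$ (i, j) - B q $$ (i, j) / real q) * m j\<bar>)"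
        using 1 sum_abs[of "\<lambda>j. (A $$ (i, j) - B q $$ (i, j) / real q) * m j" "{..<n}"] by linarith
      also have "(\<Sum>j<n. \<bar>(A $$ (i, j) - B q $$ (i, j) / real q) * m j\<bar>) \<le> (\<Sum>j<n. real_of_int \<bar>m j\<bar> / real q)"
      proof (intro sum_mono)
        fix j assume "j \<in> {..<n}"
        hence "A $$ (i, j) - B q $$ (i, j) / real q = (real q * A $$ (i, j) - \<lfloor>real q * A $$ (i, j)\<rfloor>) / real q"
          using q0 i by (simp add: B_def field_simps)
        also have "\<bar>\<dots>\<bar> \<le> 1 / real q"
        proof -
          have "\<bar>real q * A $$ (i, j) - \<lfloor>real q * A $$ (i, j)\<rfloor>\<bar> \<le> 1" by linarith
          thus ?thesis using q0 by (simp only: abs_divide abs_of_pos) (simp add: divide_right_mono)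
        qed
        finally have "\<bar>A $$ (i, j) - B q $$ (i, j) / real q\<bar> * \<bar>real_of_int (m j)\<bar> \<le> 1 / real q * \<bar>real_of_int (m j)\<bar>"
          by (rule mult_right_mono) simp
        thus "\<bar>(A $$ (i, j) - B q $$ (i, j) / real q) * m j\<bar> \<le> real_of_int \<bar>m j\<bar> / real q"
          by (simp add: abs_mult)
      qed
      finally show ?thesis by (simp add: S_def sum_divide_distrib)
    qed
    have S0: "S \<ge> 0" by (simp add: S_def sum_nonneg)
    have "(\<Sum>i<n. \<bar>Am m i\<bar>) \<le> (\<Sum>i<n. c i * (1 + \<epsilon>) + S / real q)" using Am by (intro sum_mono) auto
    also have "\<dots> = Cs * (1 + \<epsilon>) + real n * (S / real q)"
      by (simp add: Cs_def sum.distrib sum_distrib_right)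
    also have "\<dots> \<le> 2 * Cs + real n * (S / real q)" using \<epsilon> Cs by (simp add: algebra_simps)
    finally have sumAm: "(\<Sum>i<n. \<bar>Am m i\<bar>) \<le> 2 * Cs + real n * (S / real q)" .
    have "S \<le> (\<Sum>j<n. K * (\<Sum>i<n. \<bar>Am m i\<bar>))" unfolding S_def using inv by (intro sum_mono) auto
    also have "\<dots> = real n * K * (\<Sum>i<n. \<bar>Am m i\<bar>)" by simp
    also have "\<dots> \<le> real n * K * (2 * Cs + real n * (S / real q))"
      using sumAm K0 by (intro mult_left_mono) auto
    also have "\<dots> = R / 2 + (real n * (real n * K) / real q) * S" by (simp add: R_def algebra_simps)
    also have "\<dots> \<le> R / 2 + 1 / 2 * S"
      using q(4) q0 S0 by (intro add_left_mono mult_right_mono) (auto simp: divide_simps)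
    finally have SR: "S \<le> R" by linarith
    have "real_of_int \<bar>m j\<bar> \<le> R" if "j < n" for j
    proof -
      have "real_of_int \<bar>m j\<bar> \<le> S" unfolding S_def
        using that by (intro member_le_sum[of j "{..<n}" "\<lambda>j. real_of_int \<bar>m j\<bar>"]) auto
      with SR show ?thesis by linarith
    qed
    moreover have "S / real q \<le> R / Suc k"
      using SR S0 q(3) by (intro frac_le) auto
    hence "\<bar>Am m i\<bar> \<le> c i * (1 + 1 / Suc k) + R / Suc k" if "i < n" for i
      using Am[OF that] by (simp add: \<epsilon>_def)
    ultimately show ?thesis using nz by blast
  qed
  then obtain m :: "nat \<Rightarrow> nat \<Rightarrow> int" where m: "\<And>k. \<exists>j<n. m k j \<noteq> 0" "\<And>k j. j < n \<Longrightarrow> real_of_int \<bar>m k j\<bar> \<le> R"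
    "\<And>k i. i < n \<Longrightarrow> \<bar>Am (m k) i\<bar> \<le> c i * (1 + 1 / Suc k) + R / Suc k" by metis
  \<comment> \<open>The solution \<open>m k\<close> depends on the slack, but all of them lie in one
    finite set. So one solution recurs for infinitely many \<open>k\<close>, and its bounds pass to
    the limit.\<close>
  define r where "r k = restrict (m k) {..<n}" for k
  have "range r \<subseteq> PiE {..<n} (\<lambda>_. {-\<lceil>R\<rceil>..\<lceil>R\<rceil>})"
  proof (clarsimp simp: r_def)
    fix k j assume "j < n"
    with m(2)[of j k] show "- \<lceil>R\<rceil> \<le> m k j \<and> m k j \<le> \<lceil>R\<rceil>" by linarith
  qed
  hence "finite (range r)" by (rule finite_subset) (auto intro: finite_PiE)
  then obtain k0 where k0: "infinite {k. r k = r k0}"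
    using pigeonhole_infinite[of UNIV r] by auto
  have "\<bar>Am (m k0) i\<bar> \<le> c i" if i: "i < n" for i
  proof (rule ccontr)
    assume "\<not> ?thesis"
    hence "\<bar>Am (m k0) i\<bar> > c i" by simp
    moreover have "(\<lambda>k. c i * (1 + 1 / Suc k) + R / Suc k) \<longlonglongrightarrow> c i" by real_asymp
    ultimately have "\<forall>\<^sub>F k in sequentially. c i * (1 + 1 / Suc k) + R / Suc k < \<bar>Am (m k0) i\<bar>"
      by (intro order_tendstoD)
    then obtain N where N: "\<And>k. k \<ge> N \<Longrightarrow> c i * (1 + 1 / Suc k) + R / Suc k < \<bar>Am (m k0) i\<bar>"
      by (auto simp: eventually_sequentially)
    obtain k where k: "k \<ge> N" "r k = r k0" using k0 by (auto simp: infinite_nat_iff_unbounded_le)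
    have "Am (m k) i = Am (m k0) i"
    proof -
      have "m k j = m k0 j" if "j < n" for j using fun_cong[OF k(2), of j] that by (simp add: r_def)
      thus ?thesis by (simp add: Am_def)
    qed
    with N[OF k(1)] m(3)[OF i, of k] show False by linarith
  qed
  thus ?thesis using m(1)[of k0] by (auto simp: Am_def)
qed


section \<open>Finitely generated subgroups of the complex numbers\<close>

definition zspan :: "complex set \<Rightarrow> complex set" where
  "zspan B = {\<Sum>b\<in>B. of_int (c b) * b | c. True}"

lemma zspan_superset: "finite B \<Longrightarrow> b \<in> B \<Longrightarrow> b \<in> zspan B"
  unfolding zspan_def
  by (intro CollectI exI[of _ "\<lambda>x. if x = b then 1 else 0"]) (simp add: if_distrib if_distribR cong: if_cong)

lemma zspan_0: "0 \<in> zspan B"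
  unfolding zspan_def by (intro CollectI exI[of _ "\<lambda>x. 0"]) simp

lemma zspan_add: assumes "x \<in> zspan B" "y \<in> zspan B" shows "x + y \<in> zspan B"
proof -
  from assms obtain c d where "x = (\<Sum>b\<in>B. of_int (c b) * b)" "y = (\<Sum>b\<in>B. of_int (d b) * b)"
    by (auto simp: zspan_def)
  thus ?thesis unfolding zspan_def
    by (intro CollectI exI[of _ "\<lambda>b. c b + d b"]) (simp add: sum.distrib distrib_right)
qed

lemma zspan_scale: assumes "x \<in> zspan B" shows "of_int k * x \<in> zspan B"
proof -
  from assms obtain c where "x = (\<Sum>b\<in>B. of_int (c b) * b)" by (auto simp: zspan_def)
  thus ?thesis unfolding zspan_def
    by (intro CollectI exI[of _ "\<lambda>b. k * c b"]) (simp add: sum_distrib_left mult.assoc)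
qed

lemma zspan_sum: "(\<And>i. i \<in> I \<Longrightarrow> f i \<in> zspan B) \<Longrightarrow> sum f I \<in> zspan B"
  by (induction I rule: infinite_finite_induct) (auto intro: zspan_add zspan_0)

lemma zspan_closed_mult:
  assumes "\<And>b. b \<in> B \<Longrightarrow> x * b \<in> zspan C" "y \<in> zspan B"
  shows "x * y \<in> zspan C"
proof -
  from assms(2) obtain c where "y = (\<Sum>b\<in>B. of_int (c b) * b)" by (auto simp: zspan_def)
  hence "x * y = (\<Sum>b\<in>B. of_int (c b) * (x * b))" by (simp add: sum_distrib_left mult_ac)
  thus ?thesis using assms(1) by (auto intro!: zspan_sum zspan_scale)
qed

text \<open>The determinant trick: multiplication by \<open>x\<close> is an integer matrix on the
  generators, the vector of generators is an eigenvector, and the characteristic polynomial is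
  monic. The generators may be linearly dependent; \<open>b0\<close> only keeps the eigenvector from
  being zero.\<close>

lemma algebraic_int_if_stabilizes_zspan:
  assumes fin: "finite B" and b0: "b0 \<in> B" "b0 \<noteq> 0" and st: "\<And>b. b \<in> B \<Longrightarrow> x * b \<in> zspan B"
  shows "algebraic_int x"
proof -
  obtain e where e: "bij_betw e {..<card B} B" using fin bij_betw_from_nat_into_finite by blast
  define n where "n = card B"
  have "\<forall>b\<in>B. \<exists>c. x * b = (\<Sum>b'\<in>B. of_int (c b') * b')" using st by (auto simp: zspan_def)
  then obtain c where c: "\<And>b. b \<in> B \<Longrightarrow> x * b = (\<Sum>b'\<in>B. of_int (c b b') * b')" by metis
  define A where "A = mat n n (\<lambda>(i, j). c (e i) (e j))"
  define v where "v = vec n e"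
  have A: "A \<in> carrier_mat n n" by (simp add: A_def)
  have row: "(\<Sum>j<n. of_int (c (e i) (e j)) * e j) = x * e i" if "i < n" for i
  proof -
    have "e i \<in> B" using e that by (auto simp: bij_betw_def n_def)
    hence "x * e i = (\<Sum>b'\<in>B. of_int (c (e i) b') * b')" by (rule c)
    also have "\<dots> = (\<Sum>j<n. of_int (c (e i) (e j)) * e j)"
      using sum.reindex_bij_betw[OF e, of "\<lambda>b'. of_int (c (e i) b') * b'"] by (simp add: n_def)
    finally show ?thesis ..
  qed
  have "eigenvector (map_mat complex_of_int A) v x"
    unfolding eigenvector_def
  proof (intro conjI)
    show "v \<in> carrier_vec (dim_row (map_mat complex_of_int A))" by (simp add: v_def A_def)
    obtain i where "i < n" "e i = b0" using e b0(1) unfolding bij_betw_def n_def by (metis imageE lessThan_iff)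
    hence "v $ i \<noteq> 0\<^sub>v n $ i" using b0 by (simp add: v_def)
    thus "v \<noteq> 0\<^sub>v (dim_row (map_mat complex_of_int A))" by (auto simp: A_def)
    show "map_mat complex_of_int A *\<^sub>v v = x \<cdot>\<^sub>v v"
      using row by (intro eq_vecI) (auto simp: A_def v_def scalar_prod_def lessThan_atLeast0)
  qed
  hence "poly (char_poly (map_mat complex_of_int A)) x = 0"
    using eigenvalue_root_char_poly[of "map_mat complex_of_int A" n x] A by (auto simp: eigenvalue_def)
  moreover have "char_poly (map_mat complex_of_int A) = map_poly of_int (char_poly A)"
    by (rule of_int_hom.char_poly_hom[OF A])
  moreover have "lead_coeff (char_poly A) = 1" using degree_monic_char_poly[OF A] by simp
  ultimately show ?thesis by (auto simp: algebraic_int_altdef_ipoly)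
qed

lemma algebraic_int_power_eq:
  fixes x :: complex
  assumes "algebraic_int x"
  shows "\<exists>d>0. \<exists>c. x ^ d = (\<Sum>i<d. of_int (c i) * x ^ i)"
proof -
  from assms obtain p where p: "poly (map_poly of_int p) x = 0" "lead_coeff p = 1"
    by (auto simp: algebraic_int_altdef_ipoly)
  define d where "d = degree p"
  have "d \<noteq> 0"
  proof
    assume "d = 0"
    hence "p = 1" using p(2) by (auto simp: d_def elim!: degree_eq_zeroE)
    with p(1) show False by simp
  qed
  have "degree (map_poly of_int p :: complex poly) = d" unfolding d_def by (rule degree_map_poly) auto
  hence "0 = (\<Sum>i\<le>d. of_int (coeff p i) * x ^ i)"
    using p(1) by (simp add: poly_altdef coeff_map_poly)
  also have "\<dots> = (\<Sum>i<d. of_int (coeff p i) * x ^ i) + x ^ d"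
    using p(2) by (simp add: lessThan_Suc_atMost[symmetric] d_def)
  finally have "x ^ d = (\<Sum>i<d. of_int (- coeff p i) * x ^ i)"
    by (simp add: sum_negf eq_neg_iff_add_eq_0 add.commute)
  thus ?thesis using \<open>d \<noteq> 0\<close> by (intro exI[of _ d] conjI exI[of _ "\<lambda>i. - coeff p i"]) auto
qed

text \<open>The monomials in \<open>x\<close> and \<open>y\<close> of exponents below the degrees of
  monic equations span a group stable under both multiplications, hence under those by the sum and
  the product.\<close>

lemma algebraic_int_add_mult_complex:
  fixes x y :: complex
  assumes "algebraic_int x" "algebraic_int y"
  shows "algebraic_int (x + y)" "algebraic_int (x * y)"
proof -
  obtain d c where d: "d > 0" "x ^ d = (\<Sum>i<d. of_int (c i) * x ^ i)"
    using algebraic_int_power_eq[OF assms(1)] by blast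
  obtain e b where e: "e > 0" "y ^ e = (\<Sum>i<e. of_int (b i) * y ^ i)"
    using algebraic_int_power_eq[OF assms(2)] by blast
  define B where "B = (\<lambda>(i, j). x ^ i * y ^ j) ` ({..<d} \<times> {..<e})"
  have fin: "finite B" by (simp add: B_def)
  have mem: "x ^ i * y ^ j \<in> zspan B" if "i < d" "j < e" for i j
    using that by (intro zspan_superset fin) (auto simp: B_def)
  have 1: "1 \<in> B" unfolding B_def using d e by (intro image_eqI[of _ _ "(0, 0)"]) auto
  have x: "x * z \<in> zspan B" if "z \<in> B" for z
  proof -
    from that obtain i j where ij: "z = x ^ i * y ^ j" "i < d" "j < e" by (auto simp: B_def)
    show ?thesis
    proof (cases "Suc i < d")
      case True
      thus ?thesis using mem[OF True ij(3)] ij by (simp add: mult.assoc)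
    next
      case False
      hence "i = d - 1" using ij by simp
      hence "x * z = x ^ d * y ^ j" using ij d(1) by (simp add: power_eq_if)
      also have "\<dots> = (\<Sum>i<d. of_int (c i) * (x ^ i * y ^ j))"
        by (simp add: d(2) sum_distrib_right mult.assoc)
      also have "\<dots> \<in> zspan B" using mem ij by (intro zspan_sum zspan_scale) auto
      finally show ?thesis .
    qed
  qed
  have y: "y * z \<in> zspan B" if "z \<in> B" for z
  proof -
    from that obtain i j where ij: "z = x ^ i * y ^ j" "i < d" "j < e" by (auto simp: B_def)
    show ?thesis
    proof (cases "Suc j < e")
      case True
      thus ?thesis using mem[OF ij(2) True] ij by (simp add: mult_ac)
    next
      case False
      hence "j = e - 1" using ij by simp
      hence "y * z = x ^ i * y ^ e" using ij e(1) by (simp add: power_eq_if mult_ac)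
      also have "\<dots> = (\<Sum>j<e. of_int (b j) * (x ^ i * y ^ j))"
        by (simp add: e(2) sum_distrib_left mult_ac)
      also have "\<dots> \<in> zspan B" using mem ij by (intro zspan_sum zspan_scale) auto
      finally show ?thesis .
    qed
  qed
  show "algebraic_int (x + y)"
    using x y 1 by (intro algebraic_int_if_stabilizes_zspan[OF fin 1]) (auto simp: distrib_right intro: zspan_add)
  show "algebraic_int (x * y)"
  proof (rule algebraic_int_if_stabilizes_zspan[OF fin 1])
    fix z assume "z \<in> B"
    from zspan_closed_mult[of B x B, OF x y[OF this]] show "x * y * z \<in> zspan B" by (simp add: mult.assoc)
  qed simp
qed

text \<open>The basis is triangular with respect to the functionals \<open>\<phi> 0, \<phi> 1, \<dots>\<close>.\<close>

lemma subgroup_integral_basis: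
  fixes A :: "complex set" and \<phi> :: "nat \<Rightarrow> complex \<Rightarrow> int"
  assumes "0 \<in> A" "\<And>x y. x \<in> A \<Longrightarrow> y \<in> A \<Longrightarrow> x - y \<in> A"
    and "\<And>i x y. i < k \<Longrightarrow> x \<in> A \<Longrightarrow> y \<in> A \<Longrightarrow> \<phi> i (x - y) = \<phi> i x - \<phi> i y"
    and "\<And>x. x \<in> A \<Longrightarrow> (\<And>i. i < k \<Longrightarrow> \<phi> i x = 0) \<Longrightarrow> x = 0"
  shows "\<exists>(r::nat) b. (\<forall>j<r. b j \<in> A) \<and> (\<forall>x\<in>A. \<exists>c. x = (\<Sum>j<r. of_int (c j) * b j))
    \<and> (\<forall>c. (\<Sum>j<r. of_int (c j) * b j) = 0 \<longrightarrow> (\<forall>j<r. c j = 0))"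
  using assms
proof (induction k arbitrary: A)
  case 0
  hence "A = {0}" by auto
  thus ?case by (intro exI[of _ 0]) auto
next
  case (Suc k)
  note A = Suc.prems(1,2) and \<phi> = Suc.prems(3) and inj = Suc.prems(4)
  have neg: "- x \<in> A" if "x \<in> A" for x using A(2)[OF A(1) that] by simp
  have add: "x + y \<in> A" if "x \<in> A" "y \<in> A" for x y using A(2)[OF that(1) neg[OF that(2)]] by simp
  have \<phi>0: "\<phi> k 0 = 0" using \<phi>[of k 0 0] A by simp
  have \<phi>neg: "\<phi> k (- x) = - \<phi> k x" if "x \<in> A" for x using \<phi>[of k 0 x] A that \<phi>0 by simp
  have \<phi>add: "\<phi> k (x + y) = \<phi> k x + \<phi> k y" if "x \<in> A" "y \<in> A" for x y
    using \<phi>[of k x "- y"] that neg \<phi>neg by simp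
  have scale: "of_int c * x \<in> A \<and> \<phi> k (of_int c * x) = c * \<phi> k x" if "x \<in> A" for c x
  proof -
    have nat: "of_nat m * x \<in> A \<and> \<phi> k (of_nat m * x) = int m * \<phi> k x" for m
      by (induction m) (auto simp: A \<phi>0 distrib_right add \<phi>add that)
    show ?thesis
    proof (cases "c \<ge> 0")
      case True thus ?thesis using nat[of "nat c"] by simp
    next
      case False thus ?thesis using nat[of "nat (- c)"] neg[of "of_nat (nat (-c)) * x"] \<phi>neg[of "of_nat (nat (-c)) * x"] by simp
    qed
  qed
  define A' where "A' = {x\<in>A. \<phi> k x = 0}"
  have "\<exists>(r::nat) b. (\<forall>j<r. b j \<in> A') \<and> (\<forall>x\<in>A'. \<exists>c. x = (\<Sum>j<r. of_int (c j) * b j))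
    \<and> (\<forall>c. (\<Sum>j<r. of_int (c j) * b j) = 0 \<longrightarrow> (\<forall>j<r. c j = 0))"
  proof (rule Suc.IH)
    show "0 \<in> A'" using A \<phi>0 by (simp add: A'_def)
    show "x - y \<in> A'" if "x \<in> A'" "y \<in> A'" for x y using that A \<phi>[of k] by (auto simp: A'_def)
    show "\<phi> i (x - y) = \<phi> i x - \<phi> i y" if "i < k" "x \<in> A'" "y \<in> A'" for i x y
      using that \<phi> by (auto simp: A'_def)
    show "x = 0" if "x \<in> A'" "\<And>i. i < k \<Longrightarrow> \<phi> i x = 0" for x
      using that inj[of x] by (auto simp: A'_def less_Suc_eq)
  qed
  then obtain r :: nat and b where b: "\<And>j. j < r \<Longrightarrow> b j \<in> A'" "\<And>x. x \<in> A' \<Longrightarrow> \<exists>c. x = (\<Sum>j<r. of_int (c j) * b j)"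
    "\<And>c. (\<Sum>j<r. of_int (c j) * b j) = 0 \<Longrightarrow> (\<forall>j<r. c j = 0)" by blast
  show ?case
  proof (cases "\<exists>a\<in>A. \<phi> k a \<noteq> 0")
    case False
    hence "A' = A" by (auto simp: A'_def)
    thus ?thesis using b by blast
  next
    case True
    \<comment> \<open>The values of \<open>\<phi> k\<close> form a subgroup of the integers,
      generated by its least positive element. An element \<open>a\<close> attaining it completes a
      basis of the kernel \<open>A'\<close> to one of \<open>A\<close>.\<close>
    define P where "P d \<longleftrightarrow> d > 0 \<and> (\<exists>a\<in>A. \<phi> k a = int d)" for d
    have "\<exists>d. P d"
    proof -
      from True obtain a where a: "a \<in> A" "\<phi> k a \<noteq> 0" by blast
      show ?thesis
      proof (cases "\<phi> k a > 0")
        case True thus ?thesis using a by (intro exI[of _ "nat (\<phi> k a)"]) (auto simp: P_def)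
      next
        case False thus ?thesis using a neg[of a] \<phi>neg[of a]
          by (intro exI[of _ "nat (- \<phi> k a)"]) (auto simp: P_def intro!: bexI[of _ "- a"])
      qed
    qed
    then obtain d where d: "P d" and dmin: "\<And>e. P e \<Longrightarrow> d \<le> e" using LeastI_ex[of P] Least_le[of P] by blast
    from d obtain a where a: "a \<in> A" "\<phi> k a = int d" "d > 0" by (auto simp: P_def)
    define b' where "b' j = (if j = r then a else b j)" for j
    have sum': "(\<Sum>j<Suc r. of_int (c j) * b' j) = (\<Sum>j<r. of_int (c j) * b j) + of_int (c r) * a" for c :: "nat \<Rightarrow> int"
      by (simp add: b'_def)
    have bA: "(\<Sum>j<s. of_int (c j) * b j) \<in> A \<and> \<phi> k (\<Sum>j<s. of_int (c j) * b j) = 0" if "s \<le> r" for c :: "nat \<Rightarrow> int" and s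
      using that
    proof (induction s)
      case 0 thus ?case by (simp add: A \<phi>0)
    next
      case (Suc s)
      hence "b s \<in> A" "\<phi> k (b s) = 0" using b(1)[of s] by (auto simp: A'_def)
      thus ?case using Suc scale[of "b s" "c s"] add \<phi>add by simp
    qed
    show ?thesis
    proof (intro exI[of _ "Suc r"] exI[of _ b'] conjI allI impI ballI)
      show "b' j \<in> A" if "j < Suc r" for j using that a b(1)[of j] by (auto simp: b'_def A'_def less_Suc_eq)
    next
      fix x assume x: "x \<in> A"
      define q where "q = \<phi> k x div int d"
      define y where "y = x - of_int q * a"
      have y: "y \<in> A" "\<phi> k y = \<phi> k x mod int d"
        using x a scale[OF a(1), of q] A(2) \<phi>[of k x "of_int q * a"]
        by (auto simp: y_def q_def minus_div_mult_eq_mod)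
      have "\<phi> k y = 0"
      proof (rule ccontr)
        assume "\<phi> k y \<noteq> 0"
        moreover have "0 \<le> \<phi> k x mod int d" "\<phi> k x mod int d < int d" using a by auto
        ultimately have "P (nat (\<phi> k x mod int d))" "nat (\<phi> k x mod int d) < d" using y by (auto simp: P_def)
        with dmin show False by (meson not_le)
      qed
      with y have "y \<in> A'" by (simp add: A'_def)
      from b(2)[OF this] obtain c where "y = (\<Sum>j<r. of_int (c j) * b j)" by blast
      hence "x = (\<Sum>j<Suc r. of_int (if j = r then q else c j) * b' j)"
        unfolding sum' by (simp add: y_def algebra_simps)
      thus "\<exists>c. x = (\<Sum>j<Suc r. of_int (c j) * b' j)"
        by (rule exI[of _ "\<lambda>j. if j = r then q else c j"])
    next
      fix c :: "nat \<Rightarrow> int" and j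
      assume z: "(\<Sum>j<Suc r. of_int (c j) * b' j) = 0" and j: "j < Suc r"
      have "\<phi> k ((\<Sum>j<r. of_int (c j) * b j) + of_int (c r) * a) = 0" using z \<phi>0 by (simp only: sum')
      hence "c r * int d = 0" using bA[of r c] scale[OF a(1), of "c r"] \<phi>add a(2) by simp
      hence cr: "c r = 0" using a by simp
      hence "(\<Sum>j<r. of_int (c j) * b j) = 0" using z by (simp only: sum') simp
      from b(3)[OF this] cr j show "c j = 0" by (auto simp: less_Suc_eq)
    qed
  qed
qed


section \<open>Galois number fields\<close>

lemma algebraic_int_diff_complex:
  "algebraic_int x \<Longrightarrow> algebraic_int y \<Longrightarrow> algebraic_int (x - y :: complex)"
  using algebraic_int_add_mult_complex(1)[of x "- y"] by simp

text \<open>A record-free interface to the automorphism group: elements of \<open>G\<close> are used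
  only through their values on \<open>K\<close>, and finite degree is a finite spanning set with
  rational coefficients. In the theorem, finiteness of \<open>G\<close> comes from the isomorphism
  with a finite group.\<close>

locale galois_field = group G
  for G :: "(complex \<Rightarrow> complex) monoid" (structure) and K :: "complex set" +
  assumes finite_G: "finite (carrier G)"
    and K_1: "1 \<in> K"
    and K_diff: "\<And>x y. x \<in> K \<Longrightarrow> y \<in> K \<Longrightarrow> x - y \<in> K"
    and K_mult: "\<And>x y. x \<in> K \<Longrightarrow> y \<in> K \<Longrightarrow> x * y \<in> K"
    and K_inverse: "\<And>x. x \<in> K \<Longrightarrow> inverse x \<in> K"
    and K_findim: "\<exists>B. finite B \<and> B \<subseteq> K \<and> (\<forall>x\<in>K. \<exists>c. (\<forall>b\<in>B. c b \<in> \<rat>) \<and> x = (\<Sum>b\<in>B. c b * b))"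
    and act_K: "\<And>s x. s \<in> carrier G \<Longrightarrow> x \<in> K \<Longrightarrow> s x \<in> K"
    and act_add: "\<And>s x y. s \<in> carrier G \<Longrightarrow> x \<in> K \<Longrightarrow> y \<in> K \<Longrightarrow> s (x + y) = s x + s y"
    and act_mult: "\<And>s x y. s \<in> carrier G \<Longrightarrow> x \<in> K \<Longrightarrow> y \<in> K \<Longrightarrow> s (x * y) = s x * s y"
    and act_comp: "\<And>s t x. s \<in> carrier G \<Longrightarrow> t \<in> carrier G \<Longrightarrow> x \<in> K \<Longrightarrow> (s \<otimes> t) x = s (t x)"
    and act_one: "\<And>x. x \<in> K \<Longrightarrow> \<one> x = x"
    and act_ext: "\<And>s t. s \<in> carrier G \<Longrightarrow> t \<in> carrier G \<Longrightarrow> (\<And>x. x \<in> K \<Longrightarrow> s x = t x) \<Longrightarrow> s = t"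
    and fixed_Rats: "\<And>x. x \<in> K \<Longrightarrow> (\<And>s. s \<in> carrier G \<Longrightarrow> s x = x) \<Longrightarrow> x \<in> \<rat>"
begin

lemma K_0: "0 \<in> K" using K_diff[OF K_1 K_1] by simp
lemma K_minus: "x \<in> K \<Longrightarrow> - x \<in> K" using K_diff[OF K_0, of x] by simp
lemma K_add: "x \<in> K \<Longrightarrow> y \<in> K \<Longrightarrow> x + y \<in> K" using K_diff[of x "- y"] K_minus by simp
lemma K_nat: "of_nat n \<in> K" by (induction n) (auto simp: K_0 K_1 K_add)
lemma K_int: "of_int n \<in> K" by (cases n rule: int_cases2) (auto simp: K_nat K_minus)
lemma K_divide: "x \<in> K \<Longrightarrow> y \<in> K \<Longrightarrow> x / y \<in> K" by (simp add: divide_inverse K_mult K_inverse)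
lemma K_sum: "(\<And>i. i \<in> I \<Longrightarrow> f i \<in> K) \<Longrightarrow> sum f I \<in> K"
  by (induction I rule: infinite_finite_induct) (auto simp: K_0 K_add)
lemma K_prod: "(\<And>i. i \<in> I \<Longrightarrow> f i \<in> K) \<Longrightarrow> prod f I \<in> K"
  by (induction I rule: infinite_finite_induct) (auto simp: K_1 K_mult)
lemma K_power: "x \<in> K \<Longrightarrow> x ^ n \<in> K" by (induction n) (auto simp: K_1 K_mult)

context fixes s assumes s: "s \<in> carrier G"
begin

lemma act_0: "s 0 = 0" using act_add[OF s K_0 K_0] by simp
lemma act_minus: "x \<in> K \<Longrightarrow> s (- x) = - s x"
  using act_add[OF s, of x "- x"] K_minus[of x] act_0 by (simp add: eq_neg_iff_add_eq_0 add.commute)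
lemma act_diff: "x \<in> K \<Longrightarrow> y \<in> K \<Longrightarrow> s (x - y) = s x - s y"
  using act_add[OF s, of x "- y"] by (simp add: K_minus act_minus)
lemma act_inv_act: "x \<in> K \<Longrightarrow> (inv s) (s x) = x" "x \<in> K \<Longrightarrow> s ((inv s) x) = x"
  using act_comp[of "inv s" s x] act_comp[of s "inv s" x] s by (simp_all add: act_one)
lemma act_inj: "x \<in> K \<Longrightarrow> y \<in> K \<Longrightarrow> s x = s y \<longleftrightarrow> x = y"
  using act_inv_act(1) by metis
lemma act_eq_0_iff: "x \<in> K \<Longrightarrow> s x = 0 \<longleftrightarrow> x = 0"
  using act_inj[of x 0] K_0 act_0 by simp
lemma act_1: "s 1 = 1"
  using act_mult[OF s K_1 K_1] act_eq_0_iff[OF K_1] by simp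
lemma act_nat: "s (of_nat n) = of_nat n" by (induction n) (auto simp: act_0 act_1 act_add[OF s] K_1 K_nat)
lemma act_int: "s (of_int n) = of_int n" by (cases n rule: int_cases2) (auto simp: act_nat act_minus K_nat)
lemma act_sum: "(\<And>i. i \<in> I \<Longrightarrow> f i \<in> K) \<Longrightarrow> s (sum f I) = (\<Sum>i\<in>I. s (f i))"
  by (induction I rule: infinite_finite_induct) (auto simp: act_0 act_add[OF s] K_sum)
lemma act_prod: "(\<And>i. i \<in> I \<Longrightarrow> f i \<in> K) \<Longrightarrow> s (prod f I) = (\<Prod>i\<in>I. s (f i))"
  by (induction I rule: infinite_finite_induct) (auto simp: act_1 act_mult[OF s] K_prod)
lemma act_power: "x \<in> K \<Longrightarrow> s (x ^ n) = s x ^ n"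
  by (induction n) (auto simp: act_1 act_mult[OF s] K_power)
lemma act_divide: "x \<in> K \<Longrightarrow> y \<in> K \<Longrightarrow> s (x / y) = s x / s y"
proof -
  assume xy: "x \<in> K" "y \<in> K"
  show ?thesis
  proof (cases "y = 0")
    case False
    hence "s (x / y) * s y = s x" using act_mult[OF s, of "x / y" y] xy K_divide by simp
    thus ?thesis using False act_eq_0_iff xy by (simp add: field_simps)
  qed (auto simp: act_0)
qed
lemma act_Rats: "x \<in> \<rat> \<Longrightarrow> s x = x"
  by (elim Rats_cases') (simp add: act_divide K_int act_int)

lemma act_algebraic_int: assumes x: "x \<in> K" "algebraic_int x" shows "algebraic_int (s x)"
proof -
  obtain p where p: "poly (map_poly of_int p) x = 0" "lead_coeff p = 1"
    using x by (auto simp: algebraic_int_altdef_ipoly)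
  have "poly (map_poly of_int p) (s x) = s (poly (map_poly of_int p) x)"
    using x by (simp add: poly_altdef coeff_map_poly act_sum act_mult[OF s] act_power act_int K_mult K_int K_power)
  thus ?thesis using p act_0 by (auto simp: algebraic_int_altdef_ipoly)
qed

end

section \<open>The ring of integers of a Galois number field\<close>

definition \<O> where "\<O> = {x \<in> K. algebraic_int x}"

lemma O_K: "x \<in> \<O> \<Longrightarrow> x \<in> K" by (simp add: \<O>_def)
lemma O_int: "of_int n \<in> \<O>" by (simp add: \<O>_def K_int int_imp_algebraic_int)
lemma O_0: "0 \<in> \<O>" using O_int[of 0] by simp
lemma O_1: "1 \<in> \<O>" using O_int[of 1] by simp
lemma O_nat: "of_nat n \<in> \<O>" using O_int[of "int n"] by simp
lemma O_add: "x \<in> \<O> \<Longrightarrow> y \<in> \<O> \<Longrightarrow> x + y \<in> \<O>"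
  by (simp add: \<O>_def K_add algebraic_int_add_mult_complex)
lemma O_mult: "x \<in> \<O> \<Longrightarrow> y \<in> \<O> \<Longrightarrow> x * y \<in> \<O>"
  by (simp add: \<O>_def K_mult algebraic_int_add_mult_complex)
lemma O_diff: "x \<in> \<O> \<Longrightarrow> y \<in> \<O> \<Longrightarrow> x - y \<in> \<O>"
  by (simp add: \<O>_def K_diff algebraic_int_diff_complex)
lemma O_minus: "x \<in> \<O> \<Longrightarrow> - x \<in> \<O>" using O_diff[OF O_0, of x] by simp
lemma O_sum: "(\<And>i. i \<in> I \<Longrightarrow> f i \<in> \<O>) \<Longrightarrow> sum f I \<in> \<O>"
  by (induction I rule: infinite_finite_induct) (auto simp: O_0 O_add)
lemma O_prod: "(\<And>i. i \<in> I \<Longrightarrow> f i \<in> \<O>) \<Longrightarrow> prod f I \<in> \<O>"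
  by (induction I rule: infinite_finite_induct) (auto simp: O_1 O_mult)
lemma O_power: "x \<in> \<O> \<Longrightarrow> x ^ n \<in> \<O>" by (induction n) (auto simp: O_1 O_mult)
lemma O_Rats: "x \<in> \<O> \<Longrightarrow> x \<in> \<rat> \<Longrightarrow> x \<in> \<int>"
  by (simp add: \<O>_def rational_algebraic_int_is_int)
lemma act_O: "s \<in> carrier G \<Longrightarrow> x \<in> \<O> \<Longrightarrow> s x \<in> \<O>"
  by (simp add: \<O>_def act_K act_algebraic_int)

lemmas K_simps = K_0 K_1 K_add K_diff K_mult K_minus K_int K_nat K_sum K_prod K_power O_K
lemmas O_simps = O_0 O_1 O_add O_diff O_mult O_minus O_int O_nat O_sum O_prod O_power

section \<open>Trace, norm and integral bases\<close>

lemma bij_left_mult: "s \<in> carrier G \<Longrightarrow> bij_betw (\<lambda>t. s \<otimes> t) (carrier G) (carrier G)"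
  by (rule bij_betwI[of _ _ _ "\<lambda>t. inv s \<otimes> t"]) (auto simp: m_assoc[symmetric])

definition Tr where "Tr x = (\<Sum>s\<in>carrier G. s x)"
definition Nm where "Nm x = (\<Prod>s\<in>carrier G. s x)"

lemma act_Tr: assumes "s \<in> carrier G" "x \<in> K" shows "s (Tr x) = Tr x"
proof -
  have "s (Tr x) = (\<Sum>t\<in>carrier G. (s \<otimes> t) x)"
    using assms by (simp add: Tr_def act_sum act_K act_comp)
  also have "\<dots> = Tr x"
    unfolding Tr_def using sum.reindex_bij_betw[OF bij_left_mult[OF assms(1)], of "\<lambda>t. t x"] .
  finally show ?thesis .
qed

lemma act_Nm: assumes "s \<in> carrier G" "x \<in> K" shows "s (Nm x) = Nm x"
proof -
  have "s (Nm x) = (\<Prod>t\<in>carrier G. (s \<otimes> t) x)"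
    using assms by (simp add: Nm_def act_prod act_K act_comp)
  also have "\<dots> = Nm x"
    unfolding Nm_def using prod.reindex_bij_betw[OF bij_left_mult[OF assms(1)], of "\<lambda>t. t x"] .
  finally show ?thesis .
qed

lemma Tr_Rats: "x \<in> K \<Longrightarrow> Tr x \<in> \<rat>"
  by (rule fixed_Rats) (auto simp: act_Tr, auto simp: Tr_def K_sum act_K)
lemma Nm_Rats: "x \<in> K \<Longrightarrow> Nm x \<in> \<rat>"
  by (rule fixed_Rats) (auto simp: act_Nm, auto simp: Nm_def K_prod act_K)
lemma Tr_Ints: "x \<in> \<O> \<Longrightarrow> Tr x \<in> \<int>"
  by (rule O_Rats, unfold Tr_def, rule O_sum, erule (1) act_O, fold Tr_def, simp add: Tr_Rats O_K)
lemma Nm_Ints: "x \<in> \<O> \<Longrightarrow> Nm x \<in> \<int>"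
  by (rule O_Rats, unfold Nm_def, rule O_prod, erule (1) act_O, fold Nm_def, simp add: Nm_Rats O_K)
lemma Nm_eq_0_iff: "x \<in> K \<Longrightarrow> Nm x = 0 \<longleftrightarrow> x = 0"
  using act_eq_0_iff one_closed by (auto simp: Nm_def finite_G)

lemma Nm_dvd: assumes "x \<in> \<O>" shows "\<exists>y\<in>\<O>. Nm x = x * y"
proof -
  have "Nm x = \<one> x * (\<Prod>s\<in>carrier G - {\<one>}. s x)"
    unfolding Nm_def by (rule prod.remove) (auto simp: finite_G)
  moreover have "(\<Prod>s\<in>carrier G - {\<one>}. s x) \<in> \<O>" by (rule O_prod) (simp add: act_O assms)
  ultimately show ?thesis using assms by (auto simp: act_one O_K)
qed

lemma common_denominator:
  assumes "finite S" "S \<subseteq> \<rat>"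
  shows "\<exists>N>0. \<forall>q\<in>S. of_int N * q \<in> (\<int> :: complex set)"
  using assms
proof (induction S rule: finite_induct)
  case empty thus ?case by (intro exI[of _ 1]) auto
next
  case (insert q S)
  then obtain N where N: "N > 0" "\<And>q. q \<in> S \<Longrightarrow> of_int N * q \<in> (\<int> :: complex set)" by auto
  from insert.prems obtain a b where q: "q = of_int a / of_int b" "b > 0" by (auto elim: Rats_cases')
  show ?case
  proof (intro exI[of _ "N * b"] conjI ballI)
    show "N * b > 0" using N q by simp
    fix q' assume "q' \<in> insert q S"
    thus "of_int (N * b) * q' \<in> (\<int> :: complex set)"
    proof
      assume "q' = q"
      hence "of_int (N * b) * q' = (of_int (N * a) :: complex)" using q by simp
      thus ?thesis by (simp only: Ints_of_int)
    next
      assume "q' \<in> S"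
      from Ints_mult[OF Ints_of_int N(2)[OF this], of b] have "of_int b * (of_int N * q') \<in> (\<int> :: complex set)" .
      thus ?thesis by (simp add: mult_ac)
    qed
  qed
qed

text \<open>Clearing the denominators in the matrix of multiplication by \<open>x\<close> makes a
  multiple of \<open>x\<close> stabilize the integral span of the generators of
  \<open>K\<close>.\<close>

lemma denominator_O: assumes x: "x \<in> K" shows "\<exists>N>0. of_int N * x \<in> \<O>"
proof -
  obtain B where B: "finite B" "B \<subseteq> K" "\<And>x. x \<in> K \<Longrightarrow> \<exists>c. (\<forall>b\<in>B. c b \<in> \<rat>) \<and> x = (\<Sum>b\<in>B. c b * b)"
    using K_findim by blast
  have "\<forall>b\<in>B. \<exists>c. (\<forall>b'\<in>B. c b' \<in> \<rat>) \<and> x * b = (\<Sum>b'\<in>B. c b' * b')"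
    using B x by (auto intro!: B(3) K_mult)
  then obtain c where c: "\<And>b b'. b \<in> B \<Longrightarrow> b' \<in> B \<Longrightarrow> c b b' \<in> \<rat>"
    "\<And>b. b \<in> B \<Longrightarrow> x * b = (\<Sum>b'\<in>B. c b b' * b')" by metis
  have "finite ((\<lambda>(b, b'). c b b') ` (B \<times> B))" "(\<lambda>(b, b'). c b b') ` (B \<times> B) \<subseteq> \<rat>" using B c by auto
  from common_denominator[OF this] obtain N where N: "N > 0"
    "\<And>b b'. b \<in> B \<Longrightarrow> b' \<in> B \<Longrightarrow> of_int N * c b b' \<in> (\<int> :: complex set)" by auto
  have "\<forall>b\<in>B. \<forall>b'\<in>B. \<exists>n. of_int N * c b b' = of_int n" using N(2) by (auto elim!: Ints_cases)
  then obtain n where n: "\<And>b b'. b \<in> B \<Longrightarrow> b' \<in> B \<Longrightarrow> of_int N * c b b' = of_int (n b b')" by metis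
  have "of_int N * x * b \<in> zspan B" if b: "b \<in> B" for b
  proof -
    have "of_int N * x * b = (\<Sum>b'\<in>B. of_int N * c b b' * b')"
      using c(2)[OF b] by (simp add: mult.assoc sum_distrib_left)
    also have "\<dots> = (\<Sum>b'\<in>B. of_int (n b b') * b')" using n b by (intro sum.cong) auto
    finally show ?thesis by (auto simp: zspan_def)
  qed
  moreover obtain b0 where "b0 \<in> B" "b0 \<noteq> 0"
  proof (rule ccontr)
    assume "\<not> thesis"
    hence "\<forall>b\<in>B. b = 0" using that by blast
    moreover obtain c where "1 = (\<Sum>b\<in>B. c b * b)" using B(3)[OF K_1] by blast
    ultimately show False by (simp add: sum.neutral)
  qed
  ultimately have "algebraic_int (of_int N * x)" using algebraic_int_if_stabilizes_zspan[OF B(1)] by blast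
  thus ?thesis using N(1) x by (auto simp: \<O>_def K_mult K_int)
qed

lemma act_ext_O: assumes "s \<in> carrier G" "t \<in> carrier G" "\<And>x. x \<in> \<O> \<Longrightarrow> s x = t x" shows "s = t"
proof (rule act_ext[OF assms(1,2)])
  fix x assume x: "x \<in> K"
  obtain N where N: "N > 0" "of_int N * x \<in> \<O>" using denominator_O[OF x] by blast
  have "of_int N * s x = of_int N * t x"
    using assms(3)[OF N(2)] assms(1,2) x by (simp add: act_mult K_int act_int)
  thus "s x = t x" using N(1) by simp
qed

text \<open>The coordinates are traces against integral multiples of a spanning family of
  \<open>K\<close>. They vanish together only at 0: the inverse of \<open>x\<close> is a rational
  combination of the family, so otherwise the trace of 1 would be 0. Stated for any subgroup
  \<open>A\<close>, since it serves \<open>\<O>\<close>, prime ideals and fixed rings alike.\<close>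

lemma integral_basis:
  assumes "0 \<in> A" "\<And>x y. x \<in> A \<Longrightarrow> y \<in> A \<Longrightarrow> x - y \<in> A" "A \<subseteq> \<O>"
  shows "\<exists>(r::nat) b. (\<forall>j<r. b j \<in> A) \<and> (\<forall>x\<in>A. \<exists>c. x = (\<Sum>j<r. of_int (c j) * b j))
    \<and> (\<forall>c. (\<Sum>j<r. of_int (c j) * b j) = 0 \<longrightarrow> (\<forall>j<r. c j = 0))"
proof -
  obtain B where B: "finite B" "B \<subseteq> K" "\<And>x. x \<in> K \<Longrightarrow> \<exists>c. (\<forall>b\<in>B. c b \<in> \<rat>) \<and> x = (\<Sum>b\<in>B. c b * b)"
    using K_findim by blast
  have "\<forall>b\<in>B. \<exists>N>0. of_int N * b \<in> \<O>" using B denominator_O by blast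
  then obtain N where N: "\<And>b. b \<in> B \<Longrightarrow> N b > (0::int)" "\<And>b. b \<in> B \<Longrightarrow> of_int (N b) * b \<in> \<O>" by metis
  obtain e where e: "bij_betw e {..<card B} B" using B bij_betw_from_nat_into_finite by blast
  have eB: "e i \<in> B" if "i < card B" for i using e that by (auto simp: bij_betw_def)
  define g where "g i = of_int (N (e i)) * e i" for i
  have gO: "g i \<in> \<O>" if "i < card B" for i using N eB[OF that] by (simp add: g_def)
  define \<phi> where "\<phi> i y = (THE n. Tr (g i * y) = of_int n)" for i y
  have \<phi>: "of_int (\<phi> i y) = Tr (g i * y)" if iy: "i < card B" "y \<in> \<O>" for i y
  proof -
    obtain n where n: "Tr (g i * y) = of_int n" using Tr_Ints[OF O_mult[OF gO[OF iy(1)] iy(2)]] by (auto elim: Ints_cases)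
    thus ?thesis unfolding \<phi>_def by simp
  qed
  show ?thesis
  proof (rule subgroup_integral_basis[of A "card B" \<phi>])
    fix i x y assume i: "i < card B" and xy: "x \<in> A" "y \<in> A"
    have "of_int (\<phi> i (x - y)) = (of_int (\<phi> i x - \<phi> i y) :: complex)"
      using i xy assms(2,3) gO[OF i] \<phi>[OF i, of x] \<phi>[OF i, of y] \<phi>[OF i, of "x - y"]
      by (auto simp: Tr_def subset_iff right_diff_distrib act_diff K_simps sum_subtractf)
    thus "\<phi> i (x - y) = \<phi> i x - \<phi> i y" by (simp only: of_int_eq_iff)
  next
    fix x assume x: "x \<in> A" and z: "\<And>i. i < card B \<Longrightarrow> \<phi> i x = 0"
    have xK: "x \<in> K" "x \<in> \<O>" using x assms O_K by auto
    have TrB: "Tr (b * x) = 0" if "b \<in> B" for b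
    proof -
      from that obtain i where i: "i < card B" "e i = b" using e unfolding bij_betw_def by (metis imageE lessThan_iff)
      have "0 = Tr (g i * x)" using \<phi>[OF i(1) xK(2)] z[OF i(1)] by simp
      also have "\<dots> = of_int (N b) * Tr (b * x)"
        using i B xK that by (auto simp: g_def Tr_def sum_distrib_left act_mult act_int K_simps mult.assoc subset_iff)
      finally show ?thesis using N(1)[OF that] by simp
    qed
    show "x = 0"
    proof (rule ccontr)
      assume "x \<noteq> 0"
      obtain c where c: "\<And>b. b \<in> B \<Longrightarrow> c b \<in> \<rat>" "inverse x = (\<Sum>b\<in>B. c b * b)"
        using B(3)[OF K_inverse[OF xK(1)]] by blast
      have cK: "c b \<in> K" if "b \<in> B" for b using c(1)[OF that] by (auto elim!: Rats_cases' simp: K_divide K_int)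
      have one: "1 = (\<Sum>b\<in>B. c b * (b * x))"
        using c(2) \<open>x \<noteq> 0\<close> by (simp add: sum_distrib_right[symmetric] mult.assoc[symmetric]) (metis left_inverse)
      have "s 1 = (\<Sum>b\<in>B. c b * s (b * x))" if s: "s \<in> carrier G" for s
      proof -
        have "s 1 = (\<Sum>b\<in>B. s (c b * (b * x)))"
          using B(2) xK(1) cK by (subst one) (auto simp: act_sum[OF s] K_mult subset_iff)
        also have "\<dots> = (\<Sum>b\<in>B. c b * s (b * x))"
          using B(2) xK(1) cK c(1) by (intro sum.cong) (auto simp: act_mult[OF s, of _ "_ * x"] K_mult subset_iff act_Rats[OF s])
        finally show ?thesis .
      qed
      hence "Tr 1 = (\<Sum>s\<in>carrier G. \<Sum>b\<in>B. c b * s (b * x))"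
        by (simp add: Tr_def)
      also have "\<dots> = (\<Sum>b\<in>B. c b * Tr (b * x))"
        by (subst sum.swap) (simp add: Tr_def sum_distrib_left)
      also have "\<dots> = 0" using TrB by simp
      finally have "of_nat (card (carrier G)) = (0 :: complex)" by (simp add: Tr_def act_1)
      thus False using finite_G one_closed by auto
    qed
  qed (use assms in auto)
qed

lemma integral_generators:
  assumes "0 \<in> A" "\<And>x y. x \<in> A \<Longrightarrow> y \<in> A \<Longrightarrow> x - y \<in> A" "A \<subseteq> \<O>"
  shows "\<exists>B. finite B \<and> B \<subseteq> A \<and> A \<subseteq> zspan B"
proof -
  obtain r :: nat and b where b: "\<And>j. j < r \<Longrightarrow> b j \<in> A" "\<And>x. x \<in> A \<Longrightarrow> \<exists>c. x = (\<Sum>j<r. of_int (c j) * b j)"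
    using integral_basis[OF assms] by blast
  have "x \<in> zspan (b ` {..<r})" if "x \<in> A" for x
  proof -
    from b(2)[OF that] obtain c where "x = (\<Sum>j<r. of_int (c j) * b j)" by blast
    thus ?thesis by (auto intro!: zspan_sum zspan_scale zspan_superset)
  qed
  thus ?thesis using b(1) by (intro exI[of _ "b ` {..<r}"]) auto
qed

text \<open>Powers repeat in the finite ring \<open>\<O>/N\<O>\<close>.\<close>

lemma power_cycle_mod_int:
  assumes N: "N \<noteq> 0" and x: "x \<in> \<O>"
  shows "\<exists>a j. 0 < j \<and> (\<exists>z\<in>\<O>. x ^ a * (x ^ j - 1) = of_int N * z)"
proof -
  obtain r :: nat and b where b: "\<And>j. j < r \<Longrightarrow> b j \<in> \<O>" "\<And>x. x \<in> \<O> \<Longrightarrow> \<exists>c. x = (\<Sum>j<r. of_int (c j) * b j)"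
    using integral_basis[of \<O>] by (auto simp: O_simps)
  have "\<forall>i. \<exists>c. x ^ i = (\<Sum>j<r. of_int (c j) * b j)" using b(2) O_power[OF x] by blast
  then obtain c where c: "\<And>i. x ^ i = (\<Sum>j<r. of_int (c i j) * b j)" by metis
  define f where "f i = restrict (\<lambda>j. c i j mod \<bar>N\<bar>) {..<r}" for i :: nat
  have "range f \<subseteq> PiE {..<r} (\<lambda>_. {0..<\<bar>N\<bar>})" using N by (auto simp: f_def)
  hence "finite (range f)" by (rule finite_subset) (auto intro: finite_PiE)
  hence "\<not> inj f" using finite_imageD[of f UNIV] by auto
  then obtain i i' where "i \<noteq> i'" "f i = f i'" by (auto simp: inj_def)
  then obtain i i' where i: "i < i'" "f i = f i'" by (metis nat_neq_iff)
  have "\<forall>j\<in>{..<r}. \<exists>d. c i' j - c i j = N * d"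
  proof
    fix j assume "j \<in> {..<r}"
    hence "c i j mod \<bar>N\<bar> = c i' j mod \<bar>N\<bar>" using fun_cong[OF i(2), of j] by (simp add: f_def)
    hence "\<bar>N\<bar> dvd c i' j - c i j" by (metis mod_eq_dvd_iff)
    hence "N dvd c i' j - c i j" by simp
    thus "\<exists>d. c i' j - c i j = N * d" by (auto simp: dvd_def)
  qed
  then obtain d where d: "\<And>j. j < r \<Longrightarrow> c i' j - c i j = N * d j" by (metis lessThan_iff)
  have "x ^ i * (x ^ (i' - i) - 1) = x ^ i' - x ^ i"
    using i(1) by (simp add: right_diff_distrib flip: power_add)
  also have "\<dots> = (\<Sum>j<r. of_int (c i' j - c i j) * b j)" unfolding c by (simp add: sum_subtractf left_diff_distrib)
  also have "\<dots> = of_int N * (\<Sum>j<r. of_int (d j) * b j)"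
    using d by (simp add: sum_distrib_left mult.assoc)
  finally show ?thesis using i(1) b(1)
    by (intro exI[of _ i] exI[of _ "i' - i"] conjI bexI[of _ "\<Sum>j<r. of_int (d j) * b j"]) (auto intro!: O_sum O_mult O_int)
qed

end


section \<open>Prime ideals and characters\<close>

locale galois_prime = galois_field +
  fixes P :: "complex set"
  assumes P_O: "x \<in> P \<Longrightarrow> x \<in> \<O>"
    and P_0: "0 \<in> P"
    and P_add: "x \<in> P \<Longrightarrow> y \<in> P \<Longrightarrow> x + y \<in> P"
    and P_lmult: "x \<in> \<O> \<Longrightarrow> y \<in> P \<Longrightarrow> x * y \<in> P"
    and P_1: "1 \<notin> P"
    and P_prime: "x \<in> \<O> \<Longrightarrow> y \<in> \<O> \<Longrightarrow> x * y \<in> P \<Longrightarrow> x \<in> P \<or> y \<in> P"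
begin

lemma P_rmult: "x \<in> P \<Longrightarrow> y \<in> \<O> \<Longrightarrow> x * y \<in> P" using P_lmult[of y x] by (simp add: mult.commute)
lemma P_minus: "x \<in> P \<Longrightarrow> - x \<in> P" using P_lmult[OF O_minus[OF O_1], of x] by simp
lemma P_diff: "x \<in> P \<Longrightarrow> y \<in> P \<Longrightarrow> x - y \<in> P" using P_add[of x "- y"] P_minus by simp
lemma P_sum: "(\<And>i. i \<in> I \<Longrightarrow> f i \<in> P) \<Longrightarrow> sum f I \<in> P"
  by (induction I rule: infinite_finite_induct) (auto simp: P_0 P_add)
lemma P_power: "x \<in> P \<Longrightarrow> 0 < n \<Longrightarrow> x ^ n \<in> P"
  using P_rmult[of x "x ^ (n - 1)"] O_power[OF P_O, of x "n - 1"] by (simp add: power_eq_if)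
lemma P_power_iff: "x \<in> \<O> \<Longrightarrow> 0 < n \<Longrightarrow> x ^ n \<in> P \<longleftrightarrow> x \<in> P"
proof
  show "x \<in> \<O> \<Longrightarrow> x ^ n \<in> P \<Longrightarrow> x \<in> P"
    by (induction n) (use P_1 P_prime O_power in auto)
qed (rule P_power)
lemma P_mult_iff: "x \<in> \<O> \<Longrightarrow> y \<in> \<O> \<Longrightarrow> x * y \<in> P \<longleftrightarrow> x \<in> P \<or> y \<in> P"
  using P_prime P_rmult P_lmult by blast
lemma P_prod_notin: "finite I \<Longrightarrow> (\<And>i. i \<in> I \<Longrightarrow> f i \<in> \<O>) \<Longrightarrow> (\<And>i. i \<in> I \<Longrightarrow> f i \<notin> P) \<Longrightarrow> prod f I \<notin> P"
  by (induction I rule: finite_induct) (auto simp: P_1 P_mult_iff O_prod)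
lemma P_cong_sym: "x - y \<in> P \<Longrightarrow> y - x \<in> P" using P_minus by fastforce
lemma P_cong_trans: "x - y \<in> P \<Longrightarrow> y - z \<in> P \<Longrightarrow> x - z \<in> P" using P_add[of "x - y" "y - z"] by simp
lemma P_cong_iff: "x - y \<in> P \<Longrightarrow> x \<in> P \<longleftrightarrow> y \<in> P"
  using P_add[of "x - y" y] P_diff[of x "x - y"] by auto
lemma P_cong_mult: "x - y \<in> P \<Longrightarrow> x' - y' \<in> P \<Longrightarrow> x' \<in> \<O> \<Longrightarrow> y \<in> \<O> \<Longrightarrow> x * x' - y * y' \<in> P"
  using P_add[OF P_rmult[of "x - y" x'] P_lmult[of y "x' - y'"]] by (simp add: algebra_simps)
lemma P_cong_power: "x - y \<in> P \<Longrightarrow> x \<in> \<O> \<Longrightarrow> y \<in> \<O> \<Longrightarrow> x ^ n - y ^ n \<in> P"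
  by (induction n) (auto simp: P_0 intro!: P_cong_mult O_power)

text \<open>Dedekind's independence of characters over the domain \<O>/P. Different indices may give
  the same character modulo \<open>P\<close>, so what vanishes is the sum of the coefficients over
  one congruence class.\<close>

lemma character_independence_mod:
  assumes "finite J" "j0 \<in> J"
    and \<chi>: "\<And>j x. j \<in> J \<Longrightarrow> x \<in> \<O> \<Longrightarrow> \<chi> j x \<in> \<O>"
    and mult: "\<And>j x y. j \<in> J \<Longrightarrow> x \<in> \<O> \<Longrightarrow> y \<in> \<O> \<Longrightarrow> \<chi> j (x * y) - \<chi> j x * \<chi> j y \<in> P"
    and one: "\<chi> j0 1 \<notin> P"
    and "\<And>j. j \<in> J \<Longrightarrow> a j \<in> \<O>" "\<And>x. x \<in> \<O> \<Longrightarrow> (\<Sum>j\<in>J. a j * \<chi> j x) \<in> P"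
  shows "(\<Sum>j\<in>{j\<in>J. \<forall>x\<in>\<O>. \<chi> j x - \<chi> j0 x \<in> P}. a j) \<in> P"
  using assms
proof (induction J arbitrary: a rule: finite_psubset_induct)
  case (psubset J)
  note \<chi> = psubset.prems(2) and mult = psubset.prems(3) and a = psubset.prems(5) and rel = psubset.prems(6)
  have j0: "j0 \<in> J" by fact
  define E where "E = {j\<in>J. \<forall>x\<in>\<O>. \<chi> j x - \<chi> j0 x \<in> P}"
  show ?case
  proof (cases "E = J")
    case True
    have "(\<Sum>j\<in>J. a j * \<chi> j 1) - (\<Sum>j\<in>J. a j * (\<chi> j 1 - \<chi> j0 1)) \<in> P"
      by (rule P_diff, rule rel[OF O_1], rule P_sum, rule P_lmult) (use True O_1 a in \<open>auto simp: E_def\<close>)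
    also have "(\<Sum>j\<in>J. a j * \<chi> j 1) - (\<Sum>j\<in>J. a j * (\<chi> j 1 - \<chi> j0 1)) = (\<Sum>j\<in>J. a j) * \<chi> j0 1"
      by (simp add: sum_subtractf[symmetric] sum_distrib_right algebra_simps)
    finally show ?thesis
      using P_prime[of "\<Sum>j\<in>J. a j" "\<chi> j0 1"] psubset.prems(4) \<chi>[OF j0 O_1] O_sum[of J a] a True
      by (auto simp: E_def)
  next
    case False
    then obtain j1 y where j1: "j1 \<in> J" "y \<in> \<O>" "\<chi> j1 y - \<chi> j0 y \<notin> P" by (auto simp: E_def)
    \<comment> \<open>The relation at \<open>y * x\<close> minus \<open>\<chi> j1 y\<close> times
      the relation at \<open>x\<close> no longer involves \<open>j1\<close>. On the class
      \<open>E\<close> the new factor is congruent to the constant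
      \<open>\<chi> j0 y - \<chi> j1 y\<close>, which is nonzero modulo \<open>P\<close> and can be
      cancelled.\<close>
    define a' where "a' j = a j * (\<chi> j y - \<chi> j1 y)" for j
    have E': "E = {j\<in>J - {j1}. \<forall>x\<in>\<O>. \<chi> j x - \<chi> j0 x \<in> P}" using j1 by (auto simp: E_def)
    have j01: "j0 \<noteq> j1" using j1 P_0 by auto
    have "(\<Sum>j\<in>{j\<in>J - {j1}. \<forall>x\<in>\<O>. \<chi> j x - \<chi> j0 x \<in> P}. a' j) \<in> P"
    proof (rule psubset.IH)
      show "J - {j1} \<subset> J" using j1 by auto
      show "a' j \<in> \<O>" if "j \<in> J - {j1}" for j
        using that a \<chi> j1 by (auto simp: a'_def intro!: O_mult O_diff)
      fix x assume x: "x \<in> \<O>"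
      have "(\<Sum>j\<in>J - {j1}. a' j * \<chi> j x) = (\<Sum>j\<in>J. a' j * \<chi> j x)"
        using psubset.hyps(1) j1 by (intro sum.mono_neutral_left) (auto simp: a'_def)
      also have "\<dots> = (\<Sum>j\<in>J. a j * \<chi> j (y * x)) - (\<Sum>j\<in>J. a j * (\<chi> j (y * x) - \<chi> j y * \<chi> j x))
          - \<chi> j1 y * (\<Sum>j\<in>J. a j * \<chi> j x)"
        by (simp add: a'_def sum_subtractf[symmetric] sum_distrib_left algebra_simps)
      also have "\<dots> \<in> P"
        by (rule P_diff, rule P_diff, rule rel, rule O_mult, rule j1, rule x, rule P_sum, rule P_lmult)
          (use x j1 a \<chi> mult in \<open>auto intro!: P_lmult rel\<close>)
      finally show "(\<Sum>j\<in>J - {j1}. a' j * \<chi> j x) \<in> P" .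
    qed (use j1 j01 psubset.prems in auto)
    moreover have "(\<Sum>j\<in>E. a j * (\<chi> j y - \<chi> j0 y)) \<in> P"
      by (intro P_sum P_lmult) (use a j1 in \<open>auto simp: E_def\<close>)
    ultimately have "(\<Sum>j\<in>E. a' j) - (\<Sum>j\<in>E. a j * (\<chi> j y - \<chi> j0 y)) \<in> P"
      unfolding E'[symmetric] by (rule P_diff)
    also have "(\<Sum>j\<in>E. a' j) - (\<Sum>j\<in>E. a j * (\<chi> j y - \<chi> j0 y)) = (\<chi> j0 y - \<chi> j1 y) * (\<Sum>j\<in>E. a j)"
      by (simp add: a'_def sum_subtractf sum_distrib_left sum_distrib_right algebra_simps)
    finally have "\<chi> j0 y - \<chi> j1 y \<in> P \<or> (\<Sum>j\<in>E. a j) \<in> P"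
      using j1 j0 \<chi> a by (intro P_prime) (auto simp: E_def intro!: O_diff O_sum)
    thus ?thesis using j1 P_cong_sym by (auto simp: E_def)
  qed
qed

definition inertia where "inertia = {s\<in>carrier G. \<forall>x\<in>\<O>. s x - x \<in> P}"

lemma inertia_carrier: "s \<in> inertia \<Longrightarrow> s \<in> carrier G" by (simp add: inertia_def)
lemma inertiaD: "s \<in> inertia \<Longrightarrow> x \<in> \<O> \<Longrightarrow> s x - x \<in> P" by (simp add: inertia_def)
lemma inertia_act_iff: "s \<in> inertia \<Longrightarrow> x \<in> \<O> \<Longrightarrow> s x \<in> P \<longleftrightarrow> x \<in> P"
  using P_cong_iff inertiaD by blast

lemma subgroup_inertia: "subgroup inertia G"
proof (rule subgroupI)
  show "inertia \<subseteq> carrier G" by (auto simp: inertia_def)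
  have "\<one> \<in> inertia" by (auto simp: inertia_def act_one O_K P_0)
  thus "inertia \<noteq> {}" by auto
next
  fix s assume s: "s \<in> inertia"
  have "(inv s) x - x \<in> P" if "x \<in> \<O>" for x
  proof -
    have "s ((inv s) x) - (inv s) x \<in> P"
      by (rule inertiaD[OF s act_O[OF inv_closed[OF inertia_carrier[OF s]] that]])
    thus ?thesis using act_inv_act(2)[of s x] s that P_cong_sym by (simp add: inertia_carrier O_K)
  qed
  thus "inv s \<in> inertia" using s by (simp add: inertia_def)
next
  fix s t assume st: "s \<in> inertia" "t \<in> inertia"
  have "(s \<otimes> t) x - x \<in> P" if "x \<in> \<O>" for x
    using P_cong_trans[OF inertiaD[OF st(1), of "t x"] inertiaD[OF st(2) that]] st that
    by (simp add: act_comp inertia_carrier O_K act_O)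
  thus "s \<otimes> t \<in> inertia" using st by (simp add: inertia_def)
qed

text \<open>
  The relation \<open>\<Sum> h \<circ> m = \<Sum> m\<close> between characters with values in \<open>\<O>/P\<close> forces \<open>h\<close> to be one of the \<open>m\<close>,
  since the trivial character occurs \<open>card (inertia \<inter> M)\<close> times on the right.
\<close>

lemma hom_mod_prime_eq_act:
  assumes M: "subgroup M G" and h: "\<And>x. x \<in> \<O> \<Longrightarrow> h x \<in> \<O>"
    and mult: "\<And>x y. x \<in> \<O> \<Longrightarrow> y \<in> \<O> \<Longrightarrow> h (x * y) - h x * h y \<in> P"
    and tr: "\<And>x. x \<in> \<O> \<Longrightarrow> (\<Sum>m\<in>M. h (m x)) - (\<Sum>m\<in>M. m x) \<in> P"
    and card: "of_nat (card (inertia \<inter> M)) \<notin> P"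
  shows "\<exists>m\<in>M. \<forall>x\<in>\<O>. h x - m x \<in> P"
proof (rule ccontr)
  assume neg: "\<not> ?thesis"
  have MG: "m \<in> carrier G" if "m \<in> M" for m using M that by (rule subgroup.mem_carrier)
  have finM: "finite M" using MG finite_G by (meson finite_subset subsetI)
  \<comment> \<open>Both sides of the trace relation as one family: the flag selects
    \<open>m\<close> itself or \<open>h\<close> after \<open>m\<close>, and \<open>a\<close> carries
    the sign of its side.\<close>
  define \<chi> :: "(complex \<Rightarrow> complex) \<times> bool \<Rightarrow> complex \<Rightarrow> complex"
    where "\<chi> = (\<lambda>(m, b) x. if b then m x else h (m x))"
  define a :: "(complex \<Rightarrow> complex) \<times> bool \<Rightarrow> complex" where "a = (\<lambda>(m, b). if b then 1 else - 1)"
  have "(\<Sum>j\<in>{j\<in>M \<times> UNIV. \<forall>x\<in>\<O>. \<chi> j x - \<chi> (\<one>, True) x \<in> P}. a j) \<in> P"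
  proof (rule character_independence_mod)
    show "finite (M \<times> (UNIV :: bool set))" using finM by simp
    show "(\<one>, True) \<in> M \<times> UNIV" using subgroup.one_closed[OF M] by simp
    show "\<chi> j x \<in> \<O>" if "j \<in> M \<times> UNIV" "x \<in> \<O>" for j x
      using that h by (auto simp: \<chi>_def MG act_O)
    show "\<chi> j (x * y) - \<chi> j x * \<chi> j y \<in> P" if "j \<in> M \<times> UNIV" "x \<in> \<O>" "y \<in> \<O>" for j x y
      using that mult[of "fst j x" "fst j y"] by (auto simp: \<chi>_def MG act_mult O_K act_O P_0)
    show "\<chi> (\<one>, True) 1 \<notin> P" by (simp add: \<chi>_def act_one K_1 P_1)
    show "a j \<in> \<O>" for j by (auto simp: a_def O_simps split: prod.splits)
    show "(\<Sum>j\<in>M \<times> UNIV. a j * \<chi> j x) \<in> P" if "x \<in> \<O>" for x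
    proof -
      have "(\<Sum>j\<in>M \<times> UNIV. a j * \<chi> j x) = (\<Sum>m\<in>M. \<Sum>b\<in>UNIV. a (m, b) * \<chi> (m, b) x)"
        by (simp add: sum.cartesian_product)
      also have "\<dots> = (\<Sum>m\<in>M. m x) - (\<Sum>m\<in>M. h (m x))"
        by (simp add: UNIV_bool a_def \<chi>_def sum_subtractf)
      finally show ?thesis using P_cong_sym[OF tr[OF that]] by simp
    qed
  qed
  moreover have "{j\<in>M \<times> UNIV. \<forall>x\<in>\<O>. \<chi> j x - \<chi> (\<one>, True) x \<in> P} = (inertia \<inter> M) \<times> {True}"
  proof -
    \<comment> \<open>A trivial character on the side of \<open>h\<close> would make
      \<open>h\<close> congruent to the inverse of \<open>m\<close>, which the assumption excludes.
      So the trivial class consists of the inertia elements of \<open>M\<close> on the other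
      side.\<close>
    have "\<exists>x\<in>\<O>. h (m x) - x \<notin> P" if m: "m \<in> M" for m
    proof (rule ccontr)
      assume c: "\<not> ?thesis"
      have "h x - (inv m) x \<in> P" if x: "x \<in> \<O>" for x
      proof -
        have "(inv m) x \<in> \<O>" using x m by (simp add: act_O MG)
        with c have "h (m ((inv m) x)) - (inv m) x \<in> P" by blast
        thus ?thesis using act_inv_act(2)[of m x] m x by (simp add: MG O_K)
      qed
      thus False using neg subgroup.m_inv_closed[OF M m] by blast
    qed
    hence "(\<forall>x\<in>\<O>. \<chi> (m, b) x - \<chi> (\<one>, True) x \<in> P) \<longleftrightarrow> b \<and> m \<in> inertia" if "m \<in> M" for m b
      using that by (cases b) (auto simp: \<chi>_def act_one O_K inertia_def MG)
    thus ?thesis by auto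
  qed
  moreover have "(\<Sum>j\<in>(inertia \<inter> M) \<times> {True}. a j) = of_nat (card (inertia \<inter> M))"
  proof -
    have "(\<Sum>j\<in>(inertia \<inter> M) \<times> {True}. a j) = (\<Sum>j\<in>(inertia \<inter> M) \<times> {True}. 1)"
      by (rule sum.cong) (auto simp: a_def)
    thus ?thesis by (simp add: card_cartesian_product)
  qed
  ultimately show False using card by simp
qed

end


section \<open>Localization at a prime above \<open>p\<close>\<close>

locale galois_prime_over = galois_prime +
  fixes p :: nat
  assumes prime_p: "prime p" and p_in_P: "of_nat p \<in> P"
begin

lemma P_of_int_iff: "of_int n \<in> P \<longleftrightarrow> int p dvd n"
proof
  assume "int p dvd n"
  then obtain k where "n = int p * k" by (auto simp: dvd_def)
  thus "of_int n \<in> P" using P_rmult[OF p_in_P O_int, of k] by simp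
next
  assume n: "of_int n \<in> P"
  show "int p dvd n"
  proof (rule ccontr)
    assume "\<not> int p dvd n"
    hence "coprime (int p) n" using prime_p by (meson prime_imp_coprime prime_nat_int_transfer)
    then obtain u v where "u * int p + v * n = 1" using bezout_int[of "int p" n] by auto
    hence "of_int u * of_nat p + of_int v * of_int n = (1 :: complex)"
      by (metis of_int_1 of_int_add of_int_mult of_int_of_nat_eq)
    moreover have "of_int u * of_nat p + of_int v * of_int n \<in> P"
      using n p_in_P by (intro P_add P_lmult O_int)
    ultimately show False using P_1 by simp
  qed
qed

lemma P_of_nat_iff: "of_nat n \<in> P \<longleftrightarrow> p dvd n"
  using P_of_int_iff[of "int n"] by simp

lemma power_cong_1: assumes "x \<in> \<O>" "x \<notin> P" shows "\<exists>j>0. x ^ j - 1 \<in> P"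
proof -
  obtain a j z where z: "0 < j" "z \<in> \<O>" "x ^ a * (x ^ j - 1) = of_int (int p) * z"
    using power_cycle_mod_int[of "int p" x] assms prime_p by (auto dest: prime_gt_0_nat)
  hence "x ^ a * (x ^ j - 1) \<in> P" using P_rmult[OF p_in_P z(2)] by simp
  hence "x ^ a \<in> P \<or> x ^ j - 1 \<in> P" using assms by (intro P_prime) (auto intro!: O_power O_diff O_1)
  moreover have "x ^ a \<notin> P" using P_power_iff[of x a] assms P_1 by (cases "a = 0") auto
  ultimately show ?thesis using z by blast
qed

lemma inverse_mod: assumes "x \<in> \<O>" "x \<notin> P" shows "\<exists>y\<in>\<O>. x * y - 1 \<in> P"
proof -
  obtain j where "j > 0" "x ^ j - 1 \<in> P" using power_cong_1[OF assms] by blast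
  then obtain i where "x * x ^ i - 1 \<in> P" by (cases j) auto
  thus ?thesis using O_power[OF assms(1)] by blast
qed

lemma frobenius_add: assumes "x \<in> \<O>" "y \<in> \<O>" shows "(x + y) ^ p - (x ^ p + y ^ p) \<in> P"
proof -
  have p1: "p > 1" using prime_p by (rule prime_gt_1_nat)
  have eq: "{..p} = insert 0 (insert p {0<..<p})" using p1 by auto
  have "(x + y) ^ p = (\<Sum>k\<le>p. of_nat (p choose k) * x ^ k * y ^ (p - k))" by (rule binomial_ring)
  also have "\<dots> = y ^ p + (x ^ p + (\<Sum>k\<in>{0<..<p}. of_nat (p choose k) * x ^ k * y ^ (p - k)))"
    unfolding eq using p1 by simp
  finally have "(x + y) ^ p - (x ^ p + y ^ p) = (\<Sum>k\<in>{0<..<p}. of_nat (p choose k) * x ^ k * y ^ (p - k))" by simp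
  also have "\<dots> \<in> P"
  proof (rule P_sum)
    fix k assume "k \<in> {0<..<p}"
    hence "p dvd (p choose k)" using prime_p by (intro dvd_choose_prime) auto
    hence "of_nat (p choose k) \<in> P" by (simp add: P_of_nat_iff)
    thus "of_nat (p choose k) * x ^ k * y ^ (p - k) \<in> P" using assms by (intro P_rmult O_power)
  qed
  finally show ?thesis .
qed

lemma frobenius_sum:
  "finite I \<Longrightarrow> (\<And>i. i \<in> I \<Longrightarrow> f i \<in> \<O>) \<Longrightarrow> (\<Sum>i\<in>I. f i) ^ p - (\<Sum>i\<in>I. f i ^ p) \<in> P"
proof (induction I rule: finite_induct)
  case empty
  thus ?case using prime_gt_0_nat[OF prime_p] by (simp add: P_0 power_0_left)
next
  case (insert i I)
  have "(f i + (\<Sum>i\<in>I. f i)) ^ p - (f i ^ p + (\<Sum>i\<in>I. f i) ^ p) \<in> P"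
    using insert by (intro frobenius_add O_sum) auto
  from P_add[OF this insert.IH] insert show ?case by (simp add: algebra_simps)
qed

lemma frobenius_diff_1: assumes "x \<in> \<O>" shows "(x - 1) ^ (p ^ n) - (x ^ (p ^ n) - 1) \<in> P"
proof (induction n)
  case 0 thus ?case by (simp add: P_0)
next
  case (Suc n)
  have 1: "((x - 1) ^ (p ^ n)) ^ p - (x ^ (p ^ n) - 1) ^ p \<in> P"
    using Suc assms by (intro P_cong_power) (auto intro!: O_power O_diff O_1)
  have "((x ^ (p ^ n) - 1) + 1) ^ p - ((x ^ (p ^ n) - 1) ^ p + 1 ^ p) \<in> P"
    using assms by (intro frobenius_add) (auto intro!: O_power O_diff O_1)
  hence "(x ^ (p ^ n) - 1) ^ p - ((x ^ (p ^ n)) ^ p - 1) \<in> P"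
    using P_cong_sym by (simp add: algebra_simps)
  from P_cong_trans[OF 1 this] show ?case by (simp add: power_mult[symmetric] mult.commute)
qed

lemma frobenius_surj: assumes "x \<in> \<O>" shows "\<exists>y\<in>\<O>. x - y ^ p \<in> P"
proof (cases "x \<in> P")
  case True
  thus ?thesis using prime_gt_0_nat[OF prime_p] by (intro bexI[of _ 0]) (auto simp: O_0 power_0_left)
next
  case False
  obtain j where j: "j > 0" "x ^ j - 1 \<in> P" using power_cong_1[OF assms False] by blast
  obtain a k where ak: "j = p ^ a * k" "\<not> p dvd k"
    using multiplicity_decompose'[of j p] j(1) prime_p by (metis not_prime_unit neq0_conv)
  have "(x ^ k - 1) ^ (p ^ a) - ((x ^ k) ^ (p ^ a) - 1) \<in> P" using assms by (intro frobenius_diff_1 O_power)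
  moreover have "(x ^ k) ^ (p ^ a) - 1 \<in> P" using j ak by (simp add: power_mult[symmetric] mult.commute)
  ultimately have "(x ^ k - 1) ^ (p ^ a) \<in> P" using P_cong_iff by blast
  hence xk: "x ^ k - 1 \<in> P" using assms prime_gt_0_nat[OF prime_p]
    by (subst (asm) P_power_iff) (auto intro!: O_power O_diff O_1)
  have "coprime k p" using prime_imp_coprime[OF prime_p ak(2)] by (simp add: coprime_commute)
  then obtain b where b: "[k * b = p - 1] (mod p)" using cong_solve_coprime_nat
    by (metis cong_scalar_right mult.assoc mult_1 One_nat_def)
  have "p dvd 1 + k * b"
  proof -
    have "[1 + k * b = 1 + (p - 1)] (mod p)" using b by (rule cong_add[OF cong_refl])
    thus ?thesis using prime_gt_0_nat[OF prime_p] by (simp add: cong_def dvd_eq_mod_eq_0)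
  qed
  then obtain c where c: "1 + k * b = p * c" by (auto simp: dvd_def)
  have "x * (x ^ k) ^ b - x * 1 ^ b \<in> P"
    using P_lmult[OF assms P_cong_power[OF xk, of b]] assms by (simp add: right_diff_distrib O_power O_1)
  moreover have "x * (x ^ k) ^ b = (x ^ c) ^ p"
    using c by (metis mult.commute plus_1_eq_Suc power_Suc power_mult)
  ultimately show ?thesis using assms P_cong_sym by (intro bexI[of _ "x ^ c"]) (auto simp: O_power)
qed

text \<open>The contraction to \<open>\<O>\<close> of the ideal generated by \<open>a\<close> in the localization at \<open>P\<close>.\<close>

definition loc where "loc a = {x\<in>\<O>. \<exists>t\<in>\<O>. t \<notin> P \<and> (\<exists>z\<in>\<O>. t * x = a * z)}"

lemma locI: "x \<in> \<O> \<Longrightarrow> t \<in> \<O> \<Longrightarrow> t \<notin> P \<Longrightarrow> z \<in> \<O> \<Longrightarrow> t * x = a * z \<Longrightarrow> x \<in> loc a"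
  by (auto simp: loc_def)
lemma locE: assumes "x \<in> loc a" obtains t z where "x \<in> \<O>" "t \<in> \<O>" "t \<notin> P" "z \<in> \<O>" "t * x = a * z"
  using assms by (auto simp: loc_def)
lemma loc_O: "x \<in> loc a \<Longrightarrow> x \<in> \<O>" by (simp add: loc_def)
lemma loc_0: "0 \<in> loc a" by (rule locI[of 0 1 0]) (auto simp: O_simps P_1)
lemma loc_self: "a \<in> \<O> \<Longrightarrow> a \<in> loc a" by (rule locI[of a 1 1]) (auto simp: O_simps P_1)
lemma loc_lmult: assumes "y \<in> \<O>" "x \<in> loc a" shows "y * x \<in> loc a"
  using assms(2)
proof (rule locE)
  fix t z assume "x \<in> \<O>" "t \<in> \<O>" "t \<notin> P" "z \<in> \<O>" "t * x = a * z"
  thus ?thesis using assms(1) by (intro locI[of _ t "y * z"]) (auto simp: O_mult mult_ac)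
qed
lemma loc_mult: assumes "x \<in> loc a" "y \<in> loc b" shows "x * y \<in> loc (a * b)"
  using assms(1)
proof (rule locE)
  fix t z assume 1: "x \<in> \<O>" "t \<in> \<O>" "t \<notin> P" "z \<in> \<O>" "t * x = a * z"
  show ?thesis using assms(2)
  proof (rule locE)
    fix t' z' assume 2: "y \<in> \<O>" "t' \<in> \<O>" "t' \<notin> P" "z' \<in> \<O>" "t' * y = b * z'"
    have "t * t' * (x * y) = (t * x) * (t' * y)" by (simp add: mult_ac)
    also have "\<dots> = a * b * (z * z')" using 1 2 by (simp add: mult_ac)
    finally show ?thesis using 1 2 by (intro locI[of _ "t * t'" "z * z'"]) (auto simp: O_mult P_mult_iff)
  qed
qed
lemma loc_add: assumes "x \<in> loc a" "y \<in> loc a" shows "x + y \<in> loc a"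
  using assms(1)
proof (rule locE)
  fix t z assume 1: "x \<in> \<O>" "t \<in> \<O>" "t \<notin> P" "z \<in> \<O>" "t * x = a * z"
  show ?thesis using assms(2)
  proof (rule locE)
    fix t' z' assume 2: "y \<in> \<O>" "t' \<in> \<O>" "t' \<notin> P" "z' \<in> \<O>" "t' * y = a * z'"
    have "t * t' * (x + y) = t' * (t * x) + t * (t' * y)" by (simp add: algebra_simps)
    also have "\<dots> = a * (t' * z + t * z')" using 1 2 by (simp add: algebra_simps)
    finally show ?thesis using 1 2
      by (intro locI[of _ "t * t'" "t' * z + t * z'"]) (auto simp: O_mult O_add P_mult_iff)
  qed
qed
lemma loc_minus: "x \<in> loc a \<Longrightarrow> - x \<in> loc a" using loc_lmult[OF O_minus[OF O_1], of x] by simp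
lemma loc_diff: "x \<in> loc a \<Longrightarrow> y \<in> loc a \<Longrightarrow> x - y \<in> loc a" using loc_add[of x a "- y"] loc_minus by simp
lemma loc_sum: "(\<And>i. i \<in> I \<Longrightarrow> f i \<in> loc a) \<Longrightarrow> sum f I \<in> loc a"
  by (induction I rule: infinite_finite_induct) (auto simp: loc_0 loc_add)
lemma loc_cancel: assumes "t \<in> \<O>" "t \<notin> P" "x \<in> \<O>" "t * x \<in> loc a" shows "x \<in> loc a"
  using assms(4)
proof (rule locE)
  fix t' z assume "t' \<in> \<O>" "t' \<notin> P" "z \<in> \<O>" "t' * (t * x) = a * z"
  thus ?thesis using assms by (intro locI[of _ "t' * t" z]) (auto simp: O_mult P_mult_iff mult_ac)
qed

text \<open>In the localization, every \<open>y\<close> in \<open>P\<close> is nilpotent modulo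
  \<open>p\<close>, because y^j - 1 is a unit there. So each new \<open>y\<close> is handled by
  multiplying \<open>b\<close> by the last power of \<open>y\<close> that does not yet carry it into
  the ideal of \<open>p\<close>. The quotient of the result by \<open>p\<close> will invert
  \<open>P\<close> locally.\<close>

lemma loc_p_annihilator:
  assumes "finite Y" "Y \<subseteq> P"
  shows "\<exists>b\<in>\<O>. b \<notin> loc (of_nat p) \<and> (\<forall>y\<in>Y. b * y \<in> loc (of_nat p))"
  using assms
proof (induction Y rule: finite_induct)
  case empty
  have "1 \<notin> loc (of_nat p)"
  proof
    assume "1 \<in> loc (of_nat p)"
    then obtain t z where "t \<in> \<O>" "t \<notin> P" "z \<in> \<O>" "t = of_nat p * z" by (auto elim!: locE)
    thus False using P_rmult[OF p_in_P] by blast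
  qed
  thus ?case using O_1 by blast
next
  case (insert y Y)
  then obtain b where b: "b \<in> \<O>" "b \<notin> loc (of_nat p)" "\<And>y. y \<in> Y \<Longrightarrow> b * y \<in> loc (of_nat p)" by auto
  have y: "y \<in> P" "y \<in> \<O>" using insert P_O by auto
  obtain a j z where z: "0 < j" "z \<in> \<O>" "y ^ a * (y ^ j - 1) = of_int (int p) * z"
    using power_cycle_mod_int[of "int p" y] y prime_p by (auto dest: prime_gt_0_nat)
  have "y ^ j - 1 \<notin> P" using P_power[OF y(1) z(1)] P_diff[of "y ^ j" "y ^ j - 1"] P_1 by auto
  hence "b * y ^ a \<in> loc (of_nat p)"
    using z y b by (intro locI[of _ "y ^ j - 1" "b * z"]) (auto simp: O_mult O_power O_diff O_1 mult_ac)
  define k where "k = (LEAST k. b * y ^ k \<in> loc (of_nat p))"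
  have k: "b * y ^ k \<in> loc (of_nat p)" unfolding k_def by (rule LeastI) fact
  have "k \<noteq> 0" using k b(2) by (cases k) auto
  then obtain l where l: "k = Suc l" by (cases k) auto
  have "b * y ^ l \<notin> loc (of_nat p)" using not_less_Least[of l "\<lambda>k. b * y ^ k \<in> loc (of_nat p)"] l by (simp add: k_def)
  moreover have "b * y ^ l * y' \<in> loc (of_nat p)" if "y' \<in> insert y Y" for y'
    using that k l loc_lmult[OF O_power[OF y(2), of l] b(3), of y'] by (auto simp: mult_ac)
  ultimately show ?case using b(1) y by (intro bexI[of _ "b * y ^ l"]) (auto simp: O_mult O_power)
qed

text \<open>The maximal ideal of the localization at \<open>P\<close> is invertible, hence principal.\<close>

lemma exists_uniformizer: "\<exists>c\<in>P. \<exists>u\<in>\<O>. u \<notin> P \<and> (\<forall>x\<in>P. \<exists>z\<in>\<O>. u * x = c * z)"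
proof -
  obtain B where B: "finite B" "B \<subseteq> P" "P \<subseteq> zspan B"
    using integral_generators[of P] P_0 P_diff P_O by auto
  obtain b where b: "b \<in> \<O>" "b \<notin> loc (of_nat p)" "\<And>y. y \<in> B \<Longrightarrow> b * y \<in> loc (of_nat p)"
    using loc_p_annihilator[OF B(1,2)] by blast
  have "\<forall>y\<in>B. \<exists>t. t \<in> \<O> \<and> t \<notin> P \<and> (\<exists>z\<in>\<O>. t * (b * y) = of_nat p * z)"
    using b(3) by (auto simp: loc_def)
  then obtain t where t: "\<And>y. y \<in> B \<Longrightarrow> t y \<in> \<O>" "\<And>y. y \<in> B \<Longrightarrow> t y \<notin> P"
    "\<And>y. y \<in> B \<Longrightarrow> \<exists>z\<in>\<O>. t y * (b * y) = of_nat p * z" by metis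
  define s where "s = (\<Prod>y\<in>B. t y)"
  have s: "s \<in> \<O>" "s \<notin> P" using O_prod[of B t] P_prod_notin[OF B(1), of t] t unfolding s_def by auto
  have sb: "\<exists>z\<in>\<O>. s * b * x = of_nat p * z" if x: "x \<in> P" for x
  proof -
    have 1: "\<exists>z\<in>\<O>. s * b * y = of_nat p * z" if y: "y \<in> B" for y
    proof -
      obtain z where z: "z \<in> \<O>" "t y * (b * y) = of_nat p * z" using t(3)[OF y] by blast
      have "s = t y * (\<Prod>y\<in>B - {y}. t y)" unfolding s_def using B y by (intro prod.remove) auto
      hence "s * b * y = (\<Prod>y\<in>B - {y}. t y) * (t y * (b * y))" by simp
      also have "\<dots> = of_nat p * ((\<Prod>y\<in>B - {y}. t y) * z)" by (simp add: z)
      finally show ?thesis using z t by (intro bexI[of _ "(\<Prod>y\<in>B - {y}. t y) * z"]) (auto intro!: O_mult O_prod)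
    qed
    then obtain z where z: "\<And>y. y \<in> B \<Longrightarrow> z y \<in> \<O>" "\<And>y. y \<in> B \<Longrightarrow> s * b * y = of_nat p * z y" by metis
    obtain c where c: "x = (\<Sum>y\<in>B. of_int (c y) * y)" using x B by (auto simp: zspan_def)
    have "s * b * x = (\<Sum>y\<in>B. of_int (c y) * (s * b * y))" by (simp add: c sum_distrib_left mult_ac)
    also have "\<dots> = of_nat p * (\<Sum>y\<in>B. of_int (c y) * z y)" using z(2) by (simp add: sum_distrib_left mult_ac)
    finally show ?thesis using z(1) by (intro bexI[of _ "\<Sum>y\<in>B. of_int (c y) * z y"]) (auto intro!: O_sum O_mult O_int)
  qed
  have p0: "of_nat p \<noteq> (0::complex)" using prime_p by auto
  \<comment> \<open>Multiplication by \<open>l\<close> maps \<open>P\<close> into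
    \<open>\<O>\<close>, although \<open>l\<close> is not integral at \<open>P\<close>.\<close>
  define l where "l = s * b / of_nat p"
  have lK: "l \<in> K" using s b by (simp add: l_def K_divide K_mult K_nat O_K)
  have lO: "l * x \<in> \<O>" if "x \<in> P" for x
    using sb[OF that] p0 by (auto simp: l_def)
  \<comment> \<open>If \<open>l\<close> mapped \<open>P\<close> into itself, the determinant trick
    would make \<open>l\<close> integral. So some \<open>l * c\<close> is a unit at
    \<open>P\<close>, and (l c) x = c (l x) exhibits \<open>c\<close> as a local generator with
    denominator \<open>l * c\<close>.\<close>
  have "\<exists>c\<in>P. l * c \<notin> P"
  proof (rule ccontr)
    assume "\<not> ?thesis"
    hence "l * y \<in> zspan B" if "y \<in> B" for y using B that by auto
    moreover obtain b0 where "b0 \<in> B" "b0 \<noteq> 0"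
    proof (rule ccontr)
      assume "\<not> thesis"
      hence "\<forall>b\<in>B. b = 0" using that by blast
      moreover obtain c where "of_nat p = (\<Sum>y\<in>B. of_int (c y) * y)" using p_in_P B by (auto simp: zspan_def)
      ultimately show False using p0 by (simp add: sum.neutral)
    qed
    ultimately have "algebraic_int l" using algebraic_int_if_stabilizes_zspan[OF B(1)] by blast
    hence "l \<in> \<O>" using lK by (simp add: \<O>_def)
    moreover have "s * b = of_nat p * l" using p0 by (simp add: l_def)
    ultimately have "b \<in> loc (of_nat p)" using s b by (intro locI[of b s l]) auto
    with b show False by simp
  qed
  then obtain c where c: "c \<in> P" "l * c \<notin> P" by blast
  have "\<exists>z\<in>\<O>. l * c * x = c * z" if "x \<in> P" for x
    using lO[OF that] by (intro bexI[of _ "l * x"]) (auto simp: mult_ac)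
  thus ?thesis using c lO[OF c(1)] by blast
qed

end


section \<open>Ideals of the ring of integers, residue fields and Frobenius elements\<close>

context galois_field
begin

abbreviation R where "R \<equiv> ring_of_integers K"

lemma R_simps [simp]:
  "carrier R = \<O>" "monoid.mult R = (*)" "ring.add R = (+)" "\<one>\<^bsub>R\<^esub> = 1" "\<zero>\<^bsub>R\<^esub> = 0"
  by (simp_all add: ring_of_integers_def \<O>_def ring_of_type_algebra_def)

lemma cring_R: "cring R"
proof (intro cringI abelian_groupI comm_monoidI)
  show "\<exists>y\<in>carrier R. y \<oplus>\<^bsub>R\<^esub> x = \<zero>\<^bsub>R\<^esub>" if "x \<in> carrier R" for x
    using that by (intro bexI[of _ "- x"]) (auto simp: O_simps)
qed (auto simp: O_simps algebra_simps)

lemma ideal_R_iff: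
  "ideal J R \<longleftrightarrow> J \<subseteq> \<O> \<and> 0 \<in> J \<and> (\<forall>x\<in>J. \<forall>y\<in>J. x + y \<in> J) \<and> (\<forall>x\<in>\<O>. \<forall>y\<in>J. x * y \<in> J)"
proof
  assume J: "ideal J R"
  show "J \<subseteq> \<O> \<and> 0 \<in> J \<and> (\<forall>x\<in>J. \<forall>y\<in>J. x + y \<in> J) \<and> (\<forall>x\<in>\<O>. \<forall>y\<in>J. x * y \<in> J)"
    using ideal.Icarr[OF J] additive_subgroup.zero_closed[OF ideal.axioms(1)[OF J]]
      additive_subgroup.a_closed[OF ideal.axioms(1)[OF J]] ideal.I_l_closed[OF J] by auto
next
  assume J: "J \<subseteq> \<O> \<and> 0 \<in> J \<and> (\<forall>x\<in>J. \<forall>y\<in>J. x + y \<in> J) \<and> (\<forall>x\<in>\<O>. \<forall>y\<in>J. x * y \<in> J)"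
  interpret R: cring R by (rule cring_R)
  have J': "y * x \<in> J" if "x \<in> \<O>" "y \<in> J" for x y using J that by (metis mult.commute)
  show "ideal J R"
  proof (rule idealI)
    show "subgroup J (add_monoid R)"
    proof (rule group.subgroupI[OF R.a_group])
      fix x assume x: "x \<in> J"
      have "- x \<in> J" using J x O_minus[OF O_1] by (metis mult_minus1)
      moreover have "inv\<^bsub>add_monoid R\<^esub> x = - x"
        using J x by (intro group.inv_equality[OF R.a_group]) (auto simp: O_minus)
      ultimately show "inv\<^bsub>add_monoid R\<^esub> x \<in> J" by simp
    qed (use J in auto)
  qed (use J J' R.ring_axioms in auto)
qed

end

context galois_prime_over
begin

lemma ideal_P: "ideal P R"
  using P_O P_0 P_add P_lmult by (auto simp: ideal_R_iff)

lemma maximalideal_P: "maximalideal P R"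
proof (rule maximalidealI[OF ideal_P])
  show "carrier R \<noteq> P" using P_1 O_1 by auto
  fix J assume J: "ideal J R" "P \<subseteq> J" "J \<subseteq> carrier R"
  show "J = P \<or> J = carrier R"
  proof (cases "J = P")
    case False
    then obtain x where x: "x \<in> J" "x \<notin> P" "x \<in> \<O>" using J by auto
    obtain y where y: "y \<in> \<O>" "x * y - 1 \<in> P" using inverse_mod[OF x(3,2)] by blast
    have "y * x \<in> J" "- (x * y - 1) \<in> J" using J(1) x y subsetD[OF J(2) P_minus[OF y(2)]] by (simp_all add: ideal_R_iff)
    hence "y * x + - (x * y - 1) \<in> J" using J(1) unfolding ideal_R_iff by blast
    hence "1 \<in> J" by (simp add: mult.commute)
    hence "z \<in> J" if "z \<in> \<O>" for z using J that mult_1_right[of z] by (metis ideal_R_iff)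
    thus ?thesis using J by auto
  qed auto
qed

text \<open>The multiplicative group of the residue field is cyclic; finiteness holds because
  integral coordinates may be reduced modulo \<open>p\<close>. The result is phrased by congruences,
  so that tame characters can be handled through exponents of \<open>a\<close>.\<close>

lemma residue_generator: "\<exists>a\<in>\<O>. a \<notin> P \<and> (\<forall>x\<in>\<O>. x \<notin> P \<longrightarrow> (\<exists>i::nat. x - a ^ i \<in> P))"
proof -
  interpret P: ideal P R by (rule ideal_P)
  interpret Q: field "R Quot P" using maximalideal.quotient_is_field[OF maximalideal_P cring_R] .
  have coset: "P +>\<^bsub>R\<^esub> x = {z. z - x \<in> P}" for x
  proof (intro equalityI subsetI)
    fix z assume "z \<in> {z. z - x \<in> P}"
    thus "z \<in> P +>\<^bsub>R\<^esub> x" unfolding a_r_coset_def' by (intro UN_I[of "z - x"]) auto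
  qed (auto simp: a_r_coset_def')
  have coset_eq: "P +>\<^bsub>R\<^esub> x = P +>\<^bsub>R\<^esub> y \<longleftrightarrow> x - y \<in> P" for x y
  proof
    assume "P +>\<^bsub>R\<^esub> x = P +>\<^bsub>R\<^esub> y"
    moreover have "x \<in> P +>\<^bsub>R\<^esub> x" by (simp add: coset P_0)
    ultimately show "x - y \<in> P" by (simp add: coset)
  next
    assume "x - y \<in> P"
    thus "P +>\<^bsub>R\<^esub> x = P +>\<^bsub>R\<^esub> y"
      unfolding coset using P_cong_trans[of _ x y] P_cong_trans[of _ y x] P_cong_sym by blast
  qed
  have carr: "carrier (R Quot P) = (\<lambda>x. P +>\<^bsub>R\<^esub> x) ` \<O>"
    by (auto simp: FactRing_def A_RCOSETS_def')
  have "finite (carrier (R Quot P))"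
  proof -
    obtain r :: nat and b where b: "\<And>j. j < r \<Longrightarrow> b j \<in> \<O>" "\<And>x. x \<in> \<O> \<Longrightarrow> \<exists>c. x = (\<Sum>j<r. of_int (c j) * b j)"
      using integral_basis[of \<O>] by (auto simp: O_simps)
    have "carrier (R Quot P) \<subseteq> (\<lambda>c. P +>\<^bsub>R\<^esub> (\<Sum>j<r. of_int (c j) * b j)) ` (PiE {..<r} (\<lambda>_. {0..<int p}))"
    proof
      fix C assume "C \<in> carrier (R Quot P)"
      then obtain x where x: "x \<in> \<O>" "C = P +>\<^bsub>R\<^esub> x" by (auto simp: carr)
      obtain c where c: "x = (\<Sum>j<r. of_int (c j) * b j)" using b(2)[OF x(1)] by blast
      define d where "d = restrict (\<lambda>j. c j mod int p) {..<r}"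
      have "x - (\<Sum>j<r. of_int (d j) * b j) = (\<Sum>j<r. of_int (c j - d j) * b j)"
        by (simp add: c sum_subtractf left_diff_distrib)
      also have "\<dots> \<in> P"
      proof (intro P_sum P_rmult)
        fix j assume j: "j \<in> {..<r}"
        thus "of_int (c j - d j) \<in> P" by (simp only: P_of_int_iff) (simp add: d_def)
        from j show "b j \<in> \<O>" by (simp add: b)
      qed
      finally have "C = P +>\<^bsub>R\<^esub> (\<Sum>j<r. of_int (d j) * b j)" using x coset_eq by simp
      moreover have "d \<in> PiE {..<r} (\<lambda>_. {0..<int p})" using prime_gt_0_nat[OF prime_p] by (auto simp: d_def)
      ultimately show "C \<in> (\<lambda>c. P +>\<^bsub>R\<^esub> (\<Sum>j<r. of_int (c j) * b j)) ` (PiE {..<r} (\<lambda>_. {0..<int p}))" by blast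
    qed
    thus ?thesis by (rule finite_subset) (auto intro!: finite_imageI finite_PiE)
  qed
  from Q.finite_field_mult_group_has_gen[OF this] obtain A where A: "A \<in> carrier (mult_of (R Quot P))"
    "carrier (mult_of (R Quot P)) = {A [^]\<^bsub>R Quot P\<^esub> i | i::nat. i \<in> UNIV}" by (auto simp: nat_pow_mult_of)
  obtain a where a: "a \<in> \<O>" "A = P +>\<^bsub>R\<^esub> a" using A(1) by (auto simp: carr)
  have zero: "\<zero>\<^bsub>R Quot P\<^esub> = P +>\<^bsub>R\<^esub> 0" using coset[of 0] by (simp add: FactRing_def)
  have notin: "P +>\<^bsub>R\<^esub> x \<in> carrier (mult_of (R Quot P)) \<longleftrightarrow> x \<notin> P" if "x \<in> \<O>" for x
    using that coset_eq[of x 0] by (simp add: carr zero)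
  have pow: "A [^]\<^bsub>R Quot P\<^esub> i = P +>\<^bsub>R\<^esub> (a ^ i)" for i :: nat
  proof (induction i)
    case 0 thus ?case by (simp add: FactRing_def)
  next
    case (Suc i)
    thus ?case using P.rcoset_mult_add[of "a ^ i" a] a by (simp add: FactRing_def O_power mult.commute)
  qed
  show ?thesis
  proof (intro bexI[of _ a] conjI ballI impI)
    show "a \<notin> P" using A(1) a notin by blast
    fix x assume x: "x \<in> \<O>" "x \<notin> P"
    hence "P +>\<^bsub>R\<^esub> x \<in> carrier (mult_of (R Quot P))" using notin by blast
    then obtain i :: nat where "P +>\<^bsub>R\<^esub> x = A [^]\<^bsub>R Quot P\<^esub> i" unfolding A(2) by blast
    hence "P +>\<^bsub>R\<^esub> x = P +>\<^bsub>R\<^esub> (a ^ i)" by (simp only: pow)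
    thus "\<exists>i::nat. x - a ^ i \<in> P" using coset_eq by blast
  qed (rule a(1))
qed

text \<open>A Frobenius element without decomposition groups: modulo \<open>P\<close> the
  \<open>p\<close>-th power map is additive and fixes traces, which are integers. So
  \<open>hom_mod_prime_eq_act\<close> applies to it with all of \<open>G\<close>, and the hypothesis
  on the inertia group keeps the relevant multiplicity nonzero modulo \<open>P\<close>.\<close>

lemma exists_frobenius:
  assumes "\<not> p dvd card inertia"
  shows "\<exists>f\<in>carrier G. \<forall>x\<in>\<O>. x ^ p - f x \<in> P"
proof (rule hom_mod_prime_eq_act)
  show "subgroup (carrier G) G" by (rule subgroup_self)
  show "x ^ p \<in> \<O>" if "x \<in> \<O>" for x using that by (rule O_power)
  show "(x * y) ^ p - x ^ p * y ^ p \<in> P" for x y by (simp add: power_mult_distrib P_0)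
  have "inertia \<inter> carrier G = inertia" by (auto simp: inertia_def)
  thus "of_nat (card (inertia \<inter> carrier G)) \<notin> P" using assms by (simp add: P_of_nat_iff)
  fix x assume x: "x \<in> \<O>"
  have nat: "of_nat n ^ p - of_nat n \<in> P" for n
  proof (induction n)
    case 0 thus ?case using prime_gt_0_nat[OF prime_p] by (simp add: P_0 power_0_left)
  next
    case (Suc n)
    from P_add[OF frobenius_add[OF O_nat[of n] O_1] Suc] show ?case by (simp add: algebra_simps)
  qed
  obtain n where n: "Tr x = of_int n" using Tr_Ints[OF x] by (auto elim: Ints_cases)
  define m where "m = nat (n mod int p)"
  have m: "Tr x - of_nat m \<in> P"
  proof -
    have "int m = n mod int p" using prime_gt_0_nat[OF prime_p] by (simp add: m_def)
    hence "int p dvd n - int m" by simp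
    hence "of_int (n - int m) \<in> P" by (simp only: P_of_int_iff)
    thus ?thesis by (simp add: n)
  qed
  have "Tr x ^ p - of_nat m ^ p \<in> P" using m n by (intro P_cong_power) (auto simp: O_simps)
  from P_cong_trans[OF this nat] have "Tr x ^ p - of_nat m \<in> P" .
  from P_cong_trans[OF this P_cong_sym[OF m]] have "Tr x ^ p - Tr x \<in> P" .
  moreover have "Tr x ^ p - (\<Sum>s\<in>carrier G. s x ^ p) \<in> P"
    unfolding Tr_def using finite_G x by (intro frobenius_sum) (auto simp: act_O)
  ultimately have "(\<Sum>s\<in>carrier G. s x ^ p) - Tr x \<in> P" using P_cong_trans P_cong_sym by blast
  thus "(\<Sum>m\<in>carrier G. m x ^ p) - (\<Sum>m\<in>carrier G. m x) \<in> P" by (simp add: Tr_def)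
qed

end

section \<open>The valuation filtration at a prime\<close>

locale galois_uniformizer = galois_prime_over +
  fixes \<pi> u :: complex
  assumes pi_P: "\<pi> \<in> P" and u_O: "u \<in> \<O>" and u_P: "u \<notin> P"
    and unif: "\<And>x. x \<in> P \<Longrightarrow> \<exists>z\<in>\<O>. u * x = \<pi> * z"
begin

lemma pi_O: "\<pi> \<in> \<O>" using P_O pi_P by blast

lemma pi_0: "\<pi> \<noteq> 0"
proof
  assume "\<pi> = 0"
  with unif[OF p_in_P] have "u * of_nat p = 0" by auto
  thus False using u_P P_0 prime_p by auto
qed

text \<open>The integers of valuation at least \<open>k\<close> at \<open>P\<close>. As a
  contraction from the localization it lets factors outside \<open>P\<close> be cancelled at once;
  \<open>P_pow_eq_F\<close> identifies it with the ideal power used in the ramification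
  index.\<close>

definition F where "F k = loc (\<pi> ^ k)"

lemma F_I: "x \<in> \<O> \<Longrightarrow> t \<in> \<O> \<Longrightarrow> t \<notin> P \<Longrightarrow> z \<in> \<O> \<Longrightarrow> t * x = \<pi> ^ k * z \<Longrightarrow> x \<in> F k"
  unfolding F_def by (rule locI)
lemma F_E: assumes "x \<in> F k" obtains t z where "x \<in> \<O>" "t \<in> \<O>" "t \<notin> P" "z \<in> \<O>" "t * x = \<pi> ^ k * z"
  using assms unfolding F_def by (rule locE)
lemma F_O: "x \<in> F k \<Longrightarrow> x \<in> \<O>" unfolding F_def by (rule loc_O)
lemma F_0: "F 0 = \<O>" using F_O by (auto intro!: F_I[of _ 1] simp: O_1 P_1)
lemma zero_F: "0 \<in> F k" unfolding F_def by (rule loc_0)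
lemma F_add: "x \<in> F k \<Longrightarrow> y \<in> F k \<Longrightarrow> x + y \<in> F k" unfolding F_def by (rule loc_add)
lemma F_diff: "x \<in> F k \<Longrightarrow> y \<in> F k \<Longrightarrow> x - y \<in> F k" unfolding F_def by (rule loc_diff)
lemma F_minus: "x \<in> F k \<Longrightarrow> - x \<in> F k" unfolding F_def by (rule loc_minus)
lemma F_lmult: "x \<in> \<O> \<Longrightarrow> y \<in> F k \<Longrightarrow> x * y \<in> F k" unfolding F_def by (rule loc_lmult)
lemma F_sum: "(\<And>i. i \<in> I \<Longrightarrow> f i \<in> F k) \<Longrightarrow> sum f I \<in> F k" unfolding F_def by (rule loc_sum)
lemma F_unit_cancel: "t \<in> \<O> \<Longrightarrow> t \<notin> P \<Longrightarrow> x \<in> \<O> \<Longrightarrow> t * x \<in> F k \<Longrightarrow> x \<in> F k" unfolding F_def by (rule loc_cancel)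
lemma F_mult: "x \<in> F k \<Longrightarrow> y \<in> F l \<Longrightarrow> x * y \<in> F (k + l)" unfolding F_def power_add by (rule loc_mult)
lemma pi_F: "\<pi> ^ k \<in> F k" unfolding F_def by (intro loc_self O_power pi_O)
lemma F_1: "F 1 = P"
proof (intro equalityI subsetI)
  fix x assume "x \<in> F 1"
  thus "x \<in> P"
  proof (rule F_E)
    fix t z assume "x \<in> \<O>" "t \<in> \<O>" "t \<notin> P" "z \<in> \<O>" "t * x = \<pi> ^ 1 * z"
    thus ?thesis using P_prime[of t x] P_rmult[OF pi_P, of z] by simp
  qed
next
  fix x assume "x \<in> P"
  with unif obtain z where "z \<in> \<O>" "u * x = \<pi> * z" by blast
  thus "x \<in> F 1" using \<open>x \<in> P\<close> by (intro F_I[of x u z]) (auto simp: P_O u_O u_P)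
qed
lemma F_mono: assumes "k \<le> l" "x \<in> F l" shows "x \<in> F k"
  using assms(2)
proof (rule F_E)
  fix t z assume "x \<in> \<O>" "t \<in> \<O>" "t \<notin> P" "z \<in> \<O>" "t * x = \<pi> ^ l * z"
  thus ?thesis using assms(1)
    by (intro F_I[of x t "\<pi> ^ (l - k) * z"]) (auto simp: O_mult O_power pi_O mult.assoc[symmetric] power_add[symmetric])
qed
lemma F_power: assumes "x \<in> P" shows "x ^ k \<in> F k"
proof (induction k)
  case (Suc k)
  thus ?case using F_mult[of x 1 "x ^ k" k] assms by (simp add: F_1[simplified])
qed (simp add: F_0 O_1)
lemma pi_power_notin: assumes "z \<in> \<O>" "z \<notin> P" shows "\<pi> ^ k * z \<notin> F (Suc k)"
proof
  assume "\<pi> ^ k * z \<in> F (Suc k)"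
  thus False
  proof (rule F_E)
    fix t w assume t: "t \<in> \<O>" "t \<notin> P" "w \<in> \<O>" "t * (\<pi> ^ k * z) = \<pi> ^ Suc k * w"
    hence "\<pi> ^ k * (t * z) = \<pi> ^ k * (\<pi> * w)" by (simp add: mult_ac)
    hence "t * z = \<pi> * w" using pi_0 by simp
    hence "t * z \<in> P" using P_rmult[OF pi_P t(3)] by simp
    thus False using assms t by (simp add: P_mult_iff)
  qed
qed
text \<open>Valuations add: up to factors outside \<open>P\<close>, an element of exact order
  \<open>k\<close> is \<open>\<pi> ^ k\<close>.\<close>

lemma F_cancel:
  assumes x: "x \<in> F k" "x \<notin> F (Suc k)" and y: "y \<in> \<O>" "x * y \<in> F (k + m)"
  shows "y \<in> F m"
  using x(1)
proof (rule F_E)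
  fix t z assume t: "x \<in> \<O>" "t \<in> \<O>" "t \<notin> P" "z \<in> \<O>" "t * x = \<pi> ^ k * z"
  have z: "z \<notin> P"
  proof
    assume "z \<in> P"
    then obtain w where w: "w \<in> \<O>" "u * z = \<pi> * w" using unif by blast
    have "(t * u) * x = \<pi> ^ k * (u * z)" using t by (simp add: mult_ac)
    also have "\<dots> = \<pi> ^ Suc k * w" by (simp add: w mult_ac)
    finally have "x \<in> F (Suc k)" using t w u_O u_P by (intro F_I[of x "t * u" w]) (auto simp: O_mult P_mult_iff)
    with x show False by simp
  qed
  show ?thesis using y(2)
  proof (rule F_E)
    fix r w assume r: "r \<in> \<O>" "r \<notin> P" "w \<in> \<O>" "r * (x * y) = \<pi> ^ (k + m) * w"
    have "\<pi> ^ k * (r * z * y) = (t * x) * (r * y)" by (simp add: t mult_ac)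
    also have "\<dots> = \<pi> ^ k * (\<pi> ^ m * (t * w))" using r(4) by (simp add: mult_ac power_add)
    finally have "(r * z) * y = \<pi> ^ m * (t * w)" using pi_0 by simp
    thus ?thesis using t r z y by (intro F_I[of y "r * z" "t * w"]) (auto simp: O_mult P_mult_iff)
  qed
qed
text \<open>\<open>x\<close> divides its norm N, and the powers of \<open>\<pi>\<close> are
  eventually periodic modulo N. Hence \<open>x\<close> divides \<pi>^a (\<pi>^j - 1), which has
  order exactly \<open>a\<close> because its second factor is outside \<open>P\<close>.\<close>

lemma F_separated: assumes "x \<in> \<O>" "x \<noteq> 0" shows "\<exists>k. x \<notin> F k"
proof -
  obtain y where y: "y \<in> \<O>" "Nm x = x * y" using Nm_dvd[OF assms(1)] by blast
  obtain N where N: "Nm x = of_int N" using Nm_Ints[OF assms(1)] by (auto elim: Ints_cases)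
  have "N \<noteq> 0" using N Nm_eq_0_iff[of x] assms by (auto simp: O_K)
  from power_cycle_mod_int[OF this pi_O] obtain a j z where j: "0 < j" "z \<in> \<O>" "\<pi> ^ a * (\<pi> ^ j - 1) = of_int N * z" by blast
  have nP: "\<pi> ^ j - 1 \<notin> P" using P_power[OF pi_P j(1)] P_diff[of "\<pi> ^ j" "\<pi> ^ j - 1"] P_1 by auto
  have "x \<notin> F (Suc a)"
  proof
    assume "x \<in> F (Suc a)"
    hence "(y * z) * x \<in> F (Suc a)" using y j by (intro F_lmult O_mult)
    moreover have "(y * z) * x = \<pi> ^ a * (\<pi> ^ j - 1)" using j y N by (simp add: mult_ac)
    ultimately show False using pi_power_notin[OF _ nP, of a] by (simp add: O_diff O_power pi_O O_1)
  qed
  thus ?thesis ..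
qed

text \<open>The decomposition group of \<open>P\<close>.\<close>

definition stabilizer where "stabilizer = {s\<in>carrier G. \<forall>x\<in>\<O>. s x \<in> P \<longleftrightarrow> x \<in> P}"

lemma inertia_stabilizer: "inertia \<subseteq> stabilizer"
  using inertia_carrier inertia_act_iff by (auto simp: stabilizer_def)
lemma stabilizer_inv: assumes "s \<in> stabilizer" shows "inv s \<in> stabilizer"
proof -
  have s: "s \<in> carrier G" using assms by (simp add: stabilizer_def)
  have "(inv s) x \<in> P \<longleftrightarrow> x \<in> P" if "x \<in> \<O>" for x
  proof -
    have "s ((inv s) x) \<in> P \<longleftrightarrow> (inv s) x \<in> P"
      using assms act_O[OF inv_closed[OF s] that] unfolding stabilizer_def by blast
    thus ?thesis using act_inv_act(2)[OF s O_K[OF that]] by simp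
  qed
  thus ?thesis using s by (simp add: stabilizer_def)
qed
lemma F_act: assumes s: "s \<in> stabilizer" and x: "x \<in> F k" shows "s x \<in> F k"
  using x
proof (rule F_E)
  fix t z assume t: "x \<in> \<O>" "t \<in> \<O>" "t \<notin> P" "z \<in> \<O>" "t * x = \<pi> ^ k * z"
  have sG: "s \<in> carrier G" using s by (simp add: stabilizer_def)
  have "s t * s x = s z * s \<pi> ^ k"
  proof -
    have "s (t * x) = s (z * \<pi> ^ k)" by (simp only: t(5) mult.commute)
    thus ?thesis using t(1,2,4) pi_O sG by (simp add: act_mult act_power O_K K_power)
  qed
  moreover have "s \<pi> \<in> P" using s pi_P pi_O by (simp add: stabilizer_def)
  ultimately have "s t * s x \<in> F k" using F_lmult[OF act_O[OF sG t(4)] F_power] by simp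
  thus ?thesis using t s sG by (intro F_unit_cancel[of "s t" "s x"]) (auto simp: act_O stabilizer_def)
qed

end


section \<open>Tame inertia\<close>

lemma sum_power_complementary:
  "(\<Sum>i<n. x ^ (n - Suc i) * x ^ i) = of_nat n * (x ^ (n - 1) :: 'a :: comm_semiring_1)"
proof -
  have "(\<Sum>i<n. x ^ (n - Suc i) * x ^ i) = (\<Sum>i<n. x ^ (n - 1))"
  proof (rule sum.cong)
    fix i assume "i \<in> {..<n}"
    hence "n - Suc i + i = n - 1" by simp
    thus "x ^ (n - Suc i) * x ^ i = x ^ (n - 1)" by (metis power_add)
  qed simp
  thus ?thesis by simp
qed

text \<open>\<open>e\<close> is fixed by the order of \<open>p\<close> in the filtration and not by
  \<open>ramification_index\<close>, so that the locale can also be entered with \<open>p\<close>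
  itself as uniformizer and exponent 1.\<close>

locale galois_tame = galois_uniformizer +
  fixes e :: nat
  assumes p_F: "of_nat p \<in> F e" "of_nat p \<notin> F (Suc e)" and tame: "\<not> p dvd e"
begin

text \<open>
  An automorphism that is trivial modulo \<open>P\<^sup>k\<close> on \<open>\<O>\<close> and modulo \<open>P\<^sup>k\<^sup>+\<^sup>1\<close> on the uniformizer is trivial modulo
  \<open>P\<^sup>k\<^sup>+\<^sup>1\<close>, since it differs from the identity by a derivation, which vanishes on \<open>p\<close>-th powers. Tameness
  is what allows one to go on: \<open>p\<close> is fixed and equals \<open>\<pi>\<^sup>e\<close> up to a unit.
\<close>

lemma inertia_step:
  assumes s: "s \<in> inertia" and A: "\<And>x. x \<in> \<O> \<Longrightarrow> s x - x \<in> F (Suc k)" and B: "s \<pi> - \<pi> \<in> F (k + 2)"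
    and x: "x \<in> \<O>"
  shows "s x - x \<in> F (k + 2)"
proof -
  have sG: "s \<in> carrier G" using s by (rule inertia_carrier)
  \<comment> \<open>A twisted product rule for \<open>u * x = \<pi> * y\<close>: each error term
    reaches order \<open>k + 2\<close>, either by \<open>B\<close> or by an additional factor in
    \<open>P\<close>.\<close>
  have onP: "s x - x \<in> F (k + 2)" if x: "x \<in> P" for x
  proof -
    have xO: "x \<in> \<O>" using x by (rule P_O)
    obtain y where y: "y \<in> \<O>" "u * x = \<pi> * y" using unif[OF x] by blast
    have "s (u * x) = s (\<pi> * y)" by (simp only: y(2))
    hence eq: "s u * s x = s \<pi> * s y" using y(1) u_O xO pi_O sG by (simp add: act_mult O_K)
    have "u * (s x - x) = (s \<pi> - \<pi>) * s y + \<pi> * (s y - y) - (s u - u) * s x"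
      using eq y(2) by (simp add: algebra_simps)
    moreover have "(s \<pi> - \<pi>) * s y \<in> F (k + 2)"
      using F_lmult[OF act_O[OF sG y(1)] B] by (simp add: mult.commute)
    moreover have "\<pi> * (s y - y) \<in> F (k + 2)"
      using F_mult[of \<pi> 1 "s y - y" "Suc k"] pi_P A[OF y(1)] by (simp add: F_1[simplified] numeral_2_eq_2)
    moreover have "(s u - u) * s x \<in> F (k + 2)"
      using F_mult[of "s u - u" "Suc k" "s x" 1] A[OF u_O] inertia_act_iff[OF s xO] x by (simp add: F_1[simplified] numeral_2_eq_2)
    ultimately have "u * (s x - x) \<in> F (k + 2)" by (simp add: F_add F_diff)
    thus ?thesis using u_O u_P xO sG by - (rule F_unit_cancel[of u], auto simp: O_diff act_O)
  qed
  \<comment> \<open>\<open>x\<close> differs from a \<open>p\<close>-th power by an element of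
    \<open>P\<close>, where \<open>onP\<close> applies. For y^p the increment is
    \<open>s y - y\<close> times a sum congruent to p y^(p-1), hence in \<open>P\<close>.\<close>
  obtain y where y: "y \<in> \<O>" "x - y ^ p \<in> P" using frobenius_surj[OF x] by blast
  have p1: "p > 1" using prime_p by (rule prime_gt_1_nat)
  have sy: "s y \<in> \<O>" using y sG by (simp add: act_O)
  have "(\<Sum>i<p. y ^ (p - Suc i) * s y ^ i) - (\<Sum>i<p. y ^ (p - Suc i) * y ^ i) \<in> P"
    unfolding sum_subtractf[symmetric] right_diff_distrib[symmetric]
    by (intro P_sum P_lmult P_cong_power) (use y sy inertiaD[OF s y(1)] in \<open>auto simp: O_power\<close>)
  moreover have "(\<Sum>i<p. y ^ (p - Suc i) * y ^ i) = of_nat p * y ^ (p - 1)"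
    by (rule sum_power_complementary)
  moreover have "of_nat p * y ^ (p - 1) \<in> P" using p_in_P y by (intro P_rmult O_power)
  ultimately have "(\<Sum>i<p. y ^ (p - Suc i) * s y ^ i) \<in> P" using P_cong_iff by metis
  moreover have "s y ^ p - y ^ p = (s y - y) * (\<Sum>i<p. y ^ (p - Suc i) * s y ^ i)"
    by (rule power_diff_sumr2)
  ultimately have 1: "s y ^ p - y ^ p \<in> F (k + 2)"
    using F_mult[of "s y - y" "Suc k" "\<Sum>i<p. y ^ (p - Suc i) * s y ^ i" 1] A[OF y(1)] by (simp add: F_1[simplified] numeral_2_eq_2)
  have "s x - x = (s (x - y ^ p) - (x - y ^ p)) + (s y ^ p - y ^ p)"
    using x y(1) sG by (simp add: act_diff act_power O_K K_power)
  thus ?thesis using F_add[OF onP[OF y(2)] 1] by (simp only:)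
qed

text \<open>Applying \<open>s\<close> to the relation between \<open>p\<close> and \<pi>^e shows
  that s \<pi>^e - \<pi>^e has order at least k + 2 + e. It factors as s \<pi> - \<pi> times a sum
  \<open>S\<close> congruent to e \<pi>^(e-1), whose order is exactly e - 1 because \<open>p\<close>
  does not divide \<open>e\<close>. Cancelling \<open>S\<close> gains one order.\<close>

lemma uniformizer_step:
  assumes s: "s \<in> inertia" and A: "\<And>x. x \<in> \<O> \<Longrightarrow> s x - x \<in> F (k + 2)"
  shows "s \<pi> - \<pi> \<in> F (k + 3)"
proof -
  have sG: "s \<in> carrier G" using s by (rule inertia_carrier)
  have spi: "s \<pi> \<in> P" "s \<pi> \<in> \<O>" using inertia_act_iff[OF s pi_O] pi_P pi_O sG by (auto simp: act_O)
  define \<delta> where "\<delta> = s \<pi> - \<pi>"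
  have \<delta>: "\<delta> \<in> F (k + 2)" using A[OF pi_O] by (simp add: \<delta>_def)
  have e0: "e > 0" using tame by (cases e) auto
  obtain t y where ty: "t \<in> \<O>" "t \<notin> P" "y \<in> \<O>" "t * of_nat p = \<pi> ^ e * y" using p_F(1) by (elim F_E)
  have yP: "y \<notin> P"
  proof
    assume "y \<in> P"
    hence "\<pi> ^ e * y \<in> F (e + 1)" using pi_F by (intro F_mult) (simp_all add: F_1[simplified] numeral_2_eq_2)
    hence "t * of_nat p \<in> F (Suc e)" using ty by simp
    hence "of_nat p \<in> F (Suc e)" using ty by - (rule F_unit_cancel[of t], auto simp: O_nat)
    with p_F show False by simp
  qed
  have "s (t * of_nat p) = s (\<pi> ^ e * y)" by (simp only: ty(4))
  hence st: "s t * of_nat p = s \<pi> ^ e * s y"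
    using ty(1,3) pi_O sG by (simp add: act_mult act_power act_nat O_K K_nat K_power)
  have "t * (s \<pi> ^ e * s y) = s t * (\<pi> ^ e * y)" using st ty(4) by (metis mult.left_commute)
  hence eq: "(t * y) * (s \<pi> ^ e - \<pi> ^ e) = (s t - t) * (y * \<pi> ^ e) - (s y - y) * (t * s \<pi> ^ e)"
    by (simp add: algebra_simps)
  have "(s t - t) * (y * \<pi> ^ e) \<in> F ((k + 2) + e)"
    by (rule F_mult[OF A[OF ty(1)] F_lmult[OF ty(3) pi_F]])
  moreover have "(s y - y) * (t * s \<pi> ^ e) \<in> F ((k + 2) + e)"
    by (rule F_mult[OF A[OF ty(3)] F_lmult[OF ty(1) F_power[OF spi(1)]]])
  ultimately have "(t * y) * (s \<pi> ^ e - \<pi> ^ e) \<in> F ((k + 2) + e)" unfolding eq by (rule F_diff)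
  hence pe: "s \<pi> ^ e - \<pi> ^ e \<in> F ((k + 2) + e)"
    using ty yP pi_O spi by - (rule F_unit_cancel[of "t * y"], auto simp: O_mult P_mult_iff O_diff O_power)
  have pw: "s \<pi> ^ i - \<pi> ^ i \<in> F (i + 1)" for i
  proof (induction i)
    case 0 thus ?case by (simp add: zero_F)
  next
    case (Suc i)
    have "s \<pi> ^ Suc i - \<pi> ^ Suc i = s \<pi> * (s \<pi> ^ i - \<pi> ^ i) + \<delta> * \<pi> ^ i"
      by (simp add: \<delta>_def algebra_simps)
    moreover have "s \<pi> * (s \<pi> ^ i - \<pi> ^ i) \<in> F (Suc i + 1)"
      using F_mult[of "s \<pi>" 1 "s \<pi> ^ i - \<pi> ^ i" "i + 1"] Suc spi by (simp add: F_1[simplified] numeral_2_eq_2)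
    moreover have "\<delta> * \<pi> ^ i \<in> F (Suc i + 1)"
      using F_mono[OF _ F_mult[OF \<delta> pi_F[of i]], of "Suc i + 1"] by simp
    ultimately show ?case by (simp add: F_add)
  qed
  define S where "S = (\<Sum>i<e. \<pi> ^ (e - Suc i) * s \<pi> ^ i)"
  have "S - (\<Sum>i<e. \<pi> ^ (e - Suc i) * \<pi> ^ i) \<in> F e"
    unfolding S_def sum_subtractf[symmetric] right_diff_distrib[symmetric]
  proof (rule F_sum)
    fix i assume "i \<in> {..<e}"
    thus "\<pi> ^ (e - Suc i) * (s \<pi> ^ i - \<pi> ^ i) \<in> F e"
      using F_mult[OF pi_F[of "e - Suc i"] pw[of i]] by simp
  qed
  moreover have "(\<Sum>i<e. \<pi> ^ (e - Suc i) * \<pi> ^ i) = \<pi> ^ (e - 1) * of_nat e"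
    using sum_power_complementary[of \<pi> e] by (simp only: mult.commute)
  ultimately have Se: "S - \<pi> ^ (e - 1) * of_nat e \<in> F e" by simp
  have "S \<notin> F (Suc (e - 1))"
  proof
    assume "S \<in> F (Suc (e - 1))"
    hence "S - (S - \<pi> ^ (e - 1) * of_nat e) \<in> F (Suc (e - 1))" using Se e0 by - (rule F_diff, auto)
    hence "\<pi> ^ (e - 1) * of_nat e \<in> F (Suc (e - 1))" by simp
    thus False using pi_power_notin[of "of_nat e" "e - 1"] tame by (simp add: O_nat P_of_nat_iff)
  qed
  moreover have "S \<in> F (e - 1)"
  proof -
    have "S - \<pi> ^ (e - 1) * of_nat e \<in> F (e - 1)" using F_mono[OF _ Se] by simp
    moreover have "\<pi> ^ (e - 1) * of_nat e \<in> F (e - 1)"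
      using F_lmult[OF O_nat pi_F, of e "e - 1"] by (simp add: mult.commute)
    ultimately show ?thesis using F_add by fastforce
  qed
  moreover have "S * \<delta> \<in> F ((e - 1) + (k + 3))"
  proof -
    have "s \<pi> ^ e - \<pi> ^ e = \<delta> * S" unfolding \<delta>_def S_def by (rule power_diff_sumr2)
    moreover have "(e - 1) + (k + 3) = (k + 2) + e" using e0 by simp
    ultimately show ?thesis using pe by (simp only: mult.commute)
  qed
  ultimately show ?thesis using F_cancel[of S "e - 1" \<delta> "k + 3"] F_O[OF \<delta>] by (simp add: \<delta>_def)
qed

text \<open>The two steps alternate, the uniformizer always being one order ahead of general
  elements. So \<open>s x - x\<close> lies in every level of the filtration and is zero.\<close>

lemma inertia_trivial:
  assumes s: "s \<in> inertia" and spi: "s \<pi> - \<pi> \<in> F 2"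
  shows "s = \<one>"
proof -
  have AB: "(\<forall>x\<in>\<O>. s x - x \<in> F (Suc k)) \<and> s \<pi> - \<pi> \<in> F (k + 2)" for k
  proof (induction k)
    case 0
    thus ?case using inertiaD[OF s] spi by (simp add: F_1[simplified] numeral_2_eq_2)
  next
    case (Suc k)
    hence A: "s x - x \<in> F (k + 2)" if "x \<in> \<O>" for x using inertia_step[OF s, of k x] that by blast
    have "k + 3 = Suc k + 2" "k + 2 = Suc (Suc k)" by simp_all
    thus ?case using A uniformizer_step[OF s A] by metis
  qed
  show ?thesis
  proof (rule act_ext_O)
    fix x assume x: "x \<in> \<O>"
    have "s x - x = 0"
    proof (rule ccontr)
      assume "s x - x \<noteq> 0"
      then obtain k where k: "s x - x \<notin> F k"
        using F_separated[of "s x - x"] x inertia_carrier[OF s] by (auto simp: O_diff act_O)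
      moreover have "s x - x \<in> F (Suc k)" using AB[of k] x by blast
      ultimately show False using F_mono[of k "Suc k"] by simp
    qed
    thus "s x = \<one> x" using x by (simp add: act_one O_K)
  qed (use inertia_carrier[OF s] in auto)
qed

text \<open>\<open>tame_char s c\<close> says that the tame character \<open>s \<mapsto> s \<pi> / \<pi>\<close> takes \<open>s\<close> to the residue class of \<open>c\<close>.\<close>

definition tame_char where "tame_char s c \<longleftrightarrow> c \<in> \<O> \<and> s \<pi> - c * \<pi> \<in> F 2"

lemma exists_leading_coeff: assumes x: "x \<in> P" shows "\<exists>c\<in>\<O>. x - c * \<pi> \<in> F 2"
proof -
  obtain z where z: "z \<in> \<O>" "u * x = \<pi> * z" using unif[OF x] by blast
  obtain v where v: "v \<in> \<O>" "u * v - 1 \<in> P" using inverse_mod[OF u_O u_P] by blast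
  have "v * (u * x) = v * (\<pi> * z)" by (simp only: z(2))
  hence "x - (v * z) * \<pi> = - ((u * v - 1) * x)" by (simp add: algebra_simps)
  moreover have "(u * v - 1) * x \<in> F 2"
    using F_mult[of "u * v - 1" 1 x 1] v x by (simp add: F_1[simplified] numeral_2_eq_2)
  ultimately have "x - (v * z) * \<pi> \<in> F 2" by (simp add: F_minus)
  thus ?thesis using v z O_mult by blast
qed

lemma pi_F_2_iff: assumes "c \<in> \<O>" shows "c * \<pi> \<in> F 2 \<longleftrightarrow> c \<in> P"
proof
  assume "c * \<pi> \<in> F 2"
  hence "\<pi> * c \<in> F (1 + 1)" by (simp add: mult.commute numeral_2_eq_2)
  hence "c \<in> F 1"
    using F_cancel[of \<pi> 1 c 1] pi_power_notin[OF O_1 P_1, of 1] assms pi_F[of 1] by simp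
  thus "c \<in> P" by (simp add: F_1[simplified] numeral_2_eq_2)
next
  assume "c \<in> P"
  thus "c * \<pi> \<in> F 2" using F_mult[of c 1 \<pi> 1] pi_P by (simp add: F_1[simplified] numeral_2_eq_2)
qed

lemma act_pi_notin_F_2: assumes "s \<in> stabilizer" shows "s \<pi> \<notin> F 2"
proof
  assume "s \<pi> \<in> F 2"
  hence "(inv s) (s \<pi>) \<in> F 2" using stabilizer_inv[OF assms] by (rule F_act[rotated])
  hence "1 * \<pi> \<in> F 2" using assms act_inv_act(1)[of s \<pi>] pi_O by (simp add: stabilizer_def O_K)
  thus False using pi_F_2_iff[OF O_1] P_1 by blast
qed

lemma tame_char_exists: assumes "s \<in> inertia" shows "\<exists>c. tame_char s c \<and> c \<notin> P"
proof -
  obtain c where c: "c \<in> \<O>" "s \<pi> - c * \<pi> \<in> F 2"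
    using exists_leading_coeff[of "s \<pi>"] inertia_act_iff[OF assms pi_O] pi_P by blast
  have "c \<notin> P"
  proof
    assume "c \<in> P"
    hence "c * \<pi> \<in> F 2" using c pi_F_2_iff by blast
    from F_add[OF c(2) this] have "s \<pi> \<in> F 2" by simp
    thus False using act_pi_notin_F_2 inertia_stabilizer assms by blast
  qed
  thus ?thesis using c by (auto simp: tame_char_def)
qed

lemma tame_char_cong:
  assumes "tame_char s c" "d \<in> \<O>" "c - d \<in> P"
  shows "tame_char s d"
proof -
  have "(c - d) * \<pi> \<in> F 2" using assms by (subst pi_F_2_iff) (auto simp: tame_char_def O_diff)
  with assms(1) have "(s \<pi> - c * \<pi>) + (c - d) * \<pi> \<in> F 2" by - (rule F_add, auto simp: tame_char_def)
  thus ?thesis using assms(2) by (simp add: tame_char_def algebra_simps)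
qed

lemma tame_char_unique: assumes "tame_char s c" "tame_char s d" shows "c - d \<in> P"
proof -
  have "(s \<pi> - d * \<pi>) - (s \<pi> - c * \<pi>) \<in> F 2" using assms by - (rule F_diff, auto simp: tame_char_def)
  hence "(c - d) * \<pi> \<in> F 2" by (simp add: algebra_simps)
  thus ?thesis using assms pi_F_2_iff by (auto simp: tame_char_def O_diff)
qed

text \<open>Inertia acts trivially on residues, which turns the cocycle s \<pi> / \<pi> into a
  homomorphism modulo \<open>P\<close>.\<close>

lemma tame_char_mult:
  assumes s: "s \<in> inertia" "tame_char s c" and t: "t \<in> inertia" "tame_char t d"
  shows "tame_char (s \<otimes> t) (c * d)"
proof -
  have G: "s \<in> carrier G" "t \<in> carrier G" using s t by (auto simp: inertia_carrier)
  have O: "c \<in> \<O>" "d \<in> \<O>" using s t by (auto simp: tame_char_def)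
  have "s (t \<pi> - d * \<pi>) \<in> F 2"
    using t s inertia_stabilizer by - (rule F_act, auto simp: tame_char_def)
  hence 1: "s (t \<pi>) - s d * s \<pi> \<in> F 2"
    using G O pi_O by (simp add: act_diff act_mult O_K act_K K_mult)
  have 2: "(s d - d) * s \<pi> \<in> F 2"
    using F_mult[of "s d - d" 1 "s \<pi>" 1] inertiaD[OF s(1) O(2)] inertia_act_iff[OF s(1) pi_O] pi_P
    by (simp add: F_1[simplified] numeral_2_eq_2)
  have 3: "d * (s \<pi> - c * \<pi>) \<in> F 2" using s O by - (rule F_lmult, auto simp: tame_char_def)
  from F_add[OF F_add[OF 1 2] 3] have "s (t \<pi>) - (c * d) * \<pi> \<in> F 2" by (simp add: algebra_simps)
  thus ?thesis using G O pi_O by (simp add: tame_char_def O_mult act_comp O_K)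
qed

lemma tame_char_one: "tame_char \<one> 1"
  using pi_O by (simp add: tame_char_def O_1 act_one O_K zero_F)

lemma tame_char_pow:
  assumes "s \<in> inertia" "tame_char s c"
  shows "s [^] (n::nat) \<in> inertia \<and> tame_char (s [^] n) (c ^ n)"
proof (induction n)
  case 0
  thus ?case using subgroup.one_closed[OF subgroup_inertia] tame_char_one by simp
next
  case (Suc n)
  thus ?case using assms tame_char_mult[of "s [^] n" "c ^ n" s c] subgroup.m_closed[OF subgroup_inertia]
    by (simp add: mult.commute)
qed

text \<open>Equal leading coefficients make \<open>inv t \<otimes> s\<close> fix the uniformizer
  modulo \<open>F 2\<close>, where \<open>inertia_trivial\<close> takes over: there is no wild
  inertia.\<close>

lemma tame_char_inj:
  assumes s: "s \<in> inertia" "tame_char s c" and t: "t \<in> inertia" "tame_char t c"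
  shows "s = t"
proof -
  have G: "s \<in> carrier G" "t \<in> carrier G" using s t by (auto simp: inertia_carrier)
  have ti: "inv t \<in> inertia" using t subgroup.m_inv_closed[OF subgroup_inertia] by blast
  have "(s \<pi> - c * \<pi>) - (t \<pi> - c * \<pi>) \<in> F 2" using s t by - (rule F_diff, auto simp: tame_char_def)
  hence "(inv t) (s \<pi> - t \<pi>) \<in> F 2" using ti inertia_stabilizer by - (rule F_act, auto)
  hence "(inv t \<otimes> s) \<pi> - \<pi> \<in> F 2"
    using G pi_O by (simp add: act_diff act_comp O_K act_K act_inv_act)
  hence "inv t \<otimes> s = \<one>"
    using ti s(1) subgroup.m_closed[OF subgroup_inertia] by (intro inertia_trivial) auto
  thus ?thesis using G by (metis inv_equality inv_inv inv_closed)
qed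

text \<open>In characteristic \<open>p\<close> the only \<open>p\<close>-th root of unity is 1, so
  the tame character is trivial on such an element.\<close>

lemma inertia_no_p_torsion:
  assumes s: "s \<in> inertia" "s [^] p = \<one>"
  shows "s = \<one>"
proof -
  obtain c where c: "tame_char s c" using tame_char_exists[OF s(1)] by blast
  have cO: "c \<in> \<O>" using c by (simp add: tame_char_def)
  have "tame_char \<one> (c ^ p)" using tame_char_pow[OF s(1) c, of p] s(2) by simp
  hence "c ^ p - 1 \<in> P" by (rule tame_char_unique[OF _ tame_char_one])
  hence "(c - 1) ^ p \<in> P" using frobenius_diff_1[OF cO, of 1] P_cong_iff by simp
  hence "c - 1 \<in> P" using cO prime_gt_0_nat[OF prime_p] by (simp add: P_power_iff O_diff O_1)
  hence "tame_char s 1" using tame_char_cong[OF c O_1] by simp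
  thus ?thesis using tame_char_inj[OF s(1) _ _ tame_char_one] subgroup.one_closed[OF subgroup_inertia] by blast
qed

lemma p_not_dvd_card_inertia: assumes M: "subgroup M G" shows "\<not> p dvd card (inertia \<inter> M)"
proof
  assume "p dvd card (inertia \<inter> M)"
  then obtain m where m: "card (inertia \<inter> M) = p ^ 1 * m" by (auto simp: dvd_def)
  define H where "H = G\<lparr>carrier := inertia \<inter> M\<rparr>"
  have sub: "subgroup (inertia \<inter> M) G" using subgroups_Inter_pair[OF subgroup_inertia M] .
  have H: "group H" unfolding H_def using subgroup.subgroup_is_group[OF sub] group_axioms by blast
  have finH: "finite (carrier H)" using finite_subset[of "inertia \<inter> M" "carrier G"] finite_G inertia_carrier
    by (auto simp: H_def)
  \<comment> \<open>Sylow's theorem with exponent 1 plays the role of Cauchy's theorem: the subgroup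
    of order \<open>p\<close> supplies an element of order \<open>p\<close>.\<close>
  obtain Q where Q: "subgroup Q H" "card Q = p"
    using sylow_thm[OF prime_p H, of 1 m] m finH by (auto simp: Coset.order_def H_def)
  have "Q \<noteq> {\<one>}" using Q(2) prime_gt_1_nat[OF prime_p] by auto
  moreover have "\<one> \<in> Q" using subgroup.one_closed[OF Q(1)] by (simp add: H_def)
  ultimately obtain s where s: "s \<in> Q" "s \<noteq> \<one>" by auto
  have QG: "subgroup Q G" using Q(1) sub unfolding H_def by (rule incl_subgroup[rotated])
  have "Q \<subseteq> inertia" using subgroup.subset[OF Q(1)] by (auto simp: H_def)
  interpret Qg: group "G\<lparr>carrier := Q\<rparr>" using subgroup.subgroup_is_group[OF QG] group_axioms by blast
  have "s [^]\<^bsub>G\<lparr>carrier := Q\<rparr>\<^esub> card Q = \<one>\<^bsub>G\<lparr>carrier := Q\<rparr>\<^esub>"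
    using Qg.pow_order_eq_1[of s] s Q(2) prime_gt_0_nat[OF prime_p] by (simp add: Coset.order_def card_ge_0_finite)
  hence "s [^] p = \<one>" using Q(2) nat_pow_consistent[of s p Q] by simp
  thus False using inertia_no_p_torsion[of s] s \<open>Q \<subseteq> inertia\<close> by auto
qed

text \<open>The tame character embeds inertia into the powers of \<open>a\<close> modulo
  \<open>P\<close>. As for subgroups of the integers, the least positive exponent \<open>d\<close>
  that occurs divides all the others, by division with remainder.\<close>

lemma inertia_cyclic: "\<exists>g\<in>inertia. inertia \<subseteq> generate G {g}"
proof -
  obtain a where a: "a \<in> \<O>" "a \<notin> P" "\<And>x. x \<in> \<O> \<Longrightarrow> x \<notin> P \<Longrightarrow> \<exists>i::nat. x - a ^ i \<in> P"
    using residue_generator by blast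
  define E where "E = {i::nat. \<exists>s\<in>inertia. tame_char s (a ^ i)}"
  have one: "\<one> \<in> inertia" using subgroup.one_closed[OF subgroup_inertia] .
  have ex: "\<exists>i\<in>E. tame_char s (a ^ i)" if s: "s \<in> inertia" for s
  proof -
    obtain c where c: "tame_char s c" "c \<notin> P" using tame_char_exists[OF s] by blast
    then obtain i :: nat where "c - a ^ i \<in> P" using a(3)[of c] by (auto simp: tame_char_def)
    hence "tame_char s (a ^ i)" using tame_char_cong[OF c(1) O_power[OF a(1)]] by blast
    thus ?thesis using s by (auto simp: E_def)
  qed
  show ?thesis
  proof (cases "\<exists>i\<in>E. i > 0")
    case False
    have "s = \<one>" if s: "s \<in> inertia" for s
    proof -
      obtain i where i: "i \<in> E" "tame_char s (a ^ i)" using ex[OF s] by blast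
      hence "i = 0" using False by auto
      thus ?thesis using i tame_char_inj[OF s _ one tame_char_one] by simp
    qed
    moreover have "\<one> \<in> generate G {\<one>}" by (rule generate.one)
    ultimately show ?thesis using one by blast
  next
    case True
    define d where "d = (LEAST i. i \<in> E \<and> i > 0)"
    have d: "d \<in> E" "d > 0" using LeastI_ex[of "\<lambda>i. i \<in> E \<and> i > 0"] True by (auto simp: d_def)
    have dmin: "i = 0" if "i \<in> E" "i < d" for i using not_less_Least[of i "\<lambda>i. i \<in> E \<and> i > 0"] that by (auto simp: d_def)
    obtain g where g: "g \<in> inertia" "tame_char g (a ^ d)" using d by (auto simp: E_def)
    have gG: "g \<in> carrier G" using g by (simp add: inertia_carrier)
    have "s \<in> generate G {g}" if s: "s \<in> inertia" for s
    proof -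
      obtain i where i: "tame_char s (a ^ i)" using ex[OF s] by blast
      define q where "q = i div d"
      define h where "h = g [^] q"
      have h: "h \<in> inertia" "tame_char h ((a ^ d) ^ q)" using tame_char_pow[OF g, of q] by (auto simp: h_def)
      define r where "r = s \<otimes> inv h"
      have r: "r \<in> inertia" unfolding r_def
        using s h subgroup.m_inv_closed[OF subgroup_inertia] subgroup.m_closed[OF subgroup_inertia] by blast
      have sr: "s = r \<otimes> h" using s h by (simp add: r_def m_assoc inertia_carrier)
      obtain c where c: "tame_char r c" using tame_char_exists[OF r] by blast
      have cO: "c \<in> \<O>" using c by (simp add: tame_char_def)
      have "c * (a ^ d) ^ q - a ^ i \<in> P"
        using tame_char_mult[OF r c h] i sr tame_char_unique by simp
      moreover have "a ^ i = a ^ (i mod d) * (a ^ d) ^ q"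
        by (simp add: q_def flip: power_mult power_add)
      ultimately have "(c - a ^ (i mod d)) * (a ^ d) ^ q \<in> P" by (simp add: left_diff_distrib)
      moreover have "(a ^ d) ^ q \<notin> P" using P_power_iff[of a "d * q"] a P_1 by (cases "d * q = 0") (auto simp flip: power_mult)
      ultimately have "c - a ^ (i mod d) \<in> P" using cO a by (simp add: P_mult_iff O_diff O_power)
      hence cr: "tame_char r (a ^ (i mod d))" using tame_char_cong[OF c O_power[OF a(1)]] by blast
      hence "i mod d \<in> E" using r by (auto simp: E_def)
      hence "i mod d = 0" using dmin d(2) by simp
      hence "tame_char r 1" using cr by simp
      hence "r = \<one>" using tame_char_inj[OF r _ one tame_char_one] by blast
      hence "s = g [^] q" using sr gG by (simp add: h_def)
      thus ?thesis using generate_pow[OF gG] by (auto intro!: exI[of _ "int q"] simp: int_pow_int)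
    qed
    thus ?thesis using g by blast
  qed
qed

text \<open>The tame relation. The image of \<open>\<pi>\<close> under \<open>f \<otimes> s\<close>
  is also that under \<open>r \<otimes> f\<close>, with \<open>r\<close> the conjugate. The first
  has leading coefficient c^p a, since \<open>f\<close> raises residues to the \<open>p\<close>-th
  power, the second a d, since \<open>r\<close> fixes residues; here \<open>a\<close> belongs to
  \<open>f\<close>, \<open>c\<close> to \<open>s\<close> and \<open>d\<close> to
  \<open>r\<close>.\<close>

lemma frobenius_conj:
  assumes f: "f \<in> carrier G" "\<And>x. x \<in> \<O> \<Longrightarrow> x ^ p - f x \<in> P" and s: "s \<in> inertia"
  shows "f \<otimes> s \<otimes> inv f = s [^] p"
proof -
  have sG: "s \<in> carrier G" using s by (rule inertia_carrier)
  define r where "r = f \<otimes> s \<otimes> inv f"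
  have rG: "r \<in> carrier G" using f sG by (simp add: r_def)
  have fst: "f \<in> stabilizer"
  proof -
    have "f x \<in> P \<longleftrightarrow> x \<in> P" if "x \<in> \<O>" for x
      using P_cong_iff[OF f(2)[OF that]] P_power_iff[OF that prime_gt_0_nat[OF prime_p]] by simp
    thus ?thesis using f by (simp add: stabilizer_def)
  qed
  have rx: "r x = f (s ((inv f) x))" if "x \<in> K" for x
    using that f sG by (simp add: r_def act_comp act_K)
  have rI: "r \<in> inertia"
  proof -
    have "r x - x \<in> P" if x: "x \<in> \<O>" for x
    proof -
      have y: "(inv f) x \<in> \<O>" using x f by (simp add: act_O)
      hence "f (s ((inv f) x) - (inv f) x) \<in> P"
        using fst inertiaD[OF s y] P_O[OF inertiaD[OF s y]] by (simp add: stabilizer_def)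
      thus ?thesis using rx[of x] x y f sG by (simp add: act_diff O_K act_K act_inv_act)
    qed
    thus ?thesis using rG by (simp add: inertia_def)
  qed
  obtain c where c: "tame_char s c" using tame_char_exists[OF s] by blast
  obtain d where d: "tame_char r d" using tame_char_exists[OF rI] by blast
  have O: "c \<in> \<O>" "d \<in> \<O>" using c d by (auto simp: tame_char_def)
  have fpi: "f \<pi> \<in> P" "f \<pi> \<in> \<O>" using fst pi_P pi_O f by (auto simp: stabilizer_def act_O)
  obtain a where a: "a \<in> \<O>" "f \<pi> - a * \<pi> \<in> F 2" using exists_leading_coeff[OF fpi(1)] by blast
  have aP: "a \<notin> P"
  proof
    assume "a \<in> P"
    hence "a * \<pi> \<in> F 2" using a pi_F_2_iff by blast
    from F_add[OF a(2) this] show False using act_pi_notin_F_2[OF fst] by simp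
  qed
  have 1: "f (s \<pi>) - f c * f \<pi> \<in> F 2"
  proof -
    have "f (s \<pi> - c * \<pi>) \<in> F 2" using c fst by - (rule F_act, auto simp: tame_char_def)
    thus ?thesis using f sG O pi_O by (simp add: act_diff act_mult O_K act_K K_mult)
  qed
  have 2: "(c ^ p - f c) * f \<pi> \<in> F 2"
    using F_mult[of "c ^ p - f c" 1 "f \<pi>" 1] f(2)[OF O(1)] fpi by (simp add: F_1[simplified] numeral_2_eq_2)
  have 3: "c ^ p * (f \<pi> - a * \<pi>) \<in> F 2" using a O by - (rule F_lmult, rule O_power)
  have rf: "r (f \<pi>) = f (s \<pi>)" using rx[of "f \<pi>"] f pi_O by (simp add: act_K O_K act_inv_act)
  have 4: "r (f \<pi>) - r a * r \<pi> \<in> F 2"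
  proof -
    have "r (f \<pi> - a * \<pi>) \<in> F 2" using a rI inertia_stabilizer by - (rule F_act, auto)
    thus ?thesis using f rG a pi_O by (simp add: act_diff act_mult O_K act_K K_mult)
  qed
  have 5: "(r a - a) * r \<pi> \<in> F 2"
    using F_mult[of "r a - a" 1 "r \<pi>" 1] inertiaD[OF rI a(1)] inertia_act_iff[OF rI pi_O] pi_P
    by (simp add: F_1[simplified] numeral_2_eq_2)
  have 6: "a * (r \<pi> - d * \<pi>) \<in> F 2" using a d by - (rule F_lmult, auto simp: tame_char_def)
  \<comment> \<open>The two expansions are subtracted; all intermediate terms telescope and a (c^p -
    d) \<pi> remains.\<close>
  have "(r (f \<pi>) - r a * r \<pi>) + (r a - a) * r \<pi> + a * (r \<pi> - d * \<pi>)
    - ((f (s \<pi>) - f c * f \<pi>) - (c ^ p - f c) * f \<pi> + c ^ p * (f \<pi> - a * \<pi>)) \<in> F 2"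
    by (intro F_add F_diff 1 2 3 4 5 6)
  hence "(a * (c ^ p - d)) * \<pi> \<in> F 2" unfolding rf by (simp add: algebra_simps)
  hence "c ^ p - d \<in> P" using aP a O by (simp add: pi_F_2_iff O_mult O_diff O_power P_mult_iff)
  hence "tame_char r (c ^ p)" using tame_char_cong[OF d] O P_cong_sym by (simp add: O_power)
  thus ?thesis using tame_char_inj[OF rI] tame_char_pow[OF s c, of p] by (simp add: r_def)
qed

end


section \<open>Ramification indices\<close>

context galois_uniformizer
begin

abbreviation P_pow where "P_pow k \<equiv> P [^]\<^bsub>ideals_set R\<^esub> (k::nat)"

lemma P_pow_0: "P_pow 0 = \<O>"
  and P_pow_Suc: "P_pow (Suc k) = ideal_prod R (P_pow k) P"
  by (simp_all add: ideals_set_def)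

lemma ideal_P_pow: "ideal (P_pow k) R"
proof -
  interpret I: comm_monoid "ideals_set R" by (rule cring.ideals_set_is_comm_monoid[OF cring_R])
  have "P_pow k \<in> carrier (ideals_set R)" by (rule I.nat_pow_closed) (simp add: ideals_set_def ideal_P)
  thus ?thesis by (simp add: ideals_set_def)
qed

text \<open>Symbolic and ordinary powers agree because \<open>P\<close> is maximal: a denominator
  \<open>t\<close> outside \<open>P\<close> has an inverse modulo \<open>P\<close>.\<close>

lemma P_pow_eq_F: "P_pow k = F k"
proof (induction k)
  case 0
  show ?case by (simp only: P_pow_0 F_0)
next
  case (Suc k)
  have id: "x + y \<in> P_pow (Suc k)" "z \<in> \<O> \<Longrightarrow> z * x \<in> P_pow (Suc k)"
    if "x \<in> P_pow (Suc k)" "y \<in> P_pow (Suc k)" for x y z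
    using that ideal_P_pow[of "Suc k"] unfolding ideal_R_iff by blast+
  have prodI: "x * y \<in> P_pow (Suc k)" if "x \<in> F k" "y \<in> P" for x y
    unfolding P_pow_Suc using ideal_prod.prod[of x "P_pow k" y P R] that by (simp only: Suc R_simps)
  show ?case
  proof (intro equalityI subsetI)
    fix x assume "x \<in> P_pow (Suc k)"
    hence "x \<in> ideal_prod R (P_pow k) P" by (simp only: P_pow_Suc)
    thus "x \<in> F (Suc k)"
    proof (induction rule: ideal_prod.induct)
      case (prod i j)
      thus ?case using F_mult[of i k j 1] Suc by (simp add: F_1[simplified])
    next
      case (sum x y)
      thus ?case by (simp add: F_add)
    qed
  next
    fix x assume x: "x \<in> F (Suc k)"
    then obtain t z where t: "x \<in> \<O>" "t \<in> \<O>" "t \<notin> P" "z \<in> \<O>" "t * x = \<pi> ^ Suc k * z" by (elim F_E)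
    \<comment> \<open>x = v (t x) - x (t v - 1). The first summand is a multiple of \<pi>^(k+1), the
      second lies in the product of the \<open>k\<close>-th power and \<open>P\<close>.\<close>
    obtain v where v: "v \<in> \<O>" "t * v - 1 \<in> P" using inverse_mod[OF t(2,3)] by blast
    have 1: "\<pi> ^ Suc k \<in> P_pow (Suc k)" using prodI[OF pi_F pi_P] by (simp add: mult.commute)
    have "(v * z) * \<pi> ^ Suc k \<in> P_pow (Suc k)" using id(2)[OF 1 1] v t by (simp add: O_mult)
    moreover have "x * (- (t * v - 1)) \<in> P_pow (Suc k)"
      using F_mono[OF _ x, of k] v by (intro prodI P_minus) auto
    ultimately have "(v * z) * \<pi> ^ Suc k + x * (- (t * v - 1)) \<in> P_pow (Suc k)" by (rule id(1))
    moreover have "(v * z) * \<pi> ^ Suc k + x * (- (t * v - 1)) = v * (\<pi> ^ Suc k * z - t * x) + x"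
      by (simp add: algebra_simps)
    ultimately show "x \<in> P_pow (Suc k)" using t(5) by simp
  qed
qed

text \<open>\<open>F_separated\<close> bounds the exponents, so the greatest one in the definition
  is attained and equals the order of \<open>p\<close>.\<close>

lemma ramification_index_F:
  "of_nat p \<in> F (ramification_index K p P)" "of_nat p \<notin> F (Suc (ramification_index K p P))"
proof -
  have eq: "Idl\<^bsub>R\<^esub> {of_nat p} \<subseteq> P_pow k \<longleftrightarrow> of_nat p \<in> F k" for k
  proof -
    interpret R: cring R by (rule cring_R)
    have sub: "{of_nat p} \<subseteq> carrier R" by (simp add: O_nat)
    show ?thesis unfolding P_pow_eq_F[symmetric]
      using R.genideal_minimal[OF ideal_P_pow, of "{of_nat p}" k] R.genideal_self[OF sub] by blast
  qed
  have r: "ramification_index K p P = (GREATEST k. of_nat p \<in> F k)"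
    unfolding ramification_index_def eq ..
  obtain b where b: "of_nat p \<notin> F b" using F_separated[of "of_nat p"] prime_p by (auto simp: O_nat)
  have bd: "k \<le> b" if "of_nat p \<in> F k" for k using F_mono[of b k] that b by (meson nat_le_linear)
  show "of_nat p \<in> F (ramification_index K p P)"
    unfolding r by (rule GreatestI_nat[of _ 0 b]) (auto simp: F_0 O_nat bd)
  show "of_nat p \<notin> F (Suc (ramification_index K p P))"
    using Greatest_le_nat[of "\<lambda>k. of_nat p \<in> F k" "Suc (ramification_index K p P)" b] bd by (auto simp: r)
qed

end

section \<open>Tame and trivial inertia groups, conjugacy of primes\<close>

context galois_prime_over
begin

lemma tame_inertia:
  assumes "coprime (ramification_index K p P) p"
  shows "\<And>M. subgroup M G \<Longrightarrow> \<not> p dvd card (inertia \<inter> M)"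
    and "\<exists>g\<in>inertia. inertia \<subseteq> generate G {g}"
    and "\<exists>f\<in>carrier G. \<forall>s\<in>inertia. f \<otimes> s \<otimes> inv f = s [^] p"
proof -
  obtain c u where cu: "c \<in> P" "u \<in> \<O>" "u \<notin> P" "\<And>x. x \<in> P \<Longrightarrow> \<exists>z\<in>\<O>. u * x = c * z"
    using exists_uniformizer by blast
  interpret U: galois_uniformizer G K P p c u by unfold_locales (use cu in auto)
  have "\<not> p dvd ramification_index K p P"
    using assms prime_p by (metis coprime_common_divisor dvd_refl not_prime_unit)
  then interpret T: galois_tame G K P p c u "ramification_index K p P"
    by unfold_locales (use U.ramification_index_F in auto)
  show 1: "\<not> p dvd card (inertia \<inter> M)" if "subgroup M G" for M
    using that by (rule T.p_not_dvd_card_inertia)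
  show "\<exists>g\<in>inertia. inertia \<subseteq> generate G {g}" by (rule T.inertia_cyclic)
  have "inertia \<inter> carrier G = inertia" by (auto simp: inertia_def)
  with 1[OF subgroup_self] have "\<not> p dvd card inertia" by simp
  from exists_frobenius[OF this] show "\<exists>f\<in>carrier G. \<forall>s\<in>inertia. f \<otimes> s \<otimes> inv f = s [^] p"
    using T.frobenius_conj by blast
qed

text \<open>If \<open>P\<close> is unramified over \<open>p\<close>, then \<open>p\<close> itself is a uniformizer, and it is fixed by the inertia group.\<close>

lemma unramified_inertia:
  assumes "ramification_index K p P = 1"
  shows "inertia = {\<one>}"
proof -
  obtain c u where cu: "c \<in> P" "u \<in> \<O>" "u \<notin> P" "\<And>x. x \<in> P \<Longrightarrow> \<exists>z\<in>\<O>. u * x = c * z"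
    using exists_uniformizer by blast
  interpret U: galois_uniformizer G K P p c u by unfold_locales (use cu in auto)
  have pF: "of_nat p \<in> U.F 1" "of_nat p \<notin> U.F 2"
    using U.ramification_index_F assms by (simp_all add: numeral_2_eq_2)
  then obtain t y where t: "t \<in> \<O>" "t \<notin> P" "y \<in> \<O>" "t * of_nat p = c ^ 1 * y" by (elim U.F_E)
  have y: "y \<notin> P"
  proof
    assume "y \<in> P"
    hence "c * y \<in> U.F (1 + 1)" using cu(1) by (intro U.F_mult) (simp_all only: U.F_1)
    hence "t * of_nat p \<in> U.F 2" using t by (simp add: numeral_2_eq_2)
    hence "of_nat p \<in> U.F 2" using U.F_unit_cancel[OF t(1,2) O_nat] by blast
    with pF show False by simp
  qed
  have "\<exists>z\<in>\<O>. (y * u) * x = of_nat p * z" if x: "x \<in> P" for x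
  proof -
    obtain z where z: "z \<in> \<O>" "u * x = c * z" using cu(4)[OF x] by blast
    have "(y * u) * x = y * (u * x)" by (simp only: mult.assoc)
    also have "\<dots> = (c ^ 1 * y) * z" by (simp add: z(2) mult_ac)
    also have "\<dots> = of_nat p * (t * z)" unfolding t(4)[symmetric] by (simp add: mult_ac)
    finally show ?thesis using t z by (auto simp: O_mult)
  qed
  then interpret V: galois_uniformizer G K P p "of_nat p" "y * u"
    by unfold_locales (use p_in_P t cu y in \<open>auto simp: O_mult P_mult_iff\<close>)
  have "of_nat p \<in> V.F 1" "of_nat p \<notin> V.F (Suc 1)"
    using V.pi_F[of 1] V.pi_power_notin[OF O_1 P_1, of 1] by simp_all
  moreover have "\<not> p dvd 1" using prime_p by auto
  ultimately interpret T: galois_tame G K P p "of_nat p" "y * u" 1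
    by unfold_locales
  have "s = \<one>" if "s \<in> inertia" for s
    using that by (rule T.inertia_trivial) (simp add: act_nat inertia_carrier that V.zero_F)
  thus ?thesis using subgroup.one_closed[OF subgroup_inertia] by blast
qed

text \<open>
  Prime avoidance: an element of \<open>P'\<close> with no conjugate in \<open>P\<close> would have norm outside \<open>P\<close>.
\<close>

lemma conjugate_prime:
  assumes P': "P' \<subseteq> \<O>" "0 \<in> P'" "\<And>x y. x \<in> P' \<Longrightarrow> y \<in> P' \<Longrightarrow> x + y \<in> P'" "\<And>x y. x \<in> \<O> \<Longrightarrow> y \<in> P' \<Longrightarrow> x * y \<in> P'"
    and Z: "\<And>n. of_int n \<in> P' \<Longrightarrow> int p dvd n"
  shows "\<exists>s\<in>carrier G. \<forall>x\<in>P'. s x \<in> P"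
proof (rule ccontr)
  assume "\<not> ?thesis"
  hence "\<forall>s\<in>carrier G. \<exists>x\<in>P'. s x \<notin> P" by blast
  then obtain a where a: "\<And>s. s \<in> carrier G \<Longrightarrow> a s \<in> P'" "\<And>s. s \<in> carrier G \<Longrightarrow> s (a s) \<notin> P" by metis
  have "\<exists>x\<in>P'. \<forall>s\<in>S. s x \<notin> P" if "S \<subseteq> carrier G" for S
    using finite_subset[OF that finite_G] that
  proof (induction S rule: finite_induct)
    case empty
    thus ?case using P'(2) by blast
  next
    case (insert t S)
    then obtain x where x: "x \<in> P'" "\<And>s. s \<in> S \<Longrightarrow> s x \<notin> P" by auto
    have tG: "t \<in> carrier G" and SG: "\<And>s. s \<in> S \<Longrightarrow> s \<in> carrier G" using insert.prems by auto
    have xO: "x \<in> \<O>" using x P' by blast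
    show ?case
    proof (cases "t x \<in> P")
      case False
      thus ?thesis using x by auto
    next
      case True
      \<comment> \<open>With \<open>v\<close> chosen such that \<open>s\<close> sends
        \<open>x * v\<close> to 1 modulo \<open>P\<close>, the element \<open>x * v - 1\<close> goes
        into \<open>P\<close> under \<open>s\<close> and to -1 modulo \<open>P\<close> under
        \<open>t\<close>.\<close>
      have "\<exists>y\<in>\<O>. s y \<in> P \<and> t y \<notin> P" if s: "s \<in> S" for s
      proof -
        obtain w where w: "w \<in> \<O>" "s x * w - 1 \<in> P" using inverse_mod[of "s x"] x(2)[OF s] xO SG[OF s] by (auto simp: act_O)
        define v where "v = (inv s) w"
        have v: "v \<in> \<O>" "s v = w" using w SG[OF s] by (auto simp: v_def act_O act_inv_act O_K)
        have "s (x * v - 1) = s x * w - 1" using v SG[OF s] xO by (simp add: act_diff act_mult act_1 O_K K_mult K_1)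
        moreover have "t (x * v - 1) = t x * t v - 1" using v tG xO by (simp add: act_diff act_mult act_1 O_K K_mult K_1)
        moreover have "t x * t v - 1 \<notin> P"
          using P_rmult[OF True act_O[OF tG v(1)]] P_diff[of "t x * t v" "t x * t v - 1"] P_1 by auto
        ultimately show ?thesis using w v xO by (intro bexI[of _ "x * v - 1"]) (auto simp: O_diff O_mult O_1)
      qed
      then obtain y where y: "\<And>s. s \<in> S \<Longrightarrow> y s \<in> \<O>" "\<And>s. s \<in> S \<Longrightarrow> s (y s) \<in> P" "\<And>s. s \<in> S \<Longrightarrow> t (y s) \<notin> P" by metis
      define z where "z = (\<Prod>s\<in>S. y s)"
      have zO: "z \<in> \<O>" using y(1) unfolding z_def by (rule O_prod)
      have tz: "t z \<notin> P"
      proof -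
        have "t z = (\<Prod>s\<in>S. t (y s))" unfolding z_def using y(1) by (intro act_prod[OF tG] O_K)
        moreover have "(\<Prod>s\<in>S. t (y s)) \<notin> P"
          using P_prod_notin[OF insert.hyps(1), of "\<lambda>s. t (y s)"] y tG by (simp add: act_O)
        ultimately show ?thesis by simp
      qed
      have sz: "s z \<in> P" if s: "s \<in> S" for s
      proof -
        have "z = y s * (\<Prod>s\<in>S - {s}. y s)" unfolding z_def using s insert.hyps(1) by (intro prod.remove)
        moreover have "(\<Prod>s\<in>S - {s}. y s) \<in> \<O>" using y(1) by (intro O_prod) auto
        ultimately show ?thesis using y(1,2)[OF s] SG[OF s] P_rmult by (simp add: act_mult O_K act_O)
      qed
      have aO: "a t \<in> \<O>" using a(1)[OF tG] P' by blast
      \<comment> \<open>The correction repairs \<open>x\<close> at \<open>t\<close> without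
        disturbing \<open>S\<close>: every member of \<open>S\<close> sends \<open>z\<close> into
        \<open>P\<close>, while \<open>t\<close> sends neither \<open>z\<close> nor
        \<open>a t\<close> there.\<close>
      define x' where "x' = x + z * a t"
      have split: "s x' = s x + s z * s (a t)" if "s \<in> carrier G" for s
        using that xO zO aO by (simp add: x'_def act_add act_mult O_K K_mult)
      have "t x' \<notin> P"
      proof
        assume "t x' \<in> P"
        hence "t z * t (a t) \<in> P" using P_diff[OF _ True, of "t x'"] split[OF tG] by simp
        thus False using tz a(2)[OF tG] tG zO aO by (simp add: P_mult_iff act_O)
      qed
      moreover have "s x' \<notin> P" if s: "s \<in> S" for s
      proof
        assume "s x' \<in> P"
        moreover have "s z * s (a t) \<in> P" using P_rmult[OF sz[OF s]] act_O[OF SG[OF s] aO] by blast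
        ultimately show False using P_diff[of "s x'" "s z * s (a t)"] split[OF SG[OF s]] x(2)[OF s] by simp
      qed
      moreover have "x' \<in> P'" unfolding x'_def using x(1) P'(4)[OF zO a(1)[OF tG]] by (rule P'(3))
      ultimately show ?thesis by blast
    qed
  qed
  then obtain x where x: "x \<in> P'" "\<And>s. s \<in> carrier G \<Longrightarrow> s x \<notin> P" by blast
  have xO: "x \<in> \<O>" using x P' by blast
  obtain n where n: "Nm x = of_int n" using Nm_Ints[OF xO] by (auto elim: Ints_cases)
  obtain y where y: "y \<in> \<O>" "Nm x = x * y" using Nm_dvd[OF xO] by blast
  have "Nm x \<in> P'" using P'(4)[OF y(1) x(1)] y(2) by (simp add: mult.commute)
  hence "Nm x \<in> P" using Z[of n] P_of_int_iff n by simp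
  moreover have "Nm x \<notin> P" unfolding Nm_def
    using x(2) xO finite_G by (intro P_prod_notin) (auto simp: act_O)
  ultimately show False by blast
qed

end

section \<open>Inertia groups of varying primes, prime ideals of the ring of integers\<close>

context galois_field
begin

text \<open>Same set as \<open>inertia\<close>, with \<open>P\<close> as an argument instead of a
  locale parameter, so that one can quantify over all primes.\<close>

definition inertia_at where "inertia_at P = {s\<in>carrier G. \<forall>x\<in>\<O>. s x - x \<in> P}"

lemma primes_above_imp_over:
  assumes "P \<in> primes_above K p" "prime p"
  shows "galois_prime_over G K P p"
proof -
  have pi: "primeideal P R" and Z: "P \<inter> \<int> = of_int ` {k. int p dvd k}" using assms by (auto simp: primes_above_def)
  have id: "ideal P R" using pi by (rule primeideal.axioms)
  have P: "P \<subseteq> \<O>" "0 \<in> P" "\<forall>x\<in>P. \<forall>y\<in>P. x + y \<in> P" "\<forall>x\<in>\<O>. \<forall>y\<in>P. x * y \<in> P"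
    using id by (simp_all add: ideal_R_iff)
  have "1 \<notin> P"
  proof
    assume "1 \<in> P"
    hence "(1::complex) \<in> of_int ` {k. int p dvd k}" using Z by auto
    then obtain k :: int where "of_int k = (1::complex)" "int p dvd k" by (metis (mono_tags) imageE mem_Collect_eq)
    hence "int p dvd 1" by (metis of_int_eq_1_iff)
    thus False using assms(2) by auto
  qed
  moreover have "of_nat p \<in> P"
  proof -
    have "(of_int (int p) :: complex) \<in> of_int ` {k. int p dvd k}" by (rule imageI) simp
    hence "of_nat p \<in> P \<inter> \<int>" unfolding Z by simp
    thus ?thesis by blast
  qed
  moreover have "x \<in> P \<or> y \<in> P" if "x \<in> \<O>" "y \<in> \<O>" "x * y \<in> P" for x y
    using primeideal.I_prime[OF pi, of x y] that by simp
  ultimately show ?thesis using P assms(2) by unfold_locales auto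
qed

text \<open>An automorphism that moves \<open>P'\<close> into \<open>P\<close> conjugates the
  inertia group of \<open>P'\<close> into that of \<open>P\<close>.\<close>

lemma inertia_at_conj:
  assumes P: "P \<in> primes_above K p" and P': "P' \<in> primes_above K p" and p: "prime p"
    and M: "inertia_at P \<subseteq> M" "\<And>s m. s \<in> carrier G \<Longrightarrow> m \<in> M \<Longrightarrow> s \<otimes> m \<otimes> inv s \<in> M"
  shows "inertia_at P' \<subseteq> M"
proof
  interpret P: galois_prime_over G K P p by (rule primes_above_imp_over[OF P p])
  interpret P': galois_prime_over G K P' p by (rule primes_above_imp_over[OF P' p])
  have "\<exists>s\<in>carrier G. \<forall>x\<in>P'. s x \<in> P"
    by (rule P.conjugate_prime) (use P'.P_O P'.P_0 P'.P_add P'.P_lmult P'.P_of_int_iff in auto)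
  then obtain s where s: "s \<in> carrier G" "\<And>x. x \<in> P' \<Longrightarrow> s x \<in> P" by blast
  fix t assume t: "t \<in> inertia_at P'"
  hence tG: "t \<in> carrier G" by (simp add: inertia_at_def)
  have "s \<otimes> t \<otimes> inv s \<in> inertia_at P"
  proof -
    have "(s \<otimes> t \<otimes> inv s) x - x \<in> P" if x: "x \<in> \<O>" for x
    proof -
      define y where "y = (inv s) x"
      have y: "y \<in> \<O>" "s y = x" using x s by (auto simp: y_def act_O act_inv_act O_K)
      have "s (t y - y) \<in> P" using t y by (intro s) (auto simp: inertia_at_def)
      thus ?thesis using s tG x y by (simp add: act_comp act_K O_K act_diff y_def[symmetric])
    qed
    thus ?thesis using s tG by (simp add: inertia_at_def)
  qed
  hence "s \<otimes> t \<otimes> inv s \<in> M" using M by blast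
  from M(2)[OF inv_closed[OF s(1)] this] show "t \<in> M"
    using s(1) tG m_assoc[of "inv s" s t] by (simp add: m_assoc[of "inv s"] m_assoc[of _ "inv s" s])
qed

lemma exists_prime_ideal:
  assumes J: "ideal J R" "1 \<notin> J"
  shows "\<exists>P. J \<subseteq> P \<and> galois_prime G K P"
proof -
  define \<I> where "\<I> = {I. ideal I R \<and> J \<subseteq> I \<and> 1 \<notin> I}"
  have "\<exists>P\<in>\<I>. \<forall>Q\<in>\<I>. P \<subseteq> Q \<longrightarrow> Q = P"
  proof (rule subset_Zorn_nonempty)
    show "\<I> \<noteq> {}" using J by (auto simp: \<I>_def)
    fix \<C> assume \<C>: "\<C> \<noteq> {}" "subset.chain \<I> \<C>"
    have "ideal (\<Union>\<C>) R"
      unfolding ideal_R_iff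
    proof (intro conjI ballI)
      fix x y assume "x \<in> \<Union>\<C>" "y \<in> \<Union>\<C>"
      then obtain I I' where I: "I \<in> \<C>" "x \<in> I" "I' \<in> \<C>" "y \<in> I'" by blast
      hence "I \<subseteq> I' \<or> I' \<subseteq> I" using \<C>(2) by (auto simp: subset_chain_def)
      moreover have "ideal I R" "ideal I' R" using I \<C>(2) by (auto simp: \<I>_def subset_chain_def)
      ultimately have "x + y \<in> I \<or> x + y \<in> I'" using I unfolding ideal_R_iff by blast
      thus "x + y \<in> \<Union>\<C>" using I by blast
    next
      show "\<Union>\<C> \<subseteq> \<O>" using \<C> by (auto simp: \<I>_def subset_chain_def ideal_R_iff)
      show "0 \<in> \<Union>\<C>" using \<C> by (force simp: \<I>_def subset_chain_def ideal_R_iff)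
      fix x y assume x: "x \<in> \<O>" and "y \<in> \<Union>\<C>"
      then obtain I where I: "I \<in> \<C>" "y \<in> I" by blast
      hence "ideal I R" using \<C>(2) by (auto simp: \<I>_def subset_chain_def)
      hence "x * y \<in> I" using x I unfolding ideal_R_iff by blast
      thus "x * y \<in> \<Union>\<C>" using I by blast
    qed
    thus "\<Union>\<C> \<in> \<I>" using \<C> by (auto simp: \<I>_def subset_chain_def)
  qed
  then obtain P where P: "P \<in> \<I>" "\<And>Q. Q \<in> \<I> \<Longrightarrow> P \<subseteq> Q \<Longrightarrow> Q = P" by blast
  have id: "P \<subseteq> \<O>" "0 \<in> P" "\<And>x y. x \<in> P \<Longrightarrow> y \<in> P \<Longrightarrow> x + y \<in> P" "\<And>x y. x \<in> \<O> \<Longrightarrow> y \<in> P \<Longrightarrow> x * y \<in> P" "1 \<notin> P" "J \<subseteq> P"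
    using P(1) by (auto simp: \<I>_def ideal_R_iff)
  have key: "\<exists>q\<in>P. \<exists>z\<in>\<O>. 1 = q + x * z" if x: "x \<in> \<O>" "x \<notin> P" for x
  proof (rule ccontr)
    assume neg: "\<not> ?thesis"
    define Q where "Q = {q + x * z | q z. q \<in> P \<and> z \<in> \<O>}"
    have "ideal Q R"
      unfolding ideal_R_iff
    proof (intro conjI ballI)
      show "Q \<subseteq> \<O>" using id x by (auto simp: Q_def intro!: O_add O_mult)
      show "0 \<in> Q" using id(2) O_0 by (force simp: Q_def)
      fix a b assume "a \<in> Q" "b \<in> Q"
      then obtain q z q' z' where *: "a = q + x * z" "b = q' + x * z'" "q \<in> P" "z \<in> \<O>" "q' \<in> P" "z' \<in> \<O>"
        by (auto simp: Q_def)
      have "a + b = (q + q') + x * (z + z')" by (simp add: * algebra_simps)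
      thus "a + b \<in> Q" using * id(3) O_add unfolding Q_def by blast
    next
      fix a b assume a: "a \<in> \<O>" and "b \<in> Q"
      then obtain q z where *: "b = q + x * z" "q \<in> P" "z \<in> \<O>" by (auto simp: Q_def)
      have "a * b = a * q + x * (a * z)" by (simp add: * algebra_simps)
      thus "a * b \<in> Q" using * a id(4) O_mult unfolding Q_def by blast
    qed
    moreover have "P \<subseteq> Q" using O_0 by (force simp: Q_def)
    moreover have "1 \<notin> Q" using neg by (auto simp: Q_def)
    ultimately have "Q = P" using id(6) by (intro P(2)) (auto simp: \<I>_def)
    moreover have "x \<in> Q" using id(2) O_1 by (force simp: Q_def)
    ultimately show False using x by simp
  qed
  have "galois_prime G K P"
  proof unfold_locales
    fix x y assume xy: "x \<in> \<O>" "y \<in> \<O>" "x * y \<in> P"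
    show "x \<in> P \<or> y \<in> P"
    proof (rule ccontr)
      assume n: "\<not> (x \<in> P \<or> y \<in> P)"
      then obtain q z where q: "q \<in> P" "z \<in> \<O>" "1 = q + x * z" using key[OF xy(1)] by blast
      have "y = y * (q + x * z)" using q by simp
      also have "\<dots> = y * q + z * (x * y)" by (simp add: algebra_simps)
      also have "\<dots> \<in> P" by (rule id(3)[OF id(4)[OF xy(2) q(1)] id(4)[OF q(2) xy(3)]])
      finally show False using n by blast
    qed
  qed (use id in auto)
  thus ?thesis using id(6) by blast
qed

text \<open>A nonzero prime ideal contains the nonzero norm of each of its nonzero elements, hence a
  prime factor of that integer.\<close>

lemma prime_ideal_cases:
  assumes "galois_prime G K P"
  shows "P = {0} \<or> (\<exists>p. prime p \<and> P \<in> primes_above K p)"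
proof -
  interpret P: galois_prime G K P by fact
  show ?thesis
  proof (cases "P = {0}")
    case False
    then obtain x where x: "x \<in> P" "x \<noteq> 0" using P.P_0 by auto
    have xO: "x \<in> \<O>" using x P.P_O by blast
    obtain n where n: "Nm x = of_int n" using Nm_Ints[OF xO] by (auto elim: Ints_cases)
    obtain y where y: "y \<in> \<O>" "Nm x = x * y" using Nm_dvd[OF xO] by blast
    have "Nm x \<in> P" using P.P_rmult[OF x(1) y(1)] y(2) by simp
    moreover have "n \<noteq> 0" using n Nm_eq_0_iff[of x] x xO by (auto simp: O_K)
    ultimately have nP: "of_nat (nat \<bar>n\<bar>) \<in> P" "nat \<bar>n\<bar> > 0"
      using n P.P_minus[of "of_int n"] by (auto simp: abs_if)
    have "\<exists>p. prime p \<and> of_nat p \<in> P" using nP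
    proof (induction "nat \<bar>n\<bar>" arbitrary: n rule: less_induct)
      case less
      define m where "m = nat \<bar>n\<bar>"
      have m: "of_nat m \<in> P" "m > 0" using less.prems by (auto simp: m_def)
      have "m \<noteq> 1" using m P.P_1 by auto
      then obtain q where q: "prime q" "q dvd m" using prime_factor_nat by blast
      then obtain k where k: "m = q * k" by (auto simp: dvd_def)
      have "of_nat q * of_nat k \<in> P" using m k by simp
      hence "of_nat q \<in> P \<or> of_nat k \<in> P" by (intro P.P_prime O_nat)
      thus ?case
      proof
        assume "of_nat k \<in> P"
        moreover have "k > 0" "k < m" using k m prime_gt_1_nat[OF q(1)] by auto
        ultimately show ?thesis using less.hyps[of "int k"] by (simp add: m_def)
      qed (use q in blast)
    qed
    then obtain p where p: "prime p" "of_nat p \<in> P" by blast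
    interpret P: galois_prime_over G K P p by unfold_locales (use p in auto)
    have "P \<inter> \<int> = of_int ` {k. int p dvd k}" using P.P_of_int_iff by (auto simp: Ints_def)
    moreover have "primeideal P R"
      by (rule cring.maximalideal_prime[OF cring_R P.maximalideal_P])
    ultimately show ?thesis using p by (auto simp: primes_above_def)
  qed auto
qed

end


section \<open>Complex conjugation\<close>

context galois_field
begin

lemma galois_prime_zero: "galois_prime G K {0}"
  by unfold_locales (auto simp: O_0)

lemma inertia_at_zero: "inertia_at {0} = {\<one>}"
  using act_ext_O[of _ \<one>] by (auto simp: inertia_at_def act_one O_K)

text \<open>
  The polynomial \<open>\<Prod>(X - s x)\<close> takes rational values at all integers, hence it agrees with its complex conjugate.
\<close>

lemma cnj_eq_conjugate: assumes x: "x \<in> \<O>" shows "\<exists>s\<in>carrier G. cnj x = s x"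
proof -
  define f where "f = (\<Prod>s\<in>carrier G. [:- s x, 1:])"
  have f: "poly f z = (\<Prod>s\<in>carrier G. z - s x)" for z by (simp add: f_def poly_prod)
  define g where "g = map_poly cnj f"
  have g: "poly g (cnj z) = cnj (poly f z)" for z
    by (simp add: g_def poly_altdef coeff_map_poly degree_map_poly)
  have "poly f (of_int k) = poly g (of_int k)" for k :: int
  proof -
    have "poly f (of_int k) = Nm (of_int k - x)"
      unfolding f Nm_def using x by (intro prod.cong) (auto simp: act_diff act_int O_K K_int)
    hence "poly f (of_int k) \<in> \<int>" using x by (simp add: Nm_Ints O_diff O_int)
    then obtain l where "poly f (of_int k) = of_int l" by (auto elim: Ints_cases)
    thus ?thesis using g[of "of_int k"] by simp
  qed
  hence "range of_int \<subseteq> {z. poly (f - g) z = 0}" by auto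
  moreover have "infinite (range (of_int :: int \<Rightarrow> complex))"
    by (simp add: finite_image_iff inj_def infinite_UNIV_int)
  ultimately have "infinite {z. poly (f - g) z = 0}" using finite_subset by blast
  hence "f - g = 0" using poly_roots_finite by blast
  hence "poly f (cnj x) = cnj (poly f x)" using g[of x] by simp
  moreover have "poly f x = 0"
    unfolding f using finite_G one_closed x by (auto simp: act_one O_K intro!: prod_zero bexI[of _ \<one>])
  ultimately have "poly f (cnj x) = 0" by (simp only: complex_cnj_zero)
  hence "(\<Prod>s\<in>carrier G. cnj x - s x) = 0" by (simp only: f)
  thus ?thesis using finite_G by auto
qed

text \<open>At \<open>P = {0}\<close> inertia is trivial, and traces, being integers, are invariant
  under conjugation; so \<open>hom_mod_prime_eq_act\<close> finds an element of \<open>G\<close>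
  that agrees with conjugation. The previous lemma enters through the stability of
  \<open>\<O>\<close>.\<close>

lemma exists_complex_conjugation: "\<exists>c\<in>carrier G. \<forall>x\<in>\<O>. cnj x = c x"
proof -
  interpret Z: galois_prime G K "{0}" by (rule galois_prime_zero)
  have O: "cnj x \<in> \<O>" if "x \<in> \<O>" for x using cnj_eq_conjugate[OF that] that by (auto simp: act_O)
  have "\<exists>c\<in>carrier G. \<forall>x\<in>\<O>. cnj x - c x \<in> {0}"
  proof (rule Z.hom_mod_prime_eq_act)
    show "subgroup (carrier G) G" by (rule subgroup_self)
    show "cnj x \<in> \<O>" if "x \<in> \<O>" for x using that by (rule O)
    show "cnj (x * y) - cnj x * cnj y \<in> {0}" for x y by simp
    have "Z.inertia = {\<one>}" using inertia_at_zero by (simp add: Z.inertia_def inertia_at_def)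
    thus "of_nat (card (Z.inertia \<inter> carrier G)) \<notin> {0::complex}" by simp
    fix x assume x: "x \<in> \<O>"
    obtain k where "Tr x = of_int k" using Tr_Ints[OF x] by (auto elim: Ints_cases)
    hence "cnj (Tr x) = Tr x" by simp
    thus "(\<Sum>m\<in>carrier G. cnj (m x)) - (\<Sum>m\<in>carrier G. m x) \<in> {0}" by (simp add: Tr_def)
  qed
  thus ?thesis by auto
qed

end


section \<open>Subfields without ramification\<close>

text \<open>\<open>K\<close> itself may ramify; only the fixed field of \<open>M\<close> is
  unramified, as \<open>M\<close> contains all inertia groups. The last assumption keeps the
  multiplicity of the trivial character nonzero modulo \<open>P\<close> in
  \<open>OM_separates\<close>.\<close>

locale galois_unramified = galois_field +
  fixes M
  assumes M: "subgroup M G"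
    and normal: "\<And>s m. s \<in> carrier G \<Longrightarrow> m \<in> M \<Longrightarrow> s \<otimes> m \<otimes> inv s \<in> M"
    and unramified: "\<And>p P. prime p \<Longrightarrow> P \<in> primes_above K p \<Longrightarrow> inertia_at P \<subseteq> M"
    and tame: "\<And>p P. prime p \<Longrightarrow> P \<in> primes_above K p \<Longrightarrow> \<not> p dvd card (inertia_at P \<inter> M)"
begin

lemma MG: "m \<in> M \<Longrightarrow> m \<in> carrier G" using M by (rule subgroup.mem_carrier)
lemma fin_M: "finite M" using MG finite_G by (meson finite_subset subsetI)
lemma one_M: "\<one> \<in> M" using M by (rule subgroup.one_closed)
lemma mult_M: "s \<in> M \<Longrightarrow> t \<in> M \<Longrightarrow> s \<otimes> t \<in> M" using M by (rule subgroup.m_closed)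
lemma inv_M: "s \<in> M \<Longrightarrow> inv s \<in> M" using M by (rule subgroup.m_inv_closed)
lemma card_M: "card M > 0" using fin_M one_M by (auto simp: card_gt_0_iff)
lemma mult_M_iff: "s \<in> carrier G \<Longrightarrow> m \<in> M \<Longrightarrow> m \<otimes> s \<in> M \<longleftrightarrow> s \<in> M"
  using mult_M[of m s] mult_M[of "inv m" "m \<otimes> s"] inv_M[of m] MG[of m] by (auto simp: m_assoc[symmetric])

text \<open>The ring of integers of the fixed field of \<open>M\<close>.\<close>

definition OM where "OM = {x\<in>\<O>. \<forall>m\<in>M. m x = x}"

lemma OM_O: "x \<in> OM \<Longrightarrow> x \<in> \<O>" by (simp add: OM_def)
lemma OM_K: "x \<in> OM \<Longrightarrow> x \<in> K" by (simp add: OM_def O_K)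
lemma OM_fixed: "x \<in> OM \<Longrightarrow> m \<in> M \<Longrightarrow> m x = x" by (simp add: OM_def)
lemma OM_1: "1 \<in> OM" by (simp add: OM_def O_1 act_1 MG)
lemma OM_0: "0 \<in> OM" by (simp add: OM_def O_0 act_0 MG)
lemma OM_diff: "x \<in> OM \<Longrightarrow> y \<in> OM \<Longrightarrow> x - y \<in> OM" by (auto simp: OM_def O_diff act_diff MG O_K)
lemma OM_add: "x \<in> OM \<Longrightarrow> y \<in> OM \<Longrightarrow> x + y \<in> OM" by (auto simp: OM_def O_add act_add MG O_K)
lemma OM_mult: "x \<in> OM \<Longrightarrow> y \<in> OM \<Longrightarrow> x * y \<in> OM" by (auto simp: OM_def O_mult act_mult MG O_K)
lemma OM_act: assumes "s \<in> carrier G" "x \<in> OM" shows "s x \<in> OM"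
proof -
  have "m (s x) = s x" if m: "m \<in> M" for m
  proof -
    have n: "inv s \<otimes> m \<otimes> s \<in> M" using normal[of "inv s" m] assms m by simp
    have "m \<otimes> s = s \<otimes> (inv s \<otimes> m \<otimes> s)" using assms MG[OF m] by (simp add: m_assoc[symmetric])
    hence "m (s x) = s ((inv s \<otimes> m \<otimes> s) x)"
      using act_comp[of m s x] act_comp[of s "inv s \<otimes> m \<otimes> s" x] assms MG[OF m] by (simp add: OM_K)
    thus ?thesis using OM_fixed[OF assms(2) n] by simp
  qed
  thus ?thesis using assms by (simp add: OM_def act_O)
qed
lemma OM_act_coset: assumes "s \<in> carrier G" "m \<in> M" "x \<in> OM" shows "(s \<otimes> m) x = s x"
  using assms by (simp add: act_comp MG OM_K OM_fixed)

text \<open>If \<open>s\<close> were trivial on \<open>OM\<close> modulo \<open>P\<close>, it would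
  preserve all sums over \<open>M\<close> and hence agree modulo \<open>P\<close> with some
  \<open>m\<close> in \<open>M\<close>. Then \<open>s \<otimes> inv m\<close> would be an inertia
  element, so \<open>s\<close> would lie in \<open>M\<close>.\<close>

lemma OM_separates:
  assumes s: "s \<in> carrier G" "s \<notin> M" and P: "galois_prime G K P"
  shows "\<exists>y\<in>OM. s y - y \<notin> P"
proof (rule ccontr)
  assume neg: "\<not> ?thesis"
  interpret P: galois_prime G K P by (rule P)
  have inert: "P.inertia = inertia_at P" by (simp add: P.inertia_def inertia_at_def)
  have "\<exists>m\<in>M. \<forall>x\<in>\<O>. s x - m x \<in> P"
  proof (rule P.hom_mod_prime_eq_act[OF M])
    show "s x \<in> \<O>" if "x \<in> \<O>" for x using that s by (simp add: act_O)
    show "s (x * y) - s x * s y \<in> P" if "x \<in> \<O>" "y \<in> \<O>" for x y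
      using that s by (simp add: act_mult O_K P.P_0)
    show "of_nat (card (P.inertia \<inter> M)) \<notin> P"
      using prime_ideal_cases[OF P]
    proof
      assume "P = {0}"
      hence "P.inertia = {\<one>}" using inertia_at_zero inert by metis
      hence "P.inertia \<inter> M = {\<one>}" using one_M by auto
      thus ?thesis using \<open>P = {0}\<close> by simp
    next
      assume "\<exists>p. prime p \<and> P \<in> primes_above K p"
      then obtain p where p: "prime p" "P \<in> primes_above K p" by blast
      interpret Q: galois_prime_over G K P p by (rule primes_above_imp_over[OF p(2,1)])
      show ?thesis using tame[OF p] by (simp add: inert Q.P_of_nat_iff)
    qed
    fix x assume x: "x \<in> \<O>"
    define T where "T = (\<Sum>m\<in>M. m x)"
    have "m T = T" if m: "m \<in> M" for m
    proof -
      have "m T = (\<Sum>m'\<in>M. (m \<otimes> m') x)" using m x by (simp add: T_def act_sum act_comp MG O_K act_K)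
      also have "\<dots> = T" unfolding T_def
        by (rule sum.reindex_bij_witness[of _ "\<lambda>t. inv m \<otimes> t" "\<lambda>t. m \<otimes> t"])
          (use m in \<open>auto simp: m_assoc[symmetric] MG inv_M mult_M\<close>)
      finally show ?thesis .
    qed
    hence "T \<in> OM" using x by (simp add: OM_def T_def O_sum act_O MG)
    hence "s T - T \<in> P" using neg by blast
    thus "(\<Sum>m\<in>M. s (m x)) - (\<Sum>m\<in>M. m x) \<in> P"
      using s x by (simp add: T_def act_sum MG O_K act_K)
  qed
  then obtain m where m: "m \<in> M" "\<And>x. x \<in> \<O> \<Longrightarrow> s x - m x \<in> P" by blast
  have "s \<otimes> inv m \<in> inertia_at P"
  proof -
    have "(s \<otimes> inv m) x - x \<in> P" if x: "x \<in> \<O>" for x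
    proof -
      have "(inv m) x \<in> \<O>" using m x by (simp add: act_O MG)
      from m(2)[OF this] show ?thesis using m s x by (simp add: act_comp MG O_K act_inv_act)
    qed
    thus ?thesis using s m by (simp add: inertia_at_def MG)
  qed
  moreover have "inertia_at P \<subseteq> M"
    using prime_ideal_cases[OF P] unramified inertia_at_zero one_M by auto
  ultimately have "(s \<otimes> inv m) \<otimes> m \<in> M" using m mult_M by blast
  thus False using s m by (simp add: m_assoc MG)
qed

section \<open>Coset representatives and the trace of the fixed field\<close>

definition rep where "rep t = (SOME u. u \<in> carrier G \<and> inv u \<otimes> t \<in> M)"
definition reps where "reps = rep ` carrier G"

lemma rep: assumes "t \<in> carrier G" shows "rep t \<in> carrier G" "inv (rep t) \<otimes> t \<in> M"
proof -
  have "\<exists>u. u \<in> carrier G \<and> inv u \<otimes> t \<in> M" using assms one_M by (intro exI[of _ t]) simp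
  from someI_ex[OF this] show "rep t \<in> carrier G" "inv (rep t) \<otimes> t \<in> M" by (simp_all add: rep_def)
qed

text \<open>The predicate under \<open>SOME\<close> depends only on the coset of \<open>t\<close>,
  so the chosen representative does too.\<close>

lemma rep_eq: assumes "t \<in> carrier G" "t' \<in> carrier G" "inv t \<otimes> t' \<in> M" shows "rep t = rep t'"
proof -
  have "inv u \<otimes> t \<in> M \<longleftrightarrow> inv u \<otimes> t' \<in> M" if u: "u \<in> carrier G" for u
  proof
    assume "inv u \<otimes> t \<in> M"
    from mult_M[OF this assms(3)] show "inv u \<otimes> t' \<in> M"
      using u assms by (simp add: m_assoc[symmetric]) (simp add: m_assoc)
  next
    assume "inv u \<otimes> t' \<in> M"
    from mult_M[OF this inv_M[OF assms(3)]] show "inv u \<otimes> t \<in> M"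
      using u assms by (simp add: inv_mult_group m_assoc[symmetric]) (simp add: m_assoc)
  qed
  hence "(\<lambda>u. u \<in> carrier G \<and> inv u \<otimes> t \<in> M) = (\<lambda>u. u \<in> carrier G \<and> inv u \<otimes> t' \<in> M)" by auto
  thus ?thesis by (simp add: rep_def)
qed

lemma reps_carrier: "u \<in> reps \<Longrightarrow> u \<in> carrier G" using rep by (auto simp: reps_def)
lemma fin_reps: "finite reps" using finite_G by (simp add: reps_def)
lemma reps_eq_iff: assumes "u \<in> reps" "v \<in> reps" shows "inv u \<otimes> v \<in> M \<longleftrightarrow> u = v"
proof
  assume uv: "inv u \<otimes> v \<in> M"
  have "rep w = w" if w: "w \<in> reps" for w
  proof -
    obtain t where t: "t \<in> carrier G" "w = rep t" using w by (auto simp: reps_def)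
    thus ?thesis using rep_eq[of w t] rep[OF t(1)] by simp
  qed
  thus "u = v" using rep_eq[OF _ _ uv] assms reps_carrier by metis
qed (use assms one_M reps_carrier in auto)

lemma bij_reps: "bij_betw (\<lambda>(u, m). u \<otimes> m) (reps \<times> M) (carrier G)"
proof (rule bij_betwI[of _ _ _ "\<lambda>t. (rep t, inv (rep t) \<otimes> t)"])
  show "(\<lambda>(u, m). u \<otimes> m) \<in> reps \<times> M \<rightarrow> carrier G" using reps_carrier MG by auto
  show "(\<lambda>t. (rep t, inv (rep t) \<otimes> t)) \<in> carrier G \<rightarrow> reps \<times> M" using rep by (auto simp: reps_def)
  show "(case (rep t, inv (rep t) \<otimes> t) of (u, m) \<Rightarrow> u \<otimes> m) = t" if "t \<in> carrier G" for t
    using rep[OF that] that by (simp add: m_assoc[symmetric])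
  show "(rep (case um of (u, m) \<Rightarrow> u \<otimes> m), inv rep (case um of (u, m) \<Rightarrow> u \<otimes> m) \<otimes> (case um of (u, m) \<Rightarrow> u \<otimes> m)) = um"
    if um: "um \<in> reps \<times> M" for um
  proof -
    obtain u m where [simp]: "um = (u, m)" and u: "u \<in> reps" "m \<in> M" using um by auto
    have G: "u \<in> carrier G" "m \<in> carrier G" using u reps_carrier MG by auto
    have "inv (rep (u \<otimes> m)) \<otimes> (u \<otimes> m) \<in> M" using rep[of "u \<otimes> m"] G by simp
    from mult_M[OF this inv_M[OF u(2)]] have "inv (rep (u \<otimes> m)) \<otimes> u \<in> M"
      using G rep[of "u \<otimes> m"] by (simp add: m_assoc)
    hence "rep (u \<otimes> m) = u" using reps_eq_iff[of "rep (u \<otimes> m)" u] u G by (simp add: reps_def)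
    thus ?thesis using G by (simp add: m_assoc[symmetric])
  qed
qed

lemma sum_reps: assumes "\<And>u m. u \<in> carrier G \<Longrightarrow> m \<in> M \<Longrightarrow> f (u \<otimes> m) = f u"
  shows "(\<Sum>t\<in>carrier G. f t) = of_nat (card M) * (\<Sum>u\<in>reps. f u :: complex)"
proof -
  have "(\<Sum>t\<in>carrier G. f t) = (\<Sum>(u, m)\<in>reps \<times> M. f (u \<otimes> m))"
    using sum.reindex_bij_betw[OF bij_reps, of f] by (simp add: case_prod_beta)
  also have "\<dots> = (\<Sum>u\<in>reps. \<Sum>m\<in>M. f u)"
    unfolding sum.cartesian_product[symmetric] by (intro sum.cong) (auto simp: assms reps_carrier)
  finally show ?thesis by (simp add: sum_distrib_left)
qed

lemma prod_reps: assumes "\<And>u m. u \<in> carrier G \<Longrightarrow> m \<in> M \<Longrightarrow> f (u \<otimes> m) = f u"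
  shows "(\<Prod>t\<in>carrier G. f t) = (\<Prod>u\<in>reps. f u :: complex) ^ card M"
proof -
  have "(\<Prod>t\<in>carrier G. f t) = (\<Prod>(u, m)\<in>reps \<times> M. f (u \<otimes> m))"
    using prod.reindex_bij_betw[OF bij_reps, of f] by (simp add: case_prod_beta)
  also have "\<dots> = (\<Prod>u\<in>reps. \<Prod>m\<in>M. f u)"
    unfolding prod.cartesian_product[symmetric] by (intro prod.cong) (auto simp: assms reps_carrier)
  finally show ?thesis by (simp add: prod_power_distrib)
qed

lemma card_reps: "card (carrier G) = card reps * card M"
  using bij_betw_same_card[OF bij_reps] by (simp add: card_cartesian_product)

text \<open>The trace of the fixed field of \<open>M\<close> over the rationals.\<close>

definition TrM where "TrM y = (\<Sum>u\<in>reps. u y)"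

lemma TrM_Ints: assumes y: "y \<in> OM" shows "TrM y \<in> \<int>"
proof (rule O_Rats)
  show "TrM y \<in> \<O>" unfolding TrM_def using y by (intro O_sum) (simp add: act_O reps_carrier OM_O)
  have "Tr y = of_nat (card M) * TrM y" unfolding Tr_def TrM_def
    using y by (intro sum_reps) (simp add: OM_act_coset)
  hence "TrM y = Tr y / of_nat (card M)" using card_M by simp
  thus "TrM y \<in> \<rat>" using Tr_Rats[OF OM_K[OF y]] by (auto intro: Rats_divide)
qed

end


section \<open>The discriminant of the fixed ring is a unit\<close>

context galois_unramified
begin

text \<open>
  As no prime is ramified, the ideal generated by all \<open>s y - y\<close> with \<open>y \<in> OM\<close> is the unit ideal for every
  \<open>s \<notin> M\<close>. This yields a dual basis, so the discriminant of \<open>OM\<close> is a unit.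
\<close>

lemma exists_dual_family:
  assumes w: "\<And>j. j < r \<Longrightarrow> w j \<in> OM" "\<And>x. x \<in> OM \<Longrightarrow> \<exists>c :: nat \<Rightarrow> int. x = (\<Sum>j<r. of_int (c j) * w j)"
  shows "\<exists>z. (\<forall>j<r. z j \<in> \<O>) \<and> (\<forall>t\<in>carrier G. (\<Sum>j<r. z j * t (w j)) = (if t \<in> M then 1 else 0))"
proof -
  \<comment> \<open>The image of the tensor product of \<open>\<O>\<close> and \<open>OM\<close> in
    the functions on \<open>G\<close>. It is closed under products, so indicator functions can be
    built as products.\<close>
  define W where "W f \<longleftrightarrow> (\<exists>z. (\<forall>j<r. z j \<in> \<O>) \<and> (\<forall>t\<in>carrier G. f t = (\<Sum>j<r. z j * t (w j))))" for f :: "_ \<Rightarrow> complex"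
  have W_O: "f t \<in> \<O>" if "W f" "t \<in> carrier G" for f t
    using that w(1) by (auto simp: W_def OM_O act_O intro!: O_sum O_mult)
  have W_add: "W (\<lambda>t. f t + g t)" if fg: "W f" "W g" for f g
  proof -
    from fg obtain y z where "\<forall>j<r. y j \<in> \<O>" "\<forall>t\<in>carrier G. f t = (\<Sum>j<r. y j * t (w j))"
      "\<forall>j<r. z j \<in> \<O>" "\<forall>t\<in>carrier G. g t = (\<Sum>j<r. z j * t (w j))" unfolding W_def by blast
    thus ?thesis unfolding W_def
      by (intro exI[of _ "\<lambda>j. y j + z j"]) (simp add: O_add distrib_right sum.distrib)
  qed
  have W_scale: "W (\<lambda>t. a * f t)" if f: "W f" and a: "a \<in> \<O>" for f a
  proof -
    from f obtain y where "\<forall>j<r. y j \<in> \<O>" "\<forall>t\<in>carrier G. f t = (\<Sum>j<r. y j * t (w j))"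
      unfolding W_def by blast
    thus ?thesis unfolding W_def using a
      by (intro exI[of _ "\<lambda>j. a * y j"]) (simp add: O_mult sum_distrib_left mult.assoc)
  qed
  have W_eval: "W (\<lambda>t. t y)" if y: "y \<in> OM" for y
  proof -
    obtain c :: "nat \<Rightarrow> int" where c: "y = (\<Sum>j<r. of_int (c j) * w j)" using w(2)[OF y] by blast
    have "t y = (\<Sum>j<r. of_int (c j) * t (w j))" if t: "t \<in> carrier G" for t
    proof -
      have "t y = (\<Sum>j<r. t (of_int (c j) * w j))"
        unfolding c using w(1) by (intro act_sum[OF t]) (simp add: K_mult K_int OM_K)
      thus ?thesis using t w(1) by (simp add: act_mult act_int K_int OM_K)
    qed
    thus ?thesis unfolding W_def by (intro exI[of _ "\<lambda>j. of_int (c j)"]) (simp add: O_int)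
  qed
  have W_cong: "W f" if "W g" "\<And>t. t \<in> carrier G \<Longrightarrow> f t = g t" for f g
    using that unfolding W_def by simp
  have W_const: "W (\<lambda>t. a)" if a: "a \<in> \<O>" for a
    using W_scale[OF W_eval[OF OM_1] a] by (rule W_cong) (simp add: act_1)
  have W_sum: "W (\<lambda>t. \<Sum>i\<in>I. f i t)" if "finite I" "\<And>i. i \<in> I \<Longrightarrow> W (f i)" for I :: "nat set" and f
    using that by (induction I rule: finite_induct) (auto intro: W_add W_const O_0)
  have W_mult: "W (\<lambda>t. f t * g t)" if fg: "W f" "W g" for f g
  proof -
    from fg obtain y z where y: "\<forall>j<r. y j \<in> \<O>" "\<forall>t\<in>carrier G. f t = (\<Sum>j<r. y j * t (w j))"
      and z: "\<forall>j<r. z j \<in> \<O>" "\<forall>t\<in>carrier G. g t = (\<Sum>j<r. z j * t (w j))" unfolding W_def by blast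
    have "W (\<lambda>t. \<Sum>i<r. \<Sum>j<r. (y i * z j) * t (w i * w j))"
      using y z w(1) by (intro W_sum W_scale W_eval OM_mult O_mult) auto
    thus ?thesis
    proof (rule W_cong)
      fix t assume t: "t \<in> carrier G"
      have "f t * g t = (\<Sum>i<r. \<Sum>j<r. (y i * t (w i)) * (z j * t (w j)))"
        using y z t by (simp add: sum_product)
      also have "\<dots> = (\<Sum>i<r. \<Sum>j<r. (y i * z j) * t (w i * w j))"
        using t w(1) by (intro sum.cong) (auto simp: act_mult OM_K)
      finally show "f t * g t = (\<Sum>i<r. \<Sum>j<r. (y i * z j) * t (w i * w j))" .
    qed
  qed
  have sep: "\<exists>f. W f \<and> f \<one> = 1 \<and> f s = 0" if s: "s \<in> carrier G" "s \<notin> M" for s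
  proof -
    \<comment> \<open>An ideal that contains every \<open>s y - y\<close> with \<open>y\<close> in
      \<open>OM\<close>. By \<open>OM_separates\<close> no prime ideal contains it, so it contains
      1.\<close>
    define J where "J = {f s - f \<one> | f. W f}"
    have JI: "f s - f \<one> \<in> J" if "W f" for f using that by (auto simp: J_def)
    have "ideal J R"
      unfolding ideal_R_iff
    proof (intro conjI ballI)
      show "J \<subseteq> \<O>" using W_O s by (auto simp: J_def intro!: O_diff)
      show "0 \<in> J" using JI[OF W_const[OF O_0]] by simp
      fix x y assume "x \<in> J" "y \<in> J"
      then obtain f g where fg: "x = f s - f \<one>" "y = g s - g \<one>" "W f" "W g" by (auto simp: J_def)
      have "x + y = (f s + g s) - (f \<one> + g \<one>)" by (simp add: fg)
      thus "x + y \<in> J" using JI[OF W_add[OF fg(3,4)]] by (simp only:)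
    next
      fix x y assume x: "x \<in> \<O>" and "y \<in> J"
      then obtain f where f: "y = f s - f \<one>" "W f" by (auto simp: J_def)
      have "x * y = x * f s - x * f \<one>" by (simp add: f right_diff_distrib)
      thus "x * y \<in> J" using JI[OF W_scale[OF f(2) x]] by (simp only:)
    qed
    moreover have "\<not> (J \<subseteq> P \<and> galois_prime G K P)" for P
    proof
      assume P: "J \<subseteq> P \<and> galois_prime G K P"
      from OM_separates[OF s] P obtain y where y: "y \<in> OM" "s y - y \<notin> P" by blast
      have "s y - \<one> y \<in> J" using JI[OF W_eval[OF y(1)]] by simp
      with P y show False by (auto simp: act_one OM_K)
    qed
    ultimately have "1 \<in> J" using exists_prime_ideal by blast
    then obtain f where f: "W f" "f s - f \<one> = 1" by (auto simp: J_def)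
    \<comment> \<open>As f s - f 1 = 1, where f 1 is the value at the identity, the function f s - f
      t is 1 at the identity and 0 at \<open>s\<close>.\<close>
    have "W (\<lambda>t. f s + (- 1) * f t)"
      using f s by (intro W_add W_const W_scale) (auto simp: W_O O_minus O_1)
    thus ?thesis using f by (intro exI[of _ "\<lambda>t. f s + (- 1) * f t"]) auto
  qed
  \<comment> \<open>The product over all \<open>s\<close> outside \<open>M\<close> vanishes off
    \<open>M\<close>. Being a combination of evaluations at fixed elements, it is constant on
    \<open>M\<close>, hence the indicator of \<open>M\<close>.\<close>
  have "\<exists>f. W f \<and> f \<one> = 1 \<and> (\<forall>s\<in>S. f s = 0)" if "S \<subseteq> carrier G - M" for S
    using finite_subset[OF that] finite_G that
  proof (induction S rule: infinite_finite_induct)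
    case (insert s S)
    then obtain f where f: "W f" "f \<one> = 1" "\<forall>s\<in>S. f s = 0" by auto
    obtain g where g: "W g" "g \<one> = 1" "g s = 0" using sep[of s] insert.prems by auto
    show ?case using W_mult[OF f(1) g(1)] f g by (intro exI[of _ "\<lambda>t. f t * g t"]) auto
  qed (use W_const[OF O_1] in \<open>auto intro!: exI[of _ "\<lambda>t. 1"]\<close>)
  from this[OF order_refl] obtain f where f: "W f" "f \<one> = 1" "\<And>s. s \<in> carrier G \<Longrightarrow> s \<notin> M \<Longrightarrow> f s = 0" by auto
  obtain z where z: "\<forall>j<r. z j \<in> \<O>" "\<And>t. t \<in> carrier G \<Longrightarrow> f t = (\<Sum>j<r. z j * t (w j))"
    using f(1) unfolding W_def by blast
  have f1: "f t = 1" if t: "t \<in> M" for t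
  proof -
    have "f t = f \<one>" using t w(1) by (simp add: z(2) MG OM_fixed act_one OM_K)
    thus ?thesis using f by simp
  qed
  have "(\<Sum>j<r. z j * t (w j)) = (if t \<in> M then 1 else 0)" if t: "t \<in> carrier G" for t
    using z(2)[OF t] f(3)[OF t] f1[of t] by auto
  thus ?thesis using z(1) by blast
qed

lemma dual_family_conj:
  assumes z: "\<And>j. j < r \<Longrightarrow> z j \<in> \<O>" "\<And>t. t \<in> carrier G \<Longrightarrow> (\<Sum>j<r. z j * t (w j)) = (if t \<in> M then 1 else 0)"
    and w: "\<And>j. j < r \<Longrightarrow> w j \<in> OM" and s: "s \<in> carrier G" and t: "t \<in> carrier G"
  shows "(\<Sum>j<r. s (z j) * t (w j)) = (if inv s \<otimes> t \<in> M then 1 else 0)"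
proof -
  have "(\<Sum>j<r. s (z j) * t (w j)) = (\<Sum>j<r. s (z j * (inv s \<otimes> t) (w j)))"
  proof (rule sum.cong)
    fix j assume "j \<in> {..<r}"
    hence O: "z j \<in> K" "w j \<in> K" using z w by (auto simp: O_K OM_K)
    have "t (w j) = s ((inv s \<otimes> t) (w j))"
      using s t O by (simp add: act_comp act_K act_inv_act)
    thus "s (z j) * t (w j) = s (z j * (inv s \<otimes> t) (w j))" using s t O by (simp add: act_mult act_K)
  qed simp
  also have "\<dots> = s (\<Sum>j<r. z j * (inv s \<otimes> t) (w j))"
    using s t z w by (subst act_sum[OF s]) (auto simp: K_mult act_K O_K OM_K)
  also have "\<dots> = (if inv s \<otimes> t \<in> M then 1 else 0)" using s t by (simp add: z(2) act_1 act_0)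
  finally show ?thesis .
qed

text \<open>The rank is computed as a trace, in place of the degree formula of Galois theory.
  Summing \<open>z j\<close> over \<open>M\<close> gives \<open>D j\<close> in \<open>OM\<close>
  such that d y is the sum of all \<open>TrM (y * D j) * w j\<close>, with d the order of
  \<open>M\<close>. Independence makes each \<open>TrM (w k * D k)\<close> equal to d, so their sum
  is d r; summing over conjugates last, each coset contributes d.\<close>

lemma rank_eq_card_reps:
  assumes w: "\<And>j. j < r \<Longrightarrow> w j \<in> OM" "\<And>c :: nat \<Rightarrow> int. (\<Sum>j<r. of_int (c j) * w j) = 0 \<Longrightarrow> \<forall>j<r. c j = 0"
    and z: "\<And>j. j < r \<Longrightarrow> z j \<in> \<O>" "\<And>t. t \<in> carrier G \<Longrightarrow> (\<Sum>j<r. z j * t (w j)) = (if t \<in> M then 1 else 0)"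
  shows "r = card reps"
proof -
  define d where "d = card M"
  define D where "D j = (\<Sum>m\<in>M. m (z j))" for j
  have D: "D j \<in> OM" if j: "j < r" for j
  proof -
    have "m (D j) = D j" if m: "m \<in> M" for m
    proof -
      have "m (D j) = (\<Sum>m'\<in>M. (m \<otimes> m') (z j))" using m z j by (simp add: D_def act_sum act_comp MG O_K act_K)
      also have "\<dots> = D j" unfolding D_def
        by (rule sum.reindex_bij_witness[of _ "\<lambda>t. inv m \<otimes> t" "\<lambda>t. m \<otimes> t"])
          (use m in \<open>auto simp: m_assoc[symmetric] MG inv_M mult_M\<close>)
      finally show ?thesis .
    qed
    thus ?thesis using z j by (simp add: OM_def D_def O_sum act_O MG)
  qed
  have Dw: "(\<Sum>j<r. D j * t (w j)) = (if t \<in> M then of_nat d else 0)" if t: "t \<in> carrier G" for t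
  proof -
    have "(\<Sum>j<r. D j * t (w j)) = (\<Sum>m\<in>M. \<Sum>j<r. m (z j) * t (w j))"
      unfolding D_def sum_distrib_right by (rule sum.swap)
    also have "\<dots> = (\<Sum>m\<in>M. if t \<in> M then 1 else 0)"
    proof (rule sum.cong)
      fix m assume m: "m \<in> M"
      have "(\<Sum>j<r. m (z j) * t (w j)) = (if inv m \<otimes> t \<in> M then 1 else 0)"
        by (rule dual_family_conj) (use z w t MG[OF m] in auto)
      thus "(\<Sum>j<r. m (z j) * t (w j)) = (if t \<in> M then 1 else 0)"
        using mult_M_iff[OF t inv_M[OF m]] by simp
    qed simp
    finally show ?thesis by (simp add: d_def)
  qed
  have uD: "(\<Sum>j<r. u (D j) * w j) = (if u \<in> M then of_nat d else 0)" if u: "u \<in> carrier G" for u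
  proof -
    have "(\<Sum>j<r. u (D j) * w j) = u (\<Sum>j<r. D j * (inv u) (w j))"
      using u D w by (subst act_sum[OF u]) (auto simp: K_mult act_K OM_K act_mult act_inv_act)
    also have "\<dots> = (if inv u \<in> M then of_nat d else 0)" using u by (simp add: Dw act_nat act_0)
    also have "inv u \<in> M \<longleftrightarrow> u \<in> M" using inv_M[of u] inv_M[of "inv u"] u by auto
    finally show ?thesis .
  qed
  obtain u0 where u0: "u0 \<in> reps" "u0 \<in> M"
  proof
    show "rep \<one> \<in> reps" by (simp add: reps_def)
    show "rep \<one> \<in> M" using rep[of \<one>] inv_M[of "inv (rep \<one>)"] by simp
  qed
  have u0u: "u \<in> M \<longleftrightarrow> u = u0" if "u \<in> reps" for u
    using reps_eq_iff[OF u0(1) that] mult_M_iff[of u "inv u0"] inv_M[OF u0(2)] reps_carrier[OF that] by auto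
  have TT: "(\<Sum>j<r. TrM (y * D j) * w j) = of_nat d * y" if y: "y \<in> OM" for y
  proof -
    have "(\<Sum>j<r. TrM (y * D j) * w j) = (\<Sum>j<r. \<Sum>u\<in>reps. u y * (u (D j) * w j))"
      unfolding TrM_def sum_distrib_right
      using y D by (intro sum.cong) (auto simp: act_mult reps_carrier OM_K)
    also have "\<dots> = (\<Sum>u\<in>reps. u y * (\<Sum>j<r. u (D j) * w j))"
      by (subst sum.swap) (simp add: sum_distrib_left)
    also have "\<dots> = (\<Sum>u\<in>reps. if u = u0 then of_nat d * y else 0)"
      using u0 by (intro sum.cong) (auto simp: uD reps_carrier u0u OM_fixed[OF y u0(2)])
    finally show ?thesis using fin_reps u0 by simp
  qed
  have diag: "TrM (w k * D k) = of_nat d" if k: "k < r" for k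
  proof -
    have "\<forall>j\<in>{..<r}. \<exists>n. TrM (w k * D j) = of_int n"
    proof
      fix j assume "j \<in> {..<r}"
      hence "TrM (w k * D j) \<in> \<int>" using TrM_Ints[OF OM_mult[OF w(1)[OF k] D]] by simp
      thus "\<exists>n. TrM (w k * D j) = of_int n" by (auto elim: Ints_cases)
    qed
    then obtain n where n: "\<And>j. j < r \<Longrightarrow> TrM (w k * D j) = of_int (n j)" by (metis lessThan_iff)
    have "(\<Sum>j<r. of_int (n j - (if j = k then int d else 0)) * w j)
      = (\<Sum>j<r. TrM (w k * D j) * w j) - (\<Sum>j<r. if j = k then of_nat d * w j else 0)"
      unfolding sum_subtractf[symmetric] using n by (intro sum.cong) (auto simp: algebra_simps)
    also have "\<dots> = 0" using TT[OF w(1)[OF k]] k by simp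
    finally have "n k - int d = 0" using w(2)[of "\<lambda>j. n j - (if j = k then int d else 0)"] k by auto
    thus ?thesis using n[OF k] by simp
  qed
  have "of_nat d * of_nat r = (\<Sum>k<r. TrM (w k * D k))" using diag by simp
  also have "\<dots> = (\<Sum>u\<in>reps. \<Sum>k<r. u (D k) * u (w k))"
    unfolding TrM_def using D w(1)
    by (subst sum.swap) (intro sum.cong, auto simp: act_mult reps_carrier OM_K mult.commute)
  also have "\<dots> = (\<Sum>u\<in>reps. of_nat d)"
  proof (rule sum.cong)
    fix u assume "u \<in> reps"
    hence u: "u \<in> carrier G" by (rule reps_carrier)
    have "(\<Sum>k<r. u (D k) * u (w k)) = u (\<Sum>k<r. D k * \<one> (w k))"
      using u D w(1) by (subst act_sum[OF u]) (auto simp: K_mult act_K OM_K act_mult act_one)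
    thus "(\<Sum>k<r. u (D k) * u (w k)) = of_nat d" using Dw[of \<one>] one_M u by (simp add: act_nat)
  qed simp
  finally have "of_nat (d * r) = (of_nat (card reps * d) :: complex)" by simp
  hence "d * r = card reps * d" by (simp only: of_nat_eq_iff)
  thus ?thesis using card_M by (simp add: d_def)
qed

lemma det_O:
  assumes A: "A \<in> carrier_mat n n" "\<And>i j. i < n \<Longrightarrow> j < n \<Longrightarrow> A $$ (i, j) \<in> \<O>"
  shows "det A \<in> \<O>"
  unfolding det_def'[OF A(1)]
proof (rule O_sum)
  fix p assume "p \<in> {p. p permutes {0..<n}}"
  hence p: "p permutes {0..<n}" by simp
  have "(\<Prod>i=0..<n. A $$ (i, p i)) \<in> \<O>"
    using permutes_in_image[OF p] by (intro O_prod A(2)) auto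
  thus "signof p * (\<Prod>i=0..<n. A $$ (i, p i)) \<in> \<O>"
    using O_mult[OF O_int[of "signof p"]] by (simp add: sign_def O_minus)
qed

text \<open>The squared determinant is the discriminant of \<open>OM\<close>. It is an integer, as
  the determinant of the trace form. Its inverse is the squared determinant of the conjugates of the
  dual family, a rational algebraic integer. Squares are taken because the determinant itself need
  not be rational.\<close>

lemma unimodular_basis:
  obtains n w \<rho> where "n = card reps" "bij_betw \<rho> {..<n} reps" "\<And>j. j < n \<Longrightarrow> w j \<in> OM"
    "\<And>c :: nat \<Rightarrow> int. (\<Sum>j<n. of_int (c j) * w j) = 0 \<Longrightarrow> \<forall>j<n. c j = 0"
    "(det (mat n n (\<lambda>(i, j). \<rho> i (w j))))\<^sup>2 = 1 \<or> (det (mat n n (\<lambda>(i, j). \<rho> i (w j))))\<^sup>2 = - 1"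
proof -
  obtain r :: nat and w where w: "\<And>j. j < r \<Longrightarrow> w j \<in> OM" "\<And>x. x \<in> OM \<Longrightarrow> \<exists>c :: nat \<Rightarrow> int. x = (\<Sum>j<r. of_int (c j) * w j)"
    "\<And>c :: nat \<Rightarrow> int. (\<Sum>j<r. of_int (c j) * w j) = 0 \<Longrightarrow> \<forall>j<r. c j = 0"
    using integral_basis[of OM] OM_0 OM_diff OM_O by blast
  obtain z where z: "\<And>j. j < r \<Longrightarrow> z j \<in> \<O>"
    "\<And>t. t \<in> carrier G \<Longrightarrow> (\<Sum>j<r. z j * t (w j)) = (if t \<in> M then 1 else 0)"
    using exists_dual_family[OF w(1,2)] by blast
  have r: "r = card reps" using rank_eq_card_reps[OF w(1,3) z] .
  obtain \<rho> where \<rho>: "bij_betw \<rho> {..<r} reps"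
    using bij_betw_from_nat_into_finite[OF fin_reps] r by blast
  have \<rho>reps: "\<rho> i \<in> reps" if "i < r" for i using \<rho> that by (auto simp: bij_betw_def)
  hence \<rho>G: "\<rho> i \<in> carrier G" if "i < r" for i using that reps_carrier by blast
  define A where "A = mat r r (\<lambda>(i, j). \<rho> i (w j))"
  define Z where "Z = mat r r (\<lambda>(i, j). \<rho> i (z j))"
  have cA: "A \<in> carrier_mat r r" and cZ: "Z \<in> carrier_mat r r" by (auto simp: A_def Z_def)
  have "Z * A\<^sup>T = 1\<^sub>m r"
  proof (rule eq_matI)
    fix i k assume "i < dim_row (1\<^sub>m r :: complex mat)" "k < dim_col (1\<^sub>m r :: complex mat)"
    hence ik: "i < r" "k < r" by auto
    have "(Z * A\<^sup>T) $$ (i, k) = (\<Sum>j<r. \<rho> i (z j) * \<rho> k (w j))"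
      using ik by (simp add: A_def Z_def scalar_prod_def lessThan_atLeast0)
    also have "\<dots> = (if inv (\<rho> i) \<otimes> \<rho> k \<in> M then 1 else 0)"
      using dual_family_conj[OF z w(1)] ik \<rho>G by blast
    also have "\<dots> = (if i = k then 1 else 0)"
      using reps_eq_iff[OF \<rho>reps \<rho>reps] ik \<rho> by (auto simp: bij_betw_def inj_on_def)
    finally show "(Z * A\<^sup>T) $$ (i, k) = 1\<^sub>m r $$ (i, k)" using ik by simp
  qed (auto simp: A_def Z_def)
  hence "det Z * det A = 1"
    using det_mult[OF cZ, of "A\<^sup>T"] cA det_transpose[OF cA] by (metis det_one transpose_carrier_mat)
  hence inv: "(det Z)\<^sup>2 * (det A)\<^sup>2 = 1" by (metis one_power2 power_mult_distrib)
  have "(det A)\<^sup>2 \<in> \<int>"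
  proof -
    have TrM_w: "TrM (w i * w j) \<in> \<int>" if "i < r" "j < r" for i j using that w(1) by (intro TrM_Ints OM_mult) auto
    have "A\<^sup>T * A = mat r r (\<lambda>(i, j). TrM (w i * w j))"
    proof (rule eq_matI)
      fix i j assume "i < dim_row (mat r r (\<lambda>(i, j). TrM (w i * w j)))" "j < dim_col (mat r r (\<lambda>(i, j). TrM (w i * w j)))"
      hence ij: "i < r" "j < r" by auto
      have "(A\<^sup>T * A) $$ (i, j) = (\<Sum>k<r. \<rho> k (w i) * \<rho> k (w j))"
        using ij by (simp add: A_def scalar_prod_def lessThan_atLeast0)
      also have "\<dots> = (\<Sum>k<r. \<rho> k (w i * w j))" using ij w(1) by (intro sum.cong) (auto simp: act_mult \<rho>G OM_K)
      also have "\<dots> = TrM (w i * w j)" unfolding TrM_def by (rule sum.reindex_bij_betw[OF \<rho>])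
      finally show "(A\<^sup>T * A) $$ (i, j) = mat r r (\<lambda>(i, j). TrM (w i * w j)) $$ (i, j)" using ij by simp
    qed (auto simp: A_def)
    hence "(det A)\<^sup>2 = det (mat r r (\<lambda>(i, j). TrM (w i * w j)))"
      using det_mult[of "A\<^sup>T" r A] cA det_transpose[OF cA] by (simp add: power2_eq_square)
    also have "\<dots> \<in> \<int>"
    proof -
      have "(\<Prod>i=0..<r. mat r r (\<lambda>(i, j). TrM (w i * w j)) $$ (i, p i)) \<in> \<int>" if "p permutes {0..<r}" for p
        using permutes_in_image[OF that] by (intro Ints_prod) (auto intro!: TrM_w)
      thus ?thesis by (subst det_def'[of _ r]) (auto intro!: Ints_sum Ints_mult simp: sign_def)
    qed
    finally show ?thesis .
  qed
  then obtain a where a: "(det A)\<^sup>2 = of_int a" by (auto elim: Ints_cases)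
  have "det Z \<in> \<O>" using cZ by (rule det_O) (use z in \<open>auto simp: Z_def act_O \<rho>G\<close>)
  moreover have "a \<noteq> 0" using inv a by auto
  hence "(det Z)\<^sup>2 = 1 / of_int a" using inv a by (simp add: field_simps)
  hence "(det Z)\<^sup>2 \<in> \<rat>" by simp
  ultimately have "(det Z)\<^sup>2 \<in> \<int>" by (intro O_Rats O_power)
  then obtain b where b: "(det Z)\<^sup>2 = of_int b" by (auto elim: Ints_cases)
  have "(of_int (b * a) :: complex) = of_int 1" using inv a b by simp
  hence "b * a = 1" by (simp only: of_int_eq_iff)
  hence "a = 1 \<or> a = - 1" by (metis mult.commute pos_zmult_eq_1_iff_lemma zmult_eq_1_iff)
  hence "(det A)\<^sup>2 = 1 \<or> (det A)\<^sup>2 = - 1" using a by auto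
  thus thesis using that[OF r \<rho> w(1) w(3)] by (simp add: A_def)
qed

end


section \<open>No proper unramified extension of the rationals\<close>

context galois_unramified
begin

text \<open>The determinant is a conjugate of \<open>v\<close>, and \<open>s\<close> changes the
  sign of \<open>v\<close>. If v^2 = 1, then \<open>v\<close> is 1 or -1 and thus fixed by
  \<open>s\<close>. If v^2 = -1, Stickelberger's congruence fails.\<close>

lemma card_reps_neq_2: "card reps \<noteq> 2"
proof
  assume 2: "card reps = 2"
  obtain n w \<rho> where n: "n = card reps" and \<rho>: "bij_betw \<rho> {..<n} reps" and w: "\<And>j. j < n \<Longrightarrow> w j \<in> OM"
    and det: "(det (mat n n (\<lambda>(i, j). \<rho> i (w j))))\<^sup>2 = 1 \<or> (det (mat n n (\<lambda>(i, j). \<rho> i (w j))))\<^sup>2 = - 1"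
    by (rule unimodular_basis) blast
  have n2: "n = 2" using n 2 by simp
  have \<rho>01: "\<rho> 0 \<in> reps" "\<rho> 1 \<in> reps" "\<rho> 0 \<noteq> \<rho> 1"
    using bij_betwE[OF \<rho>] inj_onD[OF bij_betw_imp_inj_on[OF \<rho>], of 0 1] n2 by auto
  hence G: "\<rho> 0 \<in> carrier G" "\<rho> 1 \<in> carrier G" using reps_carrier by auto
  have w01: "w 0 \<in> OM" "w 1 \<in> OM" using w n2 by auto
  define s where "s = inv (\<rho> 0) \<otimes> \<rho> 1"
  have s: "s \<in> carrier G" using G by (simp add: s_def)
  have \<rho>1: "\<rho> 1 y = \<rho> 0 (s y)" if "y \<in> K" for y
    using act_comp[of "\<rho> 0" s y] G s that by (simp add: s_def m_assoc[symmetric])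
  have "s \<notin> M"
    using reps_eq_iff[OF \<rho>01(1,2)] \<rho>01(3) by (simp add: s_def)
  have ss: "s \<otimes> s \<in> M"
  proof -
    have reps: "reps = {\<rho> 0, \<rho> 1}" using \<rho> n2 by (auto simp: bij_betw_def lessThan_Suc numeral_2_eq_2)
    define t where "t = \<rho> 0 \<otimes> (s \<otimes> s)"
    have t: "t \<in> carrier G" using G s by (simp add: t_def)
    have "rep t \<in> {\<rho> 0, \<rho> 1}" using t reps by (auto simp: reps_def)
    thus ?thesis
    proof
      assume "rep t = \<rho> 0"
      thus ?thesis using rep(2)[OF t] G s by (simp add: t_def m_assoc[symmetric])
    next
      assume "rep t \<in> {\<rho> 1}"
      moreover have "\<rho> 1 = \<rho> 0 \<otimes> s" using G by (simp add: s_def m_assoc[symmetric])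
      moreover have "inv (\<rho> 0 \<otimes> s) \<otimes> t = s"
        using G s by (simp add: t_def inv_mult_group m_assoc) (simp add: m_assoc[symmetric])
      ultimately show ?thesis using rep(2)[OF t] \<open>s \<notin> M\<close> by simp
    qed
  qed
  have ssy: "s (s y) = y" if "y \<in> OM" for y
    using OM_fixed[OF that ss] s that by (simp add: act_comp OM_K)
  define v where "v = w 0 * s (w 1) - s (w 0) * w 1"
  have v: "v \<in> OM" using w01 s by (simp add: v_def OM_diff OM_mult OM_act)
  have sv: "s v = - v"
    using w01 s by (simp add: v_def act_diff act_mult OM_K act_K K_mult ssy mult.commute)
  have "det (mat n n (\<lambda>(i, j). \<rho> i (w j))) = \<rho> 0 (w 0) * \<rho> 1 (w 1) - \<rho> 0 (w 1) * \<rho> 1 (w 0)"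
    unfolding n2 by (subst laplace_expansion_row[of _ 2 0])
      (simp_all add: numeral_2_eq_2 cofactor_def mat_delete_def det_single)
  also have "\<dots> = \<rho> 0 v"
    using w01 G s by (simp add: v_def act_diff act_mult OM_K act_K K_mult \<rho>1[simplified] mult.commute)
  finally have det_v: "(\<rho> 0 v)\<^sup>2 = 1 \<or> (\<rho> 0 v)\<^sup>2 = - 1" using det by simp
  have vv: "v\<^sup>2 = 1 \<or> v\<^sup>2 = - 1"
  proof -
    have "\<rho> 0 (v\<^sup>2) = \<rho> 0 1 \<or> \<rho> 0 (v\<^sup>2) = \<rho> 0 (- 1)"
      using det_v G v by (simp add: act_power act_1 act_minus K_1 OM_K)
    thus ?thesis using act_inj[OF G(1)] OM_K[OF v] by (simp add: K_power K_1 K_minus)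
  qed
  have "v\<^sup>2 \<noteq> 1"
  proof
    assume "v\<^sup>2 = 1"
    hence "v = 1 \<or> v = - 1" by (simp add: power2_eq_1_iff)
    hence "s v = v" using s by (auto simp: act_1 act_minus K_1)
    hence "v = 0" using sv by simp
    with \<open>v\<^sup>2 = 1\<close> show False by simp
  qed
  moreover have "v\<^sup>2 \<noteq> - 1"
  proof
    assume m1: "v\<^sup>2 = - 1"
    \<comment> \<open>Sum and product of the two terms whose difference is \<open>v\<close>, so v^2
      = a^2 - 4 b. Both are fixed by \<open>s\<close>, hence integers, and a^2 is 0 or 1 modulo
      4.\<close>
    define a where "a = w 0 * s (w 1) + s (w 0) * w 1"
    define b where "b = (w 0 * w 1) * s (w 0 * w 1)"
    have ab: "a \<in> OM" "b \<in> OM"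
    proof -
      show "a \<in> OM" using w01 s by (simp add: a_def OM_add OM_mult OM_act)
      show "b \<in> OM" using w01 s by (simp add: b_def OM_mult OM_act)
    qed
    have sab: "s a = a" "s b = b" using w01 s
      by (simp_all add: a_def b_def act_add act_mult OM_K act_K K_mult K_add ssy mult_ac add_ac)
    have fixed: "y \<in> \<int>" if y: "y \<in> OM" "s y = y" for y
    proof -
      have "TrM y = of_nat 2 * \<rho> 0 y"
      proof -
        have "TrM y = (\<Sum>i<n. \<rho> i y)" unfolding TrM_def by (rule sum.reindex_bij_betw[OF \<rho>, symmetric])
        thus ?thesis using \<rho>1[OF OM_K[OF y(1)]] y(2) by (simp add: n2 numeral_2_eq_2)
      qed
      hence eq: "\<rho> 0 y = TrM y / of_nat 2" by simp
      have "TrM y \<in> \<rat>" using TrM_Ints[OF y(1)] Ints_subset_Rats by blast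
      hence "\<rho> 0 y \<in> \<rat>" unfolding eq by (rule Rats_divide) simp
      hence "(inv (\<rho> 0)) (\<rho> 0 y) = \<rho> 0 y" using G by (simp add: act_Rats)
      hence "y = \<rho> 0 y" using act_inv_act(1)[OF G(1) OM_K[OF y(1)]] by simp
      thus ?thesis using O_Rats[OF OM_O[OF y(1)]] \<open>\<rho> 0 y \<in> \<rat>\<close> by simp
    qed
    obtain k l where kl: "a = of_int k" "b = of_int l" using fixed ab sab by (metis Ints_cases)
    have "v\<^sup>2 = a\<^sup>2 - 4 * b"
      using w01 s by (simp add: v_def a_def b_def act_mult OM_K power2_eq_square algebra_simps)
    hence "(of_int (k\<^sup>2 - 4 * l) :: complex) = of_int (- 1)" using m1 kl by simp
    hence "k\<^sup>2 - 4 * l = - 1" by (simp only: of_int_eq_iff)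
    hence "k\<^sup>2 mod 4 = 3" by presburger
    moreover have "k\<^sup>2 mod 4 = 0 \<or> k\<^sup>2 mod 4 = 1"
    proof (cases "even k")
      case True
      then obtain c where "k = 2 * c" by (auto elim: evenE)
      thus ?thesis by (simp add: power_mult_distrib)
    next
      case False
      then obtain c where c: "k = 2 * c + 1" by (auto elim: oddE)
      have "k\<^sup>2 = 1 + 4 * (c\<^sup>2 + c)" by (simp add: c power2_eq_square algebra_simps)
      thus ?thesis by presburger
    qed
    ultimately show False by simp
  qed
  ultimately show False using vv by blast
qed

text \<open>The linear forms theorem is applied with unequal bounds of product 1. The norm of a
  nonzero integer has absolute value at least 1, so the bound at \<open>\<rho> 0\<close> is
  attained; this makes \<open>x\<close> equal to 2 or -2, against the smaller bound at
  \<open>\<rho> 1\<close>.\<close>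

lemma real_contradiction:
  assumes real: "\<And>x. x \<in> OM \<Longrightarrow> cnj x = x" and card: "card reps \<ge> 2"
  shows False
proof -
  obtain n and w :: "nat \<Rightarrow> complex" and \<rho> where n: "n = card reps" and \<rho>: "bij_betw \<rho> {..<n} reps"
    and w: "\<And>j. j < n \<Longrightarrow> w j \<in> OM" "\<And>c :: nat \<Rightarrow> int. (\<Sum>j<n. of_int (c j) * w j) = 0 \<Longrightarrow> \<forall>j<n. c j = 0"
    and det: "(det (mat n n (\<lambda>(i, j). \<rho> i (w j))))\<^sup>2 = 1 \<or> (det (mat n n (\<lambda>(i, j). \<rho> i (w j))))\<^sup>2 = - 1"
    by (rule unimodular_basis) blast
  have n2: "n \<ge> 2" using n card by simp
  have G: "\<rho> i \<in> carrier G" if "i < n" for i using \<rho> that reps_carrier by (auto simp: bij_betw_def)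
  \<comment> \<open>\<open>OM\<close> is stable under \<open>G\<close> because \<open>M\<close> is
    normal, so all conjugates of its elements are real as well.\<close>
  have re: "complex_of_real (Re (\<rho> i y)) = \<rho> i y" if "i < n" "y \<in> OM" for i y
  proof -
    have "cnj (\<rho> i y) = \<rho> i y" by (rule real[OF OM_act[OF G[OF that(1)] that(2)]])
    thus ?thesis by (simp add: complex_eq_iff)
  qed
  define A where "A = mat n n (\<lambda>(i, j). Re (\<rho> i (w j)))"
  have A: "A \<in> carrier_mat n n" by (simp add: A_def)
  have "map_mat complex_of_real A = mat n n (\<lambda>(i, j). \<rho> i (w j))"
    by (rule eq_matI) (auto simp: A_def re w)
  hence "det (mat n n (\<lambda>(i, j). \<rho> i (w j))) = complex_of_real (det A)"
    using of_real_hom.hom_det[of A] by metis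
  hence "complex_of_real ((det A)\<^sup>2) = complex_of_real 1 \<or> complex_of_real ((det A)\<^sup>2) = complex_of_real (- 1)"
    using det by simp
  hence "(det A)\<^sup>2 = 1 \<or> (det A)\<^sup>2 = - 1" by (simp only: of_real_eq_iff)
  moreover have "(det A)\<^sup>2 \<ge> 0" by simp
  ultimately have "(det A)\<^sup>2 = 1" by linarith
  hence detA: "\<bar>det A\<bar> = 1" by (auto simp: power2_eq_1_iff)
  \<comment> \<open>The product is 1 to match |det A|. The first bound is a rational integer, so
    attaining it determines \<open>x\<close>; the second exists because the index of
    \<open>M\<close> is at least 2.\<close>
  define c :: "nat \<Rightarrow> real" where "c i = (if i = 0 then 2 else if i = 1 then 1 / 2 else 1)" for i
  have prod_c: "(\<Prod>i<n. c i) = 1"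
  proof -
    have "(\<Prod>i<n. c i) = (\<Prod>i\<in>{0, 1}. c i)" using n2 by (intro prod.mono_neutral_right) (auto simp: c_def)
    thus ?thesis by (simp add: c_def)
  qed
  have c_pos: "0 < c i" for i by (simp add: c_def)
  have "\<exists>m :: nat \<Rightarrow> int. (\<exists>j<n. m j \<noteq> 0) \<and> (\<forall>i<n. \<bar>\<Sum>j<n. A $$ (i, j) * m j\<bar> \<le> c i)"
    using n2 detA prod_c c_pos by (intro minkowski_linear_forms[OF A]) auto
  then obtain m :: "nat \<Rightarrow> int" where m: "\<exists>j<n. m j \<noteq> 0" "\<And>i. i < n \<Longrightarrow> \<bar>\<Sum>j<n. A $$ (i, j) * m j\<bar> \<le> c i" by blast
  define x where "x = (\<Sum>j<n. of_int (m j) * w j)"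
  have x0: "x \<noteq> 0" using w(2)[of m] m(1) by (auto simp: x_def)
  have xO: "x \<in> \<O>" unfolding x_def using w(1) by (intro O_sum O_mult O_int) (auto simp: OM_O)
  have x: "x \<in> OM"
  proof -
    have "t x = x" if t: "t \<in> M" for t
      unfolding x_def using w(1) t
      by (subst act_sum[OF MG[OF t]]) (auto simp: K_mult K_int OM_K act_mult act_int MG OM_fixed)
    thus ?thesis using xO by (simp add: OM_def)
  qed
  have bound: "norm (\<rho> i x) \<le> c i" if i: "i < n" for i
  proof -
    have "\<rho> i x = (\<Sum>j<n. \<rho> i (of_int (m j) * w j))"
      unfolding x_def using w(1) by (intro act_sum[OF G[OF i]]) (auto simp: K_mult K_int OM_K)
    also have "\<dots> = (\<Sum>j<n. complex_of_real (A $$ (i, j) * m j))"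
    proof (rule sum.cong)
      fix j assume "j \<in> {..<n}"
      hence j: "j < n" by simp
      have "\<rho> i (of_int (m j) * w j) = of_int (m j) * \<rho> i (w j)"
        using w(1)[OF j] G[OF i] by (simp add: act_mult act_int K_int OM_K)
      also have "\<dots> = of_int (m j) * complex_of_real (Re (\<rho> i (w j)))" using re[OF i w(1)[OF j]] by simp
      finally show "\<rho> i (of_int (m j) * w j) = complex_of_real (A $$ (i, j) * m j)" using i j by (simp add: A_def)
    qed simp
    also have "\<dots> = complex_of_real (\<Sum>j<n. A $$ (i, j) * m j)" by simp
    finally have "norm (\<rho> i x) = \<bar>\<Sum>j<n. A $$ (i, j) * m j\<bar>" by (simp only: norm_of_real)
    thus ?thesis using m(2)[OF i] by simp
  qed
  have norm1: "(\<Prod>i<n. norm (\<rho> i x)) \<ge> 1"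
  proof -
    have "Nm x = (\<Prod>u\<in>reps. u x) ^ card M" unfolding Nm_def
      using x by (intro prod_reps) (simp add: OM_act_coset)
    also have "(\<Prod>u\<in>reps. u x) = (\<Prod>i<n. \<rho> i x)" by (rule prod.reindex_bij_betw[OF \<rho>, symmetric])
    finally have "norm (Nm x) = (\<Prod>i<n. norm (\<rho> i x)) ^ card M" by (simp add: norm_power prod_norm)
    moreover have "norm (Nm x) \<ge> 1"
    proof -
      obtain k where "Nm x = of_int k" using Nm_Ints[OF xO] by (auto elim: Ints_cases)
      moreover have "Nm x \<noteq> 0" using x0 Nm_eq_0_iff OM_K[OF x] by simp
      ultimately show ?thesis by simp
    qed
    ultimately have ge: "1 \<le> (\<Prod>i<n. norm (\<rho> i x)) ^ card M" by simp
    show ?thesis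
    proof (rule ccontr)
      assume "\<not> ?thesis"
      hence "(\<Prod>i<n. norm (\<rho> i x)) ^ card M < 1"
        using card_M by (intro power_less_one_iff[THEN iffD2]) (auto intro!: prod_nonneg)
      with ge show False by simp
    qed
  qed
  have "norm (\<rho> 0 x) = 2"
  proof (rule ccontr)
    assume "norm (\<rho> 0 x) \<noteq> 2"
    hence "norm (\<rho> 0 x) < c 0" using bound[of 0] n2 by (simp add: c_def)
    moreover have "(\<Prod>i\<in>{..<n} - {0}. norm (\<rho> i x)) \<le> (\<Prod>i\<in>{..<n} - {0}. c i)"
      using bound by (intro prod_mono) auto
    moreover have "(\<Prod>i\<in>{..<n} - {0}. c i) > 0" using c_pos by (intro prod_pos) auto
    ultimately have "norm (\<rho> 0 x) * (\<Prod>i\<in>{..<n} - {0}. norm (\<rho> i x)) < c 0 * (\<Prod>i\<in>{..<n} - {0}. c i)"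
      by (intro mult_less_le_imp_less) (auto intro!: prod_pos simp: act_eq_0_iff G OM_K[OF x] x0)
    moreover have "(\<Prod>i<n. norm (\<rho> i x)) = norm (\<rho> 0 x) * (\<Prod>i\<in>{..<n} - {0}. norm (\<rho> i x))"
      "(\<Prod>i<n. c i) = c 0 * (\<Prod>i\<in>{..<n} - {0}. c i)" using n2 by (auto intro!: prod.remove)
    ultimately show False using norm1 prod_c by simp
  qed
  hence "\<bar>Re (\<rho> 0 x)\<bar> = 2" using re[of 0 x] x n2 by (metis norm_of_real zero_less_numeral order_less_le_trans)
  hence "\<rho> 0 x = of_int 2 \<or> \<rho> 0 x = of_int (- 2)" using re[of 0 x] x n2 by (auto simp: abs_if complex_eq_iff split: if_splits)
  moreover have "x = of_int k" if "\<rho> 0 x = of_int k" for k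
    using that act_inj[of "\<rho> 0" x "of_int k"] G[of 0] n2 OM_K[OF x] by (simp add: act_int K_int)
  ultimately have "x = of_int 2 \<or> x = of_int (- 2)" by blast
  hence "\<rho> 1 x = of_int 2 \<or> \<rho> 1 x = of_int (- 2)" using act_int[OF G[of 1]] n2 by (metis Suc_1 Suc_le_lessD One_nat_def)
  hence "norm (\<rho> 1 x) = 2" by auto
  moreover have "norm (\<rho> 1 x) \<le> 1 / 2" using bound[of 1] n2 by (simp add: c_def)
  ultimately show False by simp
qed

text \<open>
  If \<open>M\<close> does not contain complex conjugation, then it has index 2 by maximality.
\<close>

lemma no_unramified_extension:
  assumes proper: "M \<noteq> carrier G"
    and maximal: "\<And>H. subgroup H G \<Longrightarrow> M \<subseteq> H \<Longrightarrow> H = M \<or> H = carrier G"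
  shows False
proof -
  obtain c where c: "c \<in> carrier G" "\<And>x. x \<in> \<O> \<Longrightarrow> cnj x = c x" using exists_complex_conjugation by blast
  have cc: "c \<otimes> c = \<one>"
  proof (rule act_ext_O)
    fix x assume x: "x \<in> \<O>"
    have "c (c x) = cnj (cnj x)" using c(2)[OF x] c(2)[OF act_O[OF c(1) x]] by simp
    thus "(c \<otimes> c) x = \<one> x" using c(1) x by (simp add: act_comp act_one O_K)
  qed (use c in auto)
  have ge2: "card reps \<ge> 2"
  proof -
    have "card reps \<noteq> 0" using fin_reps one_closed by (auto simp: reps_def)
    moreover have "card reps \<noteq> 1"
    proof
      assume "card reps = 1"
      hence "card (carrier G) = card M" using card_reps by simp
      moreover have "M \<subseteq> carrier G" using MG by blast
      ultimately show False using proper card_subset_eq[OF finite_G] by metis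
    qed
    ultimately show ?thesis by linarith
  qed
  show False
  proof (cases "c \<in> M")
    case True
    thus False using ge2 c OM_fixed OM_O by (intro real_contradiction) auto
  next
    case False
    \<comment> \<open>The subgroup generated by \<open>M\<close> and complex conjugation: only two
      cosets, as \<open>M\<close> is normal and \<open>c\<close> is an involution.\<close>
    define H where "H = M \<union> (\<lambda>m. c \<otimes> m) ` M"
    have cm: "m \<otimes> c \<in> (\<lambda>m. c \<otimes> m) ` M" if m: "m \<in> M" for m
    proof -
      have "inv c = c" using cc c by (metis inv_equality)
      hence "c \<otimes> m \<otimes> c \<in> M" using normal[OF c(1) m] by simp
      moreover have "m \<otimes> c = c \<otimes> (c \<otimes> m \<otimes> c)" using cc c MG[OF m] by (simp add: m_assoc[symmetric])
      ultimately show ?thesis by blast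
    qed
    have "subgroup H G"
    proof (rule subgroupI)
      show "H \<subseteq> carrier G" using MG c by (auto simp: H_def)
      show "H \<noteq> {}" using one_M by (auto simp: H_def)
      fix a assume a: "a \<in> H"
      show "inv a \<in> H"
      proof (cases "a \<in> M")
        case True
        thus ?thesis using inv_M by (simp add: H_def)
      next
        case False
        then obtain m where m: "m \<in> M" "a = c \<otimes> m" using a by (auto simp: H_def)
        have "inv c = c" using cc c by (metis inv_equality)
        hence "inv a = inv m \<otimes> c" using m c MG by (simp add: inv_mult_group)
        thus ?thesis using cm[OF inv_M[OF m(1)]] by (simp add: H_def)
      qed
      fix b assume b: "b \<in> H"
      have *: "c \<otimes> x \<in> H" if x: "x \<in> H" for x
      proof (cases "x \<in> M")
        case False
        then obtain m where m: "m \<in> M" "x = c \<otimes> m" using x by (auto simp: H_def)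
        hence "c \<otimes> x = m" using cc c MG by (simp add: m_assoc[symmetric])
        thus ?thesis using m by (simp add: H_def)
      qed (simp add: H_def)
      have **: "m \<otimes> x \<in> H" if m: "m \<in> M" and x: "x \<in> H" for m x
      proof (cases "x \<in> M")
        case True
        thus ?thesis using m mult_M by (simp add: H_def)
      next
        case False
        then obtain m' where m': "m' \<in> M" "x = c \<otimes> m'" using x by (auto simp: H_def)
        obtain m'' where m'': "m'' \<in> M" "m \<otimes> c = c \<otimes> m''" using cm[OF m] by auto
        have "m \<otimes> x = c \<otimes> (m'' \<otimes> m')"
          using m m' m'' c MG by (metis m_assoc)
        thus ?thesis using mult_M[OF m''(1) m'(1)] by (simp add: H_def)
      qed
      show "a \<otimes> b \<in> H"
      proof (cases "a \<in> M")
        case True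
        thus ?thesis using ** b by blast
      next
        case False
        then obtain m where m: "m \<in> M" "a = c \<otimes> m" using a by (auto simp: H_def)
        have "b \<in> carrier G" using b MG c by (auto simp: H_def)
        hence "a \<otimes> b = c \<otimes> (m \<otimes> b)" using m c MG by (simp add: m_assoc)
        thus ?thesis using * ** m b by simp
      qed
    qed
    moreover have "c \<in> H" using one_M c by (auto simp: H_def intro!: image_eqI[of _ _ \<one>])
    ultimately have H: "H = carrier G" using maximal[of H] False by (auto simp: H_def)
    have inj: "inj_on (\<lambda>m. c \<otimes> m) M" using c MG by (auto simp: inj_on_def)
    have "M \<inter> (\<lambda>m. c \<otimes> m) ` M = {}"
    proof -
      have "c \<otimes> m \<notin> M" if m: "m \<in> M" for m
      proof
        assume "c \<otimes> m \<in> M"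
        from mult_M[OF this inv_M[OF m]] show False using c MG[OF m] False by (simp add: m_assoc)
      qed
      thus ?thesis by blast
    qed
    hence "card (carrier G) = 2 * card M"
      unfolding H[symmetric] H_def using fin_M inj by (simp add: card_Un_disjoint card_image)
    hence "card reps = 2" using card_reps card_M by simp
    thus False using card_reps_neq_2 by simp
  qed
qed

end


section \<open>Nilpotent groups\<close>

text \<open>The last term of the lower central series not contained in \<open>M\<close> supplies an
  \<open>h\<close> outside \<open>M\<close> whose commutators with all of \<open>G\<close> lie in
  \<open>M\<close>. By maximality a subgroup that contains \<open>M\<close> and \<open>h\<close> is
  all of \<open>G\<close>; this is applied to the normalizer of \<open>M\<close> and then to the
  centre modulo \<open>M\<close>.\<close>

lemma (in group) nilpotent_maximal_subgroup:
  assumes fin: "finite (carrier G)" and nil: "nilpotent_group G" and H: "subgroup H G" "H \<noteq> carrier G"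
  shows "\<exists>M. subgroup M G \<and> H \<subseteq> M \<and> M \<noteq> carrier G
    \<and> (\<forall>N. subgroup N G \<longrightarrow> M \<subseteq> N \<longrightarrow> N = M \<or> N = carrier G)
    \<and> (\<forall>g\<in>carrier G. \<forall>h\<in>carrier G. g \<otimes> h \<otimes> inv g \<otimes> inv h \<in> M)"
proof -
  define \<A> where "\<A> = {N. subgroup N G \<and> N \<noteq> carrier G}"
  have "finite \<A>" using fin subgroup.subset by (intro finite_subset[of \<A> "Pow (carrier G)"]) (auto simp: \<A>_def)
  moreover have "H \<in> \<A>" using H by (simp add: \<A>_def)
  ultimately have "\<exists>M\<in>\<A>. H \<subseteq> M \<and> (\<forall>N\<in>\<A>. M \<subseteq> N \<longrightarrow> M = N)"
    by (rule finite_has_maximal2)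
  then obtain M where M\<A>: "M \<in> \<A>" "H \<subseteq> M" "\<And>N. N \<in> \<A> \<Longrightarrow> M \<subseteq> N \<Longrightarrow> M = N"
    by auto
  have M: "subgroup M G" "M \<noteq> carrier G" using M\<A> by (auto simp: \<A>_def)
  have max: "N = M \<or> N = carrier G" if "subgroup N G" "M \<subseteq> N" for N using M\<A>(3)[of N] that by (auto simp: \<A>_def)
  have MG: "m \<in> carrier G" if "m \<in> M" for m using subgroup.mem_carrier[OF M(1) that] .
  note cl = subgroup.m_closed[OF M(1)] subgroup.m_inv_closed[OF M(1)]
  let ?\<gamma> = "lower_central_series G"
  have \<gamma>_carrier: "?\<gamma> k \<subseteq> carrier G" for k
  proof (induction k)
    case (Suc k)
    hence "(\<Union>h\<in>?\<gamma> k. \<Union>g\<in>carrier G. {h \<otimes> g \<otimes> inv h \<otimes> inv g}) \<subseteq> carrier G" by auto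
    thus ?case using generate_incl by simp
  qed simp
  obtain K where "?\<gamma> K = {\<one>}" using nil by (auto simp: nilpotent_group_def)
  hence ex: "?\<gamma> K \<subseteq> M" using subgroup.one_closed[OF M(1)] by simp
  define k0 where "k0 = (LEAST k. ?\<gamma> k \<subseteq> M)"
  have k0: "?\<gamma> k0 \<subseteq> M" unfolding k0_def using ex by (rule LeastI)
  have "k0 \<noteq> 0" using k0 M subgroup.subset[OF M(1)] by (cases k0) auto
  then obtain k where k: "k0 = Suc k" by (cases k0) auto
  have "\<not> ?\<gamma> k \<subseteq> M" using not_less_Least[of k "\<lambda>k. ?\<gamma> k \<subseteq> M"] k by (simp add: k0_def)
  then obtain h where h: "h \<in> ?\<gamma> k" "h \<notin> M" by blast
  have hG: "h \<in> carrier G" using h \<gamma>_carrier by blast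
  have hx: "h \<otimes> x \<otimes> inv h \<otimes> inv x \<in> M" if x: "x \<in> carrier G" for x
  proof -
    have "h \<otimes> x \<otimes> inv h \<otimes> inv x \<in> ?\<gamma> (Suc k)" using h x by (auto intro!: generate.incl)
    thus ?thesis using k0 k by blast
  qed
  have conj: "g \<otimes> m \<otimes> inv g \<in> M" if "g \<in> carrier G" "m \<in> M" for g m
  proof -
    \<comment> \<open>The normalizer of \<open>M\<close>; demanding both conjugates makes closure
      under inverses immediate.\<close>
    define N where "N = {g\<in>carrier G. \<forall>m\<in>M. g \<otimes> m \<otimes> inv g \<in> M \<and> inv g \<otimes> m \<otimes> g \<in> M}"
    have "subgroup N G"
    proof (rule subgroupI)
      show "N \<noteq> {}" using MG by (auto simp: N_def intro!: exI[of _ \<one>])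
      fix a b assume ab: "a \<in> N" "b \<in> N"
      hence G: "a \<in> carrier G" "b \<in> carrier G" by (auto simp: N_def)
      have "(a \<otimes> b) \<otimes> m \<otimes> inv (a \<otimes> b) \<in> M" "inv (a \<otimes> b) \<otimes> m \<otimes> (a \<otimes> b) \<in> M" if m: "m \<in> M" for m
      proof -
        have "(a \<otimes> b) \<otimes> m \<otimes> inv (a \<otimes> b) = a \<otimes> (b \<otimes> m \<otimes> inv b) \<otimes> inv a"
          "inv (a \<otimes> b) \<otimes> m \<otimes> (a \<otimes> b) = inv b \<otimes> (inv a \<otimes> m \<otimes> a) \<otimes> b"
          using G MG[OF m] by (simp_all add: inv_mult_group m_assoc)
        thus "(a \<otimes> b) \<otimes> m \<otimes> inv (a \<otimes> b) \<in> M" "inv (a \<otimes> b) \<otimes> m \<otimes> (a \<otimes> b) \<in> M"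
          using ab m by (auto simp: N_def)
      qed
      thus "a \<otimes> b \<in> N" using G by (simp add: N_def)
    qed (auto simp: N_def)
    moreover have "M \<subseteq> N" using MG cl by (auto simp: N_def)
    moreover have "h \<in> N"
    proof -
      have "h \<otimes> m \<otimes> inv h \<in> M \<and> inv h \<otimes> m \<otimes> h \<in> M" if m: "m \<in> M" for m
      proof
        have "h \<otimes> m \<otimes> inv h = (h \<otimes> m \<otimes> inv h \<otimes> inv m) \<otimes> m" using hG MG[OF m] by (simp add: m_assoc)
        thus "h \<otimes> m \<otimes> inv h \<in> M" using cl(1)[OF hx[OF MG[OF m]] m] by simp
        define y where "y = inv h \<otimes> m \<otimes> h"
        have y: "y \<in> carrier G" using hG MG[OF m] by (simp add: y_def)
        have "h \<otimes> y \<otimes> inv h = m" using hG MG[OF m] by (simp add: y_def m_assoc) (simp add: m_assoc[symmetric])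
        hence "m \<otimes> inv y \<in> M" using hx[OF y] by simp
        from cl(1)[OF cl(2)[OF this] m] have "y \<in> M" using y MG[OF m] by (simp add: inv_mult_group m_assoc)
        thus "inv h \<otimes> m \<otimes> h \<in> M" by (simp add: y_def)
      qed
      thus ?thesis using hG by (simp add: N_def)
    qed
    ultimately have "N = carrier G" using max h by blast
    thus ?thesis using that by (auto simp: N_def)
  qed
  \<comment> \<open>The preimage of the centre of the quotient by \<open>M\<close>, written with
    commutators. That it is a subgroup rests on the normality just shown.\<close>
  define Z where "Z = {g\<in>carrier G. \<forall>x\<in>carrier G. g \<otimes> x \<otimes> inv g \<otimes> inv x \<in> M}"
  have "subgroup Z G"
  proof (rule subgroupI)
    show "Z \<noteq> {}" using subgroup.one_closed[OF M(1)] by (auto simp: Z_def intro!: exI[of _ \<one>])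
    fix a assume a: "a \<in> Z"
    hence aG: "a \<in> carrier G" by (simp add: Z_def)
    have "inv a \<otimes> x \<otimes> inv (inv a) \<otimes> inv x \<in> M" if x: "x \<in> carrier G" for x
    proof -
      have "inv (a \<otimes> x \<otimes> inv a \<otimes> inv x) \<in> M" using a x cl(2) by (auto simp: Z_def)
      from conj[OF inv_closed[OF aG] this] show ?thesis using aG x by (simp add: inv_mult_group m_assoc)
    qed
    thus "inv a \<in> Z" using aG by (simp add: Z_def)
    fix b assume b: "b \<in> Z"
    hence bG: "b \<in> carrier G" by (simp add: Z_def)
    have "a \<otimes> b \<otimes> x \<otimes> inv (a \<otimes> b) \<otimes> inv x \<in> M" if x: "x \<in> carrier G" for x
    proof -
      have 1: "a \<otimes> (b \<otimes> x \<otimes> inv b \<otimes> inv x) \<otimes> inv a \<in> M" using b x by (intro conj[OF aG]) (auto simp: Z_def)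
      have 2: "a \<otimes> x \<otimes> inv a \<otimes> inv x \<in> M" using a x by (simp add: Z_def)
      have "inv x \<otimes> (inv a \<otimes> (a \<otimes> (x \<otimes> (inv a \<otimes> inv x)))) = inv a \<otimes> inv x"
        using aG x by (simp add: m_assoc[symmetric])
      thus ?thesis using cl(1)[OF 1 2] aG bG x by (simp add: inv_mult_group m_assoc)
    qed
    thus "a \<otimes> b \<in> Z" using aG bG by (simp add: Z_def)
  qed (auto simp: Z_def)
  moreover have "M \<subseteq> Z"
  proof
    fix m assume m: "m \<in> M"
    have "m \<otimes> x \<otimes> inv m \<otimes> inv x \<in> M" if x: "x \<in> carrier G" for x
      using cl(1)[OF m conj[OF x cl(2)[OF m]]] x MG[OF m] by (simp add: m_assoc)
    thus "m \<in> Z" using MG[OF m] by (simp add: Z_def)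
  qed
  moreover have "h \<in> Z" using hG hx by (simp add: Z_def)
  ultimately have "Z = carrier G" using max h by blast
  hence "\<forall>g\<in>carrier G. \<forall>h\<in>carrier G. g \<otimes> h \<otimes> inv g \<otimes> inv h \<in> M" by (auto simp: Z_def)
  thus ?thesis using M M\<A>(2) max by blast
qed


section \<open>Galois groups of number fields\<close>

lemma complex_field_simps [simp]:
  "carrier complex_field = UNIV" "monoid.mult complex_field = (*)" "ring.add complex_field = (+)"
  "\<one>\<^bsub>complex_field\<^esub> = 1" "\<zero>\<^bsub>complex_field\<^esub> = 0"
  by (simp_all add: ring_of_type_algebra_def)

interpretation cf: cring complex_field by (rule cring_from_type_algebra)

lemma complex_field_a_inv [simp]: "\<ominus>\<^bsub>complex_field\<^esub> x = - x"
  by (rule cf.minus_equality) auto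

lemma complex_field_m_inv: "x \<noteq> 0 \<Longrightarrow> inv\<^bsub>complex_field\<^esub> x = inverse x"
  by (rule cf.comm_inv_char) auto

lemma subfield_complexD:
  assumes "subfield K complex_field"
  shows "1 \<in> K" "x \<in> K \<Longrightarrow> y \<in> K \<Longrightarrow> x - y \<in> K" "x \<in> K \<Longrightarrow> y \<in> K \<Longrightarrow> x * y \<in> K" "x \<in> K \<Longrightarrow> inverse x \<in> K"
proof -
  have sr: "subring K complex_field" using subfieldE(1)[OF assms] .
  show "1 \<in> K" using subringE(3)[OF sr] by simp
  show "x - y \<in> K" if "x \<in> K" "y \<in> K" for x y
    using subringE(7)[OF sr that(1) subringE(5)[OF sr that(2)]] by simp
  show "x * y \<in> K" if "x \<in> K" "y \<in> K" using subringE(6)[OF sr that] by simp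
  show "inverse x \<in> K" if x: "x \<in> K"
  proof (cases "x = 0")
    case False
    thus ?thesis using cf.subfield_m_inv(1)[OF assms, of x] x complex_field_m_inv by simp
  qed (use x in auto)
qed

lemma Span_Rats_sum:
  assumes "x \<in> cf.Span \<rat> Us"
  shows "\<exists>c. (\<forall>b\<in>set Us. c b \<in> \<rat>) \<and> x = (\<Sum>b\<in>set Us. c b * b)"
  using assms
proof (induction Us arbitrary: x)
  case (Cons u Us)
  then obtain k v where kv: "k \<in> \<rat>" "v \<in> cf.Span \<rat> Us" "x = k * u + v"
    by (auto simp: cf.line_extension_mem_iff)
  obtain c where c: "\<forall>b\<in>set Us. c b \<in> \<rat>" "v = (\<Sum>b\<in>set Us. c b * b)" using Cons.IH[OF kv(2)] by blast
  show ?case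
  proof (cases "u \<in> set Us")
    case True
    have "v = c u * u + (\<Sum>b\<in>set Us - {u}. c b * b)" unfolding c(2) using True by (intro sum.remove) auto
    moreover have "(\<Sum>b\<in>set Us. (c(u := c u + k)) b * b) = (c u + k) * u + (\<Sum>b\<in>set Us - {u}. c b * b)"
      using True by (subst sum.remove[of _ u]) auto
    ultimately have "x = (\<Sum>b\<in>set (u # Us). (c(u := c u + k)) b * b)"
      using True kv(3) by (simp add: insert_absorb distrib_right)
    thus ?thesis using c(1) kv(1) True by (intro exI[of _ "c(u := c u + k)"]) auto
  next
    case False
    hence "x = (\<Sum>b\<in>set (u # Us). (c(u := k)) b * b)" using kv(3) c(2) by simp (intro sum.cong, auto)
    thus ?thesis using c(1) kv(1) by (intro exI[of _ "c(u := k)"]) auto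
  qed
qed auto

lemma subfield_Rats: "subfield \<rat> complex_field"
proof (rule field.subfieldI'[OF field_from_type_algebra])
  show "subring \<rat> complex_field" by (rule cf.subringI) (auto intro: Rats_minus_iff[THEN iffD2])
  show "inv\<^bsub>complex_field\<^esub> k \<in> \<rat>" if "k \<in> \<rat> - {\<zero>\<^bsub>complex_field\<^esub>}" for k
    using that by (simp add: complex_field_m_inv)
qed

lemma aut_group_carrier_iff:
  assumes K: "subfield K complex_field"
  shows "s \<in> carrier (aut_group K) \<longleftrightarrow> s \<in> Bij K \<and> (\<forall>x\<in>K. \<forall>y\<in>K. s (x + y) = s x + s y \<and> s (x * y) = s x * s y)
    \<and> s 1 = 1 \<and> (\<forall>q\<in>\<rat>. s q = q)"
  unfolding aut_group_def Ring.ring_hom_def using Bij_imp_funcset[of s K] by auto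

text \<open>Connects the automorphism group of the problem with the locale of the proof. The group
  laws are inherited from the bijections of \<open>K\<close>, among which the automorphisms form a
  subgroup.\<close>

lemma galois_field_aut_group:
  assumes gal: "finite_galois K" and fin: "finite (carrier (aut_group K))"
  shows "galois_field (aut_group K) K"
proof -
  have K: "subfield K complex_field" and fd: "cf.finite_dimension \<rat> K"
    and fixed: "{x \<in> K. \<forall>s \<in> carrier (aut_group K). s x = x} = \<rat>"
    using gal by (auto simp: finite_galois_def number_field_def)
  note Kc = subfield_complexD[OF K]
  have K0: "0 \<in> K" using Kc(2)[OF Kc(1) Kc(1)] by simp
  have Kadd: "x + y \<in> K" if "x \<in> K" "y \<in> K" for x y using Kc(2)[OF that(1) Kc(2)[OF K0 that(2)]] by simp
  note iff = aut_group_carrier_iff[OF K]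
  have carr: "s \<in> Bij K" "x \<in> K \<Longrightarrow> s x \<in> K" if "s \<in> carrier (aut_group K)" for s x
    using that Bij_imp_funcset[of s K] by (auto simp: iff)
  interpret B: group "BijGroup K" by (rule group_BijGroup)
  have "subgroup (carrier (aut_group K)) (BijGroup K)"
  proof (rule B.subgroupI)
    show sub: "carrier (aut_group K) \<subseteq> carrier (BijGroup K)" using carr by (auto simp: BijGroup_def)
    have RK: "\<rat> \<subseteq> K" using fixed by blast
    have "(\<lambda>x\<in>K. x) \<in> carrier (aut_group K)" using K0 Kc Kadd RK by (auto simp: iff id_Bij)
    thus "carrier (aut_group K) \<noteq> {}" by blast
    fix s assume s: "s \<in> carrier (aut_group K)"
    define t where "t = restrict (inv_into K s) K"
    have sB: "s \<in> Bij K" using carr s by blast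
    have tB: "t \<in> Bij K" unfolding t_def using sB by (rule restrict_inv_into_Bij)
    have tK: "t x \<in> K" "s (t x) = x" if "x \<in> K" for x
      using sB that by (auto simp: t_def Bij_def bij_betw_def f_inv_into_f inv_into_into)
    have inj: "x = y" if "x \<in> K" "y \<in> K" "s x = s y" for x y
      using sB that by (auto simp: Bij_def bij_betw_def inj_on_def)
    have "t \<in> carrier (aut_group K)"
      unfolding iff
    proof (intro conjI ballI)
      fix x y assume xy: "x \<in> K" "y \<in> K"
      show "t (x + y) = t x + t y" by (rule inj) (use s xy tK in \<open>simp_all add: iff Kadd\<close>)
      show "t (x * y) = t x * t y" by (rule inj) (use s xy tK in \<open>simp_all add: iff Kc(3)\<close>)
    next
      show "t 1 = 1" by (rule inj) (use s tK[OF Kc(1)] Kc(1) in \<open>simp_all add: iff\<close>)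
      fix q :: complex assume "q \<in> \<rat>"
      hence q: "q \<in> K" "s q = q" using RK s by (auto simp: iff)
      show "t q = q" by (rule inj) (use q tK in simp_all)
    qed (rule tB)
    thus "inv\<^bsub>BijGroup K\<^esub> s \<in> carrier (aut_group K)" using inv_BijGroup[OF sB] by (simp add: t_def)
    fix r assume r: "r \<in> carrier (aut_group K)"
    have "compose K s r \<in> carrier (aut_group K)"
      unfolding iff using r s carr RK
      by (auto simp: iff compose_eq Kadd Kc(3) Kc(1) compose_Bij subset_iff)
    thus "s \<otimes>\<^bsub>BijGroup K\<^esub> r \<in> carrier (aut_group K)" using carr r s by (simp add: BijGroup_def)
  qed
  hence grp: "group (aut_group K)"
    using subgroup.subgroup_is_group[of "carrier (aut_group K)" "BijGroup K"] B.group_axioms by (simp add: aut_group_def)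
  have mult: "(s \<otimes>\<^bsub>aut_group K\<^esub> t) x = s (t x)" if "s \<in> carrier (aut_group K)" "t \<in> carrier (aut_group K)" "x \<in> K" for s t x
  proof -
    have "monoid.mult (aut_group K) = monoid.mult (BijGroup K)" by (simp add: aut_group_def)
    thus ?thesis using that carr by (simp add: BijGroup_def compose_eq)
  qed
  have findim: "\<exists>B. finite B \<and> B \<subseteq> K \<and> (\<forall>x\<in>K. \<exists>c. (\<forall>b\<in>B. c b \<in> \<rat>) \<and> x = (\<Sum>b\<in>B. c b * b))"
  proof -
    obtain Us where Us: "cf.Span \<rat> Us = K"
      using cf.exists_base[OF subfield_Rats cf.finite_dimensionE[OF subfield_Rats fd]] by blast
    have "set Us \<subseteq> K" using cf.Span_base_incl[OF subfield_Rats, of Us] Us by simp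
    thus ?thesis using Span_Rats_sum[of _ Us] Us by (intro exI[of _ "set Us"]) auto
  qed
  show ?thesis
    unfolding galois_field_def galois_field_axioms_def
  proof (intro conjI allI impI grp fin findim)
    fix s t x y
    show "1 \<in> K" by (rule Kc)
    show "x \<in> K \<Longrightarrow> y \<in> K \<Longrightarrow> x - y \<in> K" "x \<in> K \<Longrightarrow> y \<in> K \<Longrightarrow> x * y \<in> K" "x \<in> K \<Longrightarrow> inverse x \<in> K"
      by (rule Kc; assumption)+
    assume s: "s \<in> carrier (aut_group K)"
    show "x \<in> K \<Longrightarrow> s x \<in> K" using carr s by blast
    show "x \<in> K \<Longrightarrow> y \<in> K \<Longrightarrow> s (x + y) = s x + s y" "x \<in> K \<Longrightarrow> y \<in> K \<Longrightarrow> s (x * y) = s x * s y"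
      using s by (auto simp: iff)
    assume t: "t \<in> carrier (aut_group K)"
    show "x \<in> K \<Longrightarrow> (s \<otimes>\<^bsub>aut_group K\<^esub> t) x = s (t x)" using mult s t by blast
    assume "\<forall>x. x \<in> K \<longrightarrow> s x = t x"
    thus "s = t" using carr(1)[OF s] carr(1)[OF t] by (auto simp: Bij_def intro: extensionalityI)
  next
    fix x assume "x \<in> K"
    thus "\<one>\<^bsub>aut_group K\<^esub> x = x" by (simp add: aut_group_def BijGroup_def)
  next
    fix x assume "x \<in> K" "\<forall>s. s \<in> carrier (aut_group K) \<longrightarrow> s x = x"
    thus "x \<in> \<rat>" using fixed by blast
  qed
qed

section \<open>Counting odd prime divisors, and the bound on the number of generators\<close>

lemma prod_distinct_primes_dvd:
  assumes "finite Q" "\<And>q. q \<in> Q \<Longrightarrow> prime q \<and> q dvd (n::nat)"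
  shows "\<Prod>Q dvd n"
  using assms
proof (induction Q rule: finite_induct)
  case (insert q Q)
  have "coprime q r" if "r \<in> Q" for r
    using primes_coprime[of q r] insert that by auto
  hence "coprime q (\<Prod>Q)" by (intro prod_coprime_right)
  thus ?case using insert by (auto intro!: divides_mult)
qed simp

lemma card_odd_prime_divisors_le_ln:
  fixes n :: nat
  assumes n: "n > 0"
  shows "real (card {p. prime p \<and> p dvd n \<and> p \<noteq> 2}) \<le> ln (real n)"
proof -
  define Q where "Q = {p. prime p \<and> p dvd n \<and> p \<noteq> 2}"
  have fin: "finite Q" using n by (intro finite_subset[of Q "{d. d dvd n}"]) (auto simp: Q_def)
  have "3 ^ card Q \<le> \<Prod>Q"
  proof -
    have "(\<Prod>q\<in>Q. 3) \<le> \<Prod>Q"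
    proof (intro prod_mono conjI)
      fix q assume "q \<in> Q"
      hence "prime q" "q \<noteq> 2" by (auto simp: Q_def)
      thus "3 \<le> q" using prime_ge_2_nat[of q] by linarith
    qed auto
    thus ?thesis by simp
  qed
  also have "\<Prod>Q \<le> n" using prod_distinct_primes_dvd[OF fin, of n] n by (intro dvd_imp_le) (auto simp: Q_def)
  finally have "real (3 ^ card Q) \<le> real n" by (simp only: of_nat_le_iff)
  hence "ln (3 ^ card Q) \<le> ln (real n)" by (intro ln_mono) auto
  hence "real (card Q) * ln 3 \<le> ln (real n)" by (simp add: ln_realpow)
  moreover have "ln 3 \<ge> (1::real)" using exp_le ln_ge_iff[of 3 1] by simp
  hence "real (card Q) * 1 \<le> real (card Q) * ln 3" by (intro mult_left_mono) auto
  ultimately show ?thesis by (simp add: Q_def)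
qed

theorem proposition3p2:
  fixes n :: nat and G :: "('a, 'b) monoid_scheme"
  assumes "n > 0" and "squarefree n"
    and "G \<in> pi_A_t n"
    and "nilpotent_group G"
  shows "real (min_generators G) \<le> ln (real n)"
proof -
  obtain K where G: "group G" "finite (carrier G)" and gal: "finite_galois K" and iso: "aut_group K \<cong> G"
    and unr: "\<And>p. prime p \<Longrightarrow> \<not> p dvd n \<Longrightarrow> unramified_at K p"
    and tam: "\<And>p. prime p \<Longrightarrow> tamely_ramified_at K p"
    using assms(3) by (auto simp: pi_A_t_def)
  define A where "A = aut_group K"
  obtain \<psi> where \<psi>: "\<psi> \<in> iso A G" using iso by (auto simp: is_iso_def A_def)
  have bij: "bij_betw \<psi> (carrier A) (carrier G)" using \<psi> by (simp add: iso_def)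
  have fin: "finite (carrier A)" using G bij bij_betw_finite by blast
  interpret G: group G by (rule G)
  interpret A: galois_field A K unfolding A_def by (rule galois_field_aut_group[OF gal fin[unfolded A_def]])
  interpret \<psi>: group_hom A G \<psi> using \<psi> by unfold_locales (simp add: iso_def)
  define Q where "Q = {p. prime p \<and> p dvd n \<and> p \<noteq> 2}"
  have finQ: "finite Q" using assms(1) by (intro finite_subset[of Q "{d. d dvd n}"]) (auto simp: Q_def)
  have tame: "coprime (ramification_index K p P) p" if "prime p" "P \<in> primes_above K p" for p P
    using tam[OF that(1)] that(2) by (simp add: tamely_ramified_at_def)
  have inert: "galois_prime.inertia A K P = A.inertia_at P" if "prime p" "P \<in> primes_above K p" for p P
    using galois_prime.inertia_def[OF galois_prime_over.axioms(1)[OF A.primes_above_imp_over[OF that(2,1)]]]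
    by (simp add: A.inertia_at_def)
  \<comment> \<open>If no prime lies above \<open>p\<close>, an arbitrary group element serves as
    default value.\<close>
  have "\<exists>g\<in>carrier A. primes_above K p \<noteq> {} \<longrightarrow> (\<exists>P\<in>primes_above K p. A.inertia_at P \<subseteq> generate A {g})" if p: "p \<in> Q" for p
  proof (cases "primes_above K p = {}")
    case False
    then obtain P where P: "P \<in> primes_above K p" by blast
    have pp: "prime p" using p by (simp add: Q_def)
    from galois_prime_over.tame_inertia(2)[OF A.primes_above_imp_over[OF P pp] tame[OF pp P]]
    obtain g where "g \<in> A.inertia_at P" "A.inertia_at P \<subseteq> generate A {g}" unfolding inert[OF pp P] by blast
    thus ?thesis using P by (auto simp: A.inertia_at_def)
  qed auto
  then obtain gen where gen: "\<And>p. p \<in> Q \<Longrightarrow> gen p \<in> carrier A"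
    "\<And>p. p \<in> Q \<Longrightarrow> primes_above K p \<noteq> {} \<Longrightarrow> \<exists>P\<in>primes_above K p. A.inertia_at P \<subseteq> generate A {gen p}" by metis
  define S where "S = (\<lambda>p. \<psi> (gen p)) ` Q"
  have S: "S \<subseteq> carrier G" "finite S" using gen(1) finQ by (auto simp: S_def)
  have "generate G S = carrier G"
  proof (rule ccontr)
    assume "generate G S \<noteq> carrier G"
    from G.nilpotent_maximal_subgroup[OF G(2) assms(4) G.generate_is_subgroup[OF S(1)] this]
    obtain N where N: "subgroup N G" "generate G S \<subseteq> N" "N \<noteq> carrier G"
      "\<forall>H. subgroup H G \<longrightarrow> N \<subseteq> H \<longrightarrow> H = N \<or> H = carrier G"
      "\<forall>g\<in>carrier G. \<forall>h\<in>carrier G. g \<otimes>\<^bsub>G\<^esub> h \<otimes>\<^bsub>G\<^esub> inv\<^bsub>G\<^esub> g \<otimes>\<^bsub>G\<^esub> inv\<^bsub>G\<^esub> h \<in> N"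
      by (elim exE conjE) (rule that)
    \<comment> \<open>The maximal subgroup was found in \<open>G\<close>; its preimage moves the
      argument to the automorphism group, where inertia lives.\<close>
    define M where "M = {s \<in> carrier A. \<psi> s \<in> N}"
    have M: "subgroup M A"
      using subgroup.m_closed[OF N(1)] subgroup.m_inv_closed[OF N(1)] subgroup.one_closed[OF N(1)]
      by (intro A.subgroupI) (auto simp: M_def)
    have comm: "g \<otimes>\<^bsub>A\<^esub> h \<otimes>\<^bsub>A\<^esub> inv\<^bsub>A\<^esub> g \<otimes>\<^bsub>A\<^esub> inv\<^bsub>A\<^esub> h \<in> M" if "g \<in> carrier A" "h \<in> carrier A" for g h
      using that N(5) by (simp add: M_def)
    have normal: "s \<otimes>\<^bsub>A\<^esub> m \<otimes>\<^bsub>A\<^esub> inv\<^bsub>A\<^esub> s \<in> M" if "s \<in> carrier A" "m \<in> M" for s m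
    proof -
      have m: "m \<in> carrier A" using that by (simp add: M_def)
      have "s \<otimes>\<^bsub>A\<^esub> m \<otimes>\<^bsub>A\<^esub> inv\<^bsub>A\<^esub> s = s \<otimes>\<^bsub>A\<^esub> m \<otimes>\<^bsub>A\<^esub> inv\<^bsub>A\<^esub> s \<otimes>\<^bsub>A\<^esub> inv\<^bsub>A\<^esub> m \<otimes>\<^bsub>A\<^esub> m"
        using that(1) m by (simp add: A.m_assoc)
      thus ?thesis using subgroup.m_closed[OF M comm[OF that(1) m] that(2)] by simp
    qed
    have inertM: "A.inertia_at P \<subseteq> M" if p: "prime p" and P: "P \<in> primes_above K p" for p P
    proof -
      interpret P: galois_prime_over A K P p by (rule A.primes_above_imp_over[OF P p])
      consider "\<not> p dvd n" | "p = 2" | "p \<in> Q" using p by (auto simp: Q_def)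
      thus ?thesis
      proof cases
        case 1
        hence "ramification_index K p P = 1" using unr[OF p] P by (simp add: unramified_at_def)
        from P.unramified_inertia[OF this] show ?thesis
          using subgroup.one_closed[OF M] inert[OF p P] by simp
      next
        case 2
        obtain f where f: "f \<in> carrier A" "\<And>s. s \<in> A.inertia_at P \<Longrightarrow> f \<otimes>\<^bsub>A\<^esub> s \<otimes>\<^bsub>A\<^esub> inv\<^bsub>A\<^esub> f = s [^]\<^bsub>A\<^esub> p"
          using P.tame_inertia(3)[OF tame[OF p P]] unfolding inert[OF p P] by blast
        show ?thesis
        proof
          fix s assume s: "s \<in> A.inertia_at P"
          hence sA: "s \<in> carrier A" by (simp add: A.inertia_at_def)
          have "f \<otimes>\<^bsub>A\<^esub> s \<otimes>\<^bsub>A\<^esub> inv\<^bsub>A\<^esub> f \<otimes>\<^bsub>A\<^esub> inv\<^bsub>A\<^esub> s = s"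
            using f(2)[OF s] sA 2 by (simp add: numeral_2_eq_2 A.m_assoc)
          thus "s \<in> M" using comm[OF f(1) sA] by simp
        qed
      next
        case 3
        obtain P0 where P0: "P0 \<in> primes_above K p" "A.inertia_at P0 \<subseteq> generate A {gen p}" using gen(2)[OF 3] P by blast
        have "\<psi> (gen p) \<in> N" using N(2) 3 by (auto simp: S_def intro: generate.incl)
        hence "{gen p} \<subseteq> M" using gen(1)[OF 3] by (simp add: M_def)
        hence "generate A {gen p} \<subseteq> M" using A.generate_subgroup_incl M by blast
        thus ?thesis using A.inertia_at_conj[OF P0(1) P p _ normal] P0(2) by blast
      qed
    qed
    have tameM: "\<not> p dvd card (A.inertia_at P \<inter> M)" if p: "prime p" and P: "P \<in> primes_above K p" for p P
      using galois_prime_over.tame_inertia(1)[OF A.primes_above_imp_over[OF P p] tame[OF p P] M]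
      unfolding inert[OF p P] .
    interpret U: galois_unramified A K M
      using galois_unramified.intro[OF A.galois_field_axioms galois_unramified_axioms.intro[OF M normal inertM tameM]] .
    show False
    proof (rule U.no_unramified_extension)
      show "M \<noteq> carrier A"
      proof
        assume "M = carrier A"
        hence "\<psi> ` carrier A \<subseteq> N" by (auto simp: M_def)
        hence "carrier G \<subseteq> N" using bij by (simp add: bij_betw_def)
        thus False using N(3) subgroup.subset[OF N(1)] by blast
      qed
      fix H assume H: "subgroup H A" "M \<subseteq> H"
      have HA: "H \<subseteq> carrier A" using subgroup.subset[OF H(1)] .
      \<comment> \<open>Maximality of \<open>M\<close> is transferred from that of \<open>N\<close>
        through the images of subgroups under the isomorphism.\<close>
      have "N \<subseteq> \<psi> ` H"
      proof
        fix x assume x: "x \<in> N"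
        hence "x \<in> \<psi> ` carrier A" using bij subgroup.mem_carrier[OF N(1)] by (simp add: bij_betw_def)
        thus "x \<in> \<psi> ` H" using H(2) x by (auto simp: M_def)
      qed
      hence "\<psi> ` H = N \<or> \<psi> ` H = carrier G" using N(4) \<psi>.subgroup_img_is_subgroup[OF H(1)] by blast
      thus "H = M \<or> H = carrier A"
      proof
        assume "\<psi> ` H = N"
        hence "H \<subseteq> M" using HA by (auto simp: M_def)
        thus ?thesis using H(2) by blast
      next
        assume "\<psi> ` H = carrier G"
        hence "\<psi> ` H = \<psi> ` carrier A" using bij by (simp add: bij_betw_def)
        thus ?thesis using bij HA inj_on_image_eq_iff[of \<psi> "carrier A" H "carrier A"] by (simp add: bij_betw_def)
      qed
    qed
  qed
  hence "min_generators G \<le> card S"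
    unfolding min_generators_def using S by (intro Least_le) auto
  also have "card S \<le> card Q" unfolding S_def using finQ by (rule card_image_le)
  finally have "real (min_generators G) \<le> real (card Q)" by simp
  also have "\<dots> \<le> ln (real n)" unfolding Q_def using assms(1) by (rule card_odd_prime_divisors_le_ln)
  finally show ?thesis .
qed

end
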